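(* Let $\alpha>-1$ and let $X=\{(\lambda,m_\lambda)\}_{\lambda\in\Lambda}$ be a divisor in $\mathbb{D}$. (a) If $X$ is an interpolating divisor for $\mathcal{A}^2_\alpha$, then there exists $C_X>0$ such that the disks $$\left\{D\left(\lambda,\sqrt{\frac{m_\lambda-C_X}{m_\lambda+\alpha+1}}\right)\right\}_{\lambda\in\Lambda,\ m_\lambda>C_X}$$ are pairwise disjoint. (b) Conversely, if for some $C_X$ with $(\alpha+1)(1-e^{-1})<C_X<\alpha+1$ the disks $$\left\{D\left(\lambda,\sqrt{\frac{m_\lambda+C_X}{m_\lambda+\alpha+1}}\right)\right\}_{\lambda\in\Lambda}$$ are pairwise disjoint, then $X$ is an interpolating divisor for $\mathcal{A}^2_\alpha$.
   Context: $\mathbb{D}$ is the open unit disk in $\mathbb{C}$. For $\alpha>-1$, $\mathcal{A}^2_\alpha$ is the space of holomorphic functions $f$ on $\mathbb{D}$ with $\|f\|_{\alpha,2}^2=\int_{\mathbb{D}}|f|^2\,dA_\alpha<\infty$, where $dA_\alpha(z)=(1+\alpha)(1-|z|^2)^\alpha\,dx\,dy/\pi$, with scalar product $\langle f,g\rangle=\int_{\mathbb{D}} f\overline{g}\,dA_\alpha$. Its standard orthonormal basis is $e_n(z)=\sqrt{\frac{\Gamma(n+2+\alpha)}{n!\,\Gamma(2+\alpha)}}\,z^n$, $n\ge 0$. For $\lambda\in\mathbb{D}$ put $\varphi_\lambda(z)=\frac{\lambda-z}{1-\overline{\lambda}z}$ and let $T_\lambda f(z)=[\varphi_\lambda'(z)]^{(2+\alpha)/2}f(\varphi_\lambda(z))$,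 an isometry of $\mathcal{A}^2_\alpha$ (a holomorphic branch of the power is fixed; changing it only multiplies $T_\lambda$ by a unimodular constant and is immaterial here). The pseudohyperbolic distance is $\rho(u,v)=|\varphi_u(v)|$ and $D(\lambda,r)=\{z\in\mathbb{D}:\rho(\lambda,z)<r\}$. A divisor is a set $X=\{(\lambda,m_\lambda)\}_{\lambda\in\Lambda}$, where $\Lambda\subset\mathbb{D}$ is a set of (distinct) points and each $m_\lambda\ge 1$ is an integer (multiplicity). Let $\ell^2(X)$ be the set of families of complex numbers $v=(v_\lambda^j)_{\lambda\in\Lambda,\,0\le j<m_\lambda}$ with $\sum_{\lambda\in\Lambda}\sum_{j<m_\lambda}|v_\lambda^j|^2<\infty$. $X$ is interpolating for $\mathcal{A}^2_\alpha$ if for every $v\in\ell^2(X)$ there exists $f\in\mathcal{A}^2_\alpha$ such that $\langle f,T_\lambda e_j\rangle=v_\lambda^j$ for all $\lambda\in\Lambda$ and $0\le j<m_\lambda$. *)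

theory Defs
  imports "HOL-Analysis.Analysis"
begin

text \<open>The carrier is restricted to the disk, so that measurability and integrability
  with respect to this measure do not depend on values outside the disk.\<close>

definition bergman_measure :: "real \<Rightarrow> complex measure" where
  "bergman_measure \<alpha> =
     density (restrict_space lborel (ball 0 1))
       (\<lambda>z. ennreal ((1 + \<alpha>) * (1 - (cmod z)\<^sup>2) powr \<alpha> / pi))"

definition bergman_space :: "real \<Rightarrow> (complex \<Rightarrow> complex) set" where
  "bergman_space \<alpha> =
     {f. f holomorphic_on ball 0 1 \<and> integrable (bergman_measure \<alpha>) (\<lambda>z. (cmod (f z))\<^sup>2)}"

definition bergman_inner :: "real \<Rightarrow> (complex \<Rightarrow> complex) \<Rightarrow> (complex \<Rightarrow> complex) \<Rightarrow> complex" where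
  "bergman_inner \<alpha> f g = (LINT z|bergman_measure \<alpha>. f z * cnj (g z))"

definition bergman_basis :: "real \<Rightarrow> nat \<Rightarrow> complex \<Rightarrow> complex" where
  "bergman_basis \<alpha> n z =
     of_real (sqrt (Gamma (real n + 2 + \<alpha>) / (fact n * Gamma (2 + \<alpha>)))) * z ^ n"

definition disk_aut :: "complex \<Rightarrow> complex \<Rightarrow> complex" where
  "disk_aut w z = (w - z) / (1 - cnj w * z)"

text \<open>A holomorphic branch of the power with exponent \<open>s\<close> of the derivative of \<open>disk_aut w\<close>
  is \<open>exp (s * L)\<close> for a holomorphic logarithm \<open>L\<close> of that derivative. (The principal power \<open>powr\<close> would not do: it is
  discontinuous where the derivative crosses the negative real axis.)\<close>

definition deriv_log_branch :: "complex \<Rightarrow> (complex \<Rightarrow> complex) \<Rightarrow> bool" where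
  "deriv_log_branch w L \<longleftrightarrow>
     L holomorphic_on ball 0 1 \<and> (\<forall>z\<in>ball 0 1. exp (L z) = deriv (disk_aut w) z)"

definition bergman_shift ::
    "real \<Rightarrow> (complex \<Rightarrow> complex) \<Rightarrow> complex \<Rightarrow> (complex \<Rightarrow> complex) \<Rightarrow> complex \<Rightarrow> complex" where
  "bergman_shift \<alpha> L w f z = exp (of_real ((2 + \<alpha>) / 2) * L z) * f (disk_aut w z)"

definition pseudohyp_dist :: "complex \<Rightarrow> complex \<Rightarrow> real" where
  "pseudohyp_dist u v = cmod (disk_aut u v)"

definition pseudohyp_disk :: "complex \<Rightarrow> real \<Rightarrow> complex set" where
  "pseudohyp_disk w r = {z \<in> ball 0 1. pseudohyp_dist w z < r}"

text \<open>A divisor is given by its set of points \<open>\<Lambda>\<close> and a multiplicity function \<open>m\<close>, of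
  which only the values on \<open>\<Lambda>\<close> matter.\<close>

definition divisor :: "complex set \<Rightarrow> (complex \<Rightarrow> nat) \<Rightarrow> bool" where
  "divisor \<Lambda> m \<longleftrightarrow> \<Lambda> \<subseteq> ball 0 1 \<and> (\<forall>w\<in>\<Lambda>. m w \<ge> 1)"

definition ell2 :: "complex set \<Rightarrow> (complex \<Rightarrow> nat) \<Rightarrow> (complex \<Rightarrow> nat \<Rightarrow> complex) set" where
  "ell2 \<Lambda> m = {v. (\<lambda>w. \<Sum>j<m w. (cmod (v w j))\<^sup>2) summable_on \<Lambda>}"

text \<open>\<open>L w\<close> is the logarithm branch used to define the isometry at the point \<open>w\<close>.\<close>

definition interpolating ::
    "real \<Rightarrow> (complex \<Rightarrow> complex \<Rightarrow> complex) \<Rightarrow> complex set \<Rightarrow> (complex \<Rightarrow> nat) \<Rightarrow> bool" where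
  "interpolating \<alpha> L \<Lambda> m \<longleftrightarrow>
     (\<forall>v\<in>ell2 \<Lambda> m. \<exists>f\<in>bergman_space \<alpha>. \<forall>w\<in>\<Lambda>. \<forall>j<m w.
        bergman_inner \<alpha> f (bergman_shift \<alpha> (L w) w (bergman_basis \<alpha> j)) = v w j)"

lemma deriv_log_branch_exists:
  assumes "w \<in> ball 0 1"
  shows "\<exists>L. deriv_log_branch w L"
proof -
  define L where "L = (\<lambda>z. Ln (of_real ((cmod w)\<^sup>2 - 1)) - 2 * Ln (1 - cnj w * z))"
  have lam: "cmod w < 1" using assms by simp
  hence lam2: "(cmod w)\<^sup>2 < 1" by (simp add: abs_square_less_1)
  have re: "Re (1 - cnj w * z) > 0" if "z \<in> ball 0 1" for z
  proof -
    have "cmod w * cmod z < 1"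
      using mult_strict_mono'[of "cmod w" 1 "cmod z" 1] lam that by simp
    hence "cmod (cnj w * z) < 1" by (simp add: norm_mult)
    thus ?thesis using complex_Re_le_cmod[of "cnj w * z"] by simp
  qed
  have nz: "1 - cnj w * z \<noteq> 0" if "z \<in> ball 0 1" for z
    using re[OF that] by fastforce
  have "L holomorphic_on ball 0 1"
    unfolding L_def
    by (intro holomorphic_intros) (use re in \<open>auto simp: complex_nonpos_Reals_iff\<close>, force)
  moreover have "exp (L z) = deriv (disk_aut w) z" if z: "z \<in> ball 0 1" for z
  proof -
    have nl: "complex_of_real ((cmod w)\<^sup>2 - 1) \<noteq> 0"
      using lam2 by (simp only: of_real_eq_0_iff)
    have cn: "complex_of_real (cmod w) * complex_of_real (cmod w) = w * cnj w"
      using complex_norm_square[of w] by (simp add: power2_eq_square)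
    have "exp (L z) = of_real ((cmod w)\<^sup>2 - 1) / (1 - cnj w * z)\<^sup>2"
      using nl nz[OF z] by (simp add: L_def exp_diff exp_double)
    moreover have "(disk_aut w has_field_derivative
        of_real ((cmod w)\<^sup>2 - 1) / (1 - cnj w * z)\<^sup>2) (at z)"
      unfolding disk_aut_def
      by (rule derivative_eq_intros refl nz[OF z])+
         (use nz[OF z] cn in \<open>simp add: field_simps power2_eq_square\<close>)
    ultimately show ?thesis by (simp add: DERIV_imp_deriv)
  qed
  ultimately show ?thesis unfolding deriv_log_branch_def by blast
qed

end

theory Submission
  imports Defs "HOL-Complex_Analysis.Complex_Analysis"
begin

text \<open>
Necessity: an interpolating divisor admits no sequence of pairs \<open>(w, u)\<close> for which the spans of \<open>T_w e_j\<close>,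
\<open>j < m w\<close>, and of \<open>T_u e_j\<close>, \<open>j < m u\<close>, contain unit vectors arbitrarily close to each other. If the disks of \<open>w\<close>
and \<open>u\<close> meet at \<open>z0\<close>, both spans nearly contain the normalised reproducing kernel at \<open>z0\<close>.

Sufficiency: for finite sets of points it suffices to bound the functions \<open>g_w = \<Sum>j<m w. c w j * T_w e_j\<close> by their
sum \<open>G\<close>, uniformly; a limiting argument does the rest. Each \<open>g_w (1 - |z|\<^sup>2) powr \<alpha>\<close> is the \<open>z\<close>-derivative of an explicit
function vanishing on the circle, with a pole of order \<open>m w\<close> in the conjugate variable at \<open>w\<close>. The a priori inequality of the
weighted d-bar problem, applied to the sum \<open>U\<close> of these functions, bounds \<open>U\<close> by \<open>G\<close>; its weight cancels the poles and is
modified only inside the given disks, whose size leaves enough curvature. On an annulus inside its disk the weight is unmodified, and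
cutting off there recovers \<open>g_w\<close> from \<open>G\<close> and \<open>U\<close> by Stokes' theorem.
\<close>

section \<open>Wirtinger derivatives\<close>

text \<open>All bounds must be uniform in the multiplicities m, and the radii permit it. With s =
  |\<open>disk_aut w z\<close>|^2, the weight is modified for s < m/(m+a), while the given disk is s
  < (m+C)/(m+\<alpha>+1). If a > \<alpha>+1-C, then 1-s at the second radius is at most a fixed
  fraction, independent of m, of 1-s at the first, which leaves an annulus thick enough for cutting
  off at bounded cost. The curvature budget is \<alpha>+1. Applying the energy identity to
  (1-|z|^2)^p U in place of U adds 2p to the curvature \<alpha> of the original weight and costs
  p^2; p = 1 is optimal. The modification spends 2a: the simplest weight would spend only a, but its
  second derivative jumps, and the square that smooths it doubles the loss. The two demands a >
  \<alpha>+1-C and 2a < \<alpha>+1 are compatible exactly when C > (\<alpha>+1)/2, which holds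
  because 1 - 1/e > 1/2. Necessity extracts no uniform interpolation constant. It uses one datum
  with masses of order 2^-k at infinitely many pairs whose spans come within order 4^-k.\<close>

definition wirtinger ::
  "complex set \<Rightarrow> (complex \<Rightarrow> complex) \<Rightarrow> (complex \<Rightarrow> complex) \<Rightarrow> (complex \<Rightarrow> complex) \<Rightarrow> bool" where
  "wirtinger S f a b \<longleftrightarrow>
     (\<forall>z\<in>S. (f has_derivative (\<lambda>h. a z * h + b z * cnj h)) (at z)) \<and>
     continuous_on S a \<and> continuous_on S b"

lemma wirtingerD:
  assumes "wirtinger S f a b" "z \<in> S"
  shows "(f has_derivative (\<lambda>h. a z * h + b z * cnj h)) (at z)"
  using assms by (auto simp: wirtinger_def)

lemma wirtinger_continuous:
  assumes "wirtinger S f a b"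
  shows "continuous_on S f" "continuous_on S a" "continuous_on S b"
proof -
  show "continuous_on S f"
    using has_derivative_continuous[OF wirtingerD[OF assms]]
    by (intro continuous_at_imp_continuous_on ballI)
qed (use assms in \<open>auto simp: wirtinger_def\<close>)

lemma wirtinger_subset: "wirtinger S f a b \<Longrightarrow> T \<subseteq> S \<Longrightarrow> wirtinger T f a b"
  unfolding wirtinger_def by (meson continuous_on_subset subsetD)

lemma wirtinger_cong:
  assumes "wirtinger S f a b" "\<And>z. z \<in> S \<Longrightarrow> a z = a' z" "\<And>z. z \<in> S \<Longrightarrow> b z = b' z"
  shows "wirtinger S f a' b'"
  using assms unfolding wirtinger_def by (auto cong: continuous_on_cong)

lemma wirtinger_cong_fun:
  assumes "wirtinger S f a b" "open S" "\<And>z. z \<in> S \<Longrightarrow> f z = g z"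
  shows "wirtinger S g a b"
  unfolding wirtinger_def
proof (intro conjI ballI)
  fix z assume z: "z \<in> S"
  show "(g has_derivative (\<lambda>h. a z * h + b z * cnj h)) (at z)"
    by (rule has_derivative_transform_within_open[OF wirtingerD[OF assms(1) z] assms(2) z])
       (use assms(3) in auto)
qed (use assms(1) in \<open>auto simp: wirtinger_def\<close>)

lemma wirtinger_const: "wirtinger S (\<lambda>_. c) (\<lambda>_. 0) (\<lambda>_. 0)"
  by (simp add: wirtinger_def)

lemma wirtinger_holomorphic:
  assumes "open S" "f holomorphic_on S"
  shows "wirtinger S f (deriv f) (\<lambda>_. 0)"
  unfolding wirtinger_def
proof (intro conjI ballI)
  fix z assume "z \<in> S"
  then have "(f has_field_derivative deriv f z) (at z)"
    using assms by (simp add: holomorphic_derivI)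
  then show "(f has_derivative (\<lambda>h. deriv f z * h + 0 * cnj h)) (at z)"
    by (simp add: has_field_derivative_def)
qed (use assms holomorphic_deriv holomorphic_on_imp_continuous_on in auto)

lemma wirtinger_cnj:
  assumes "wirtinger S f a b"
  shows "wirtinger S (\<lambda>z. cnj (f z)) (\<lambda>z. cnj (b z)) (\<lambda>z. cnj (a z))"
  unfolding wirtinger_def
proof (intro conjI ballI)
  fix z assume "z \<in> S"
  from has_derivative_compose[OF wirtingerD[OF assms this]
      bounded_linear_imp_has_derivative[OF bounded_linear_cnj]]
  show "((\<lambda>z. cnj (f z)) has_derivative (\<lambda>h. cnj (b z) * h + cnj (a z) * cnj h)) (at z)"
    by (simp add: add.commute)
qed (use assms in \<open>auto simp: wirtinger_def intro!: continuous_intros\<close>)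

lemma wirtinger_add:
  assumes "wirtinger S f a b" "wirtinger S g c d"
  shows "wirtinger S (\<lambda>z. f z + g z) (\<lambda>z. a z + c z) (\<lambda>z. b z + d z)"
  unfolding wirtinger_def
proof (intro conjI ballI)
  fix z assume "z \<in> S"
  from has_derivative_add[OF wirtingerD[OF assms(1) this] wirtingerD[OF assms(2) this]]
  show "((\<lambda>z. f z + g z) has_derivative (\<lambda>h. (a z + c z) * h + (b z + d z) * cnj h)) (at z)"
    by (simp add: algebra_simps)
qed (use assms in \<open>auto simp: wirtinger_def intro!: continuous_intros\<close>)

lemma wirtinger_mult:
  assumes "wirtinger S f a b" "wirtinger S g c d"
  shows "wirtinger S (\<lambda>z. f z * g z) (\<lambda>z. a z * g z + f z * c z) (\<lambda>z. b z * g z + f z * d z)"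
  unfolding wirtinger_def
proof (intro conjI ballI)
  fix z assume "z \<in> S"
  from has_derivative_mult[OF wirtingerD[OF assms(1) this] wirtingerD[OF assms(2) this]]
  show "((\<lambda>z. f z * g z) has_derivative
      (\<lambda>h. (a z * g z + f z * c z) * h + (b z * g z + f z * d z) * cnj h)) (at z)"
    by (simp add: algebra_simps)
qed (use assms wirtinger_continuous[OF assms(1)] wirtinger_continuous[OF assms(2)] in
     \<open>auto simp: wirtinger_def intro!: continuous_intros\<close>)

lemma wirtinger_cmult:
  "wirtinger S f a b \<Longrightarrow> wirtinger S (\<lambda>z. c * f z) (\<lambda>z. c * a z) (\<lambda>z. c * b z)"
  using wirtinger_mult[OF wirtinger_const[of S c]] by simp

lemma wirtinger_minus:
  "wirtinger S f a b \<Longrightarrow> wirtinger S (\<lambda>z. - f z) (\<lambda>z. - a z) (\<lambda>z. - b z)"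
  using wirtinger_cmult[of S f a b "-1"] by simp

lemma wirtinger_diff:
  assumes "wirtinger S f a b" "wirtinger S g c d"
  shows "wirtinger S (\<lambda>z. f z - g z) (\<lambda>z. a z - c z) (\<lambda>z. b z - d z)"
  using wirtinger_add[OF assms(1) wirtinger_minus[OF assms(2)]] by simp

lemma wirtinger_id: "wirtinger S (\<lambda>z. z) (\<lambda>_. 1) (\<lambda>_. 0)"
  by (simp add: wirtinger_def)

lemma wirtinger_exp:
  assumes "wirtinger S f a b"
  shows "wirtinger S (\<lambda>z. exp (f z)) (\<lambda>z. exp (f z) * a z) (\<lambda>z. exp (f z) * b z)"
  unfolding wirtinger_def
proof (intro conjI ballI)
  fix z assume "z \<in> S"
  have "(exp has_derivative (\<lambda>h. exp (f z) * h)) (at (f z))"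
    using DERIV_exp[of "f z"] by (simp add: has_field_derivative_def)
  from has_derivative_compose[OF wirtingerD[OF assms \<open>z \<in> S\<close>] this]
  show "((\<lambda>z. exp (f z)) has_derivative (\<lambda>h. exp (f z) * a z * h + exp (f z) * b z * cnj h)) (at z)"
    by (simp add: algebra_simps)
qed (use assms wirtinger_continuous[OF assms] in \<open>auto simp: wirtinger_def intro!: continuous_intros\<close>)

text \<open>As \<open>f\<close> is real-valued, so is its differential; the real chain rule
  therefore multiplies the whole expression a h + b cnj h by \<open>k'\<close>, with no splitting
  into real and imaginary parts.\<close>

lemma wirtinger_real_comp:
  fixes k k' :: "real \<Rightarrow> real"
  assumes "wirtinger S f a b" and real: "\<And>z. f z = of_real (r z)"
    and k: "\<And>x. (k has_real_derivative k' x) (at x)" "continuous_on UNIV k'"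
  shows "wirtinger S (\<lambda>z. of_real (k (r z)))
     (\<lambda>z. of_real (k' (r z)) * a z) (\<lambda>z. of_real (k' (r z)) * b z)"
  unfolding wirtinger_def
proof (intro conjI ballI)
  fix z assume z: "z \<in> S"
  let ?L = "\<lambda>h. a z * h + b z * cnj h"
  have r: "r = (\<lambda>z. Re (f z))" using real by auto
  have d: "(r has_derivative (\<lambda>h. Re (?L h))) (at z)"
    unfolding r by (rule has_derivative_Re[OF wirtingerD[OF assms(1) z]])
  have "((\<lambda>z. of_real (r z) :: complex) has_derivative (\<lambda>h. of_real (Re (?L h)))) (at z)"
    using has_derivative_of_real[OF d] .
  moreover have "(\<lambda>z. of_real (r z)) = f" using real by auto
  ultimately have "(\<lambda>h. of_real (Re (?L h))) = ?L"
    using has_derivative_unique wirtingerD[OF assms(1) z] by metis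
  then have L: "of_real (Re (?L h)) = ?L h" for h by metis
  have "((\<lambda>z. k (r z)) has_derivative (\<lambda>h. k' (r z) * Re (?L h))) (at z)"
    using has_derivative_compose[OF d k(1)[unfolded has_field_derivative_def]] by simp
  from has_derivative_of_real[OF this]
  have "((\<lambda>z. of_real (k (r z))) has_derivative
        (\<lambda>h. of_real (k' (r z)) * of_real (Re (?L h)) :: complex)) (at z)" by simp
  then show "((\<lambda>z. of_real (k (r z))) has_derivative
      (\<lambda>h. of_real (k' (r z)) * a z * h + of_real (k' (r z)) * b z * cnj h)) (at z)"
    unfolding L by (simp add: algebra_simps)
next
  have "continuous_on S r"
  proof -
    have "r = (\<lambda>z. Re (f z))" using real by auto
    then show ?thesis using wirtinger_continuous(1)[OF assms(1)] by (auto intro: continuous_intros)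
  qed
  then have "continuous_on S (\<lambda>z. k' (r z))"
    using k(2) continuous_on_compose2 by blast
  then show "continuous_on S (\<lambda>z. of_real (k' (r z)) * a z)" "continuous_on S (\<lambda>z. of_real (k' (r z)) * b z)"
    using wirtinger_continuous[OF assms(1)] by (auto intro!: continuous_intros)
qed

text \<open>Nothing is assumed of \<open>f\<close> on \<open>Z\<close>, where it may have poles. The
  product is smooth there because it is identically zero, and the two open pieces are glued.\<close>

lemma wirtinger_cutoff:
  assumes f: "wirtinger S f a b" and g: "wirtinger (S \<union> Z) g c d" and "open S" "open Z"
    and zero: "\<And>z. z \<in> Z \<Longrightarrow> g z = 0" "\<And>z. z \<in> Z \<Longrightarrow> c z = 0" "\<And>z. z \<in> Z \<Longrightarrow> d z = 0"
  shows "wirtinger (S \<union> Z) (\<lambda>z. g z * f z)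
    (\<lambda>z. c z * f z + g z * a z) (\<lambda>z. d z * f z + g z * b z)" (is "wirtinger _ ?F ?A ?B")
proof -
  have S: "wirtinger S ?F ?A ?B"
    by (rule wirtinger_mult[OF wirtinger_subset[OF g] f]) auto
  have "wirtinger Z (\<lambda>_. 0) (\<lambda>_. 0) (\<lambda>_. 0)" by (rule wirtinger_const)
  then have "wirtinger Z ?F (\<lambda>_. 0) (\<lambda>_. 0)"
    by (rule wirtinger_cong_fun[OF _ \<open>open Z\<close>]) (simp add: zero)
  then have Z: "wirtinger Z ?F ?A ?B"
    by (rule wirtinger_cong) (simp_all add: zero)
  show ?thesis
    using S Z \<open>open S\<close> \<open>open Z\<close> unfolding wirtinger_def
    by (auto intro: continuous_on_open_Un)
qed

text \<open>Twice continuous differentiability. The mixed second derivative \<open>c\<close> is the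
  one that is named, because curvature and commutator are expressed through it; the same
  \<open>c\<close> in both clauses is the symmetry of mixed derivatives.\<close>

definition wirtinger2 ::
  "complex set \<Rightarrow> (complex \<Rightarrow> complex) \<Rightarrow> (complex \<Rightarrow> complex) \<Rightarrow> (complex \<Rightarrow> complex) \<Rightarrow> (complex \<Rightarrow> complex) \<Rightarrow> bool" where
  "wirtinger2 S f a b c \<longleftrightarrow>
     wirtinger S f a b \<and> (\<exists>a'. wirtinger S a a' c) \<and> (\<exists>b'. wirtinger S b c b')"

lemma wirtinger2_cong:
  assumes "wirtinger2 S f a b c" "\<And>z. a z = a' z" "\<And>z. b z = b' z" "\<And>z. c z = c' z"
  shows "wirtinger2 S f a' b' c'"
proof -
  have "a = a'" "b = b'" "c = c'" using assms by auto
  with assms show ?thesis by simp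
qed

lemma wirtinger2_const: "wirtinger2 S (\<lambda>_. c) (\<lambda>_. 0) (\<lambda>_. 0) (\<lambda>_. 0)"
  unfolding wirtinger2_def using wirtinger_const by blast

lemma wirtinger2_holomorphic:
  assumes "open S" "f holomorphic_on S"
  shows "wirtinger2 S f (deriv f) (\<lambda>_. 0) (\<lambda>_. 0)"
  unfolding wirtinger2_def
  using wirtinger_holomorphic[OF assms] wirtinger_holomorphic[OF assms(1) holomorphic_deriv[OF assms(2,1)]]
    wirtinger_const[of S 0] by blast

lemma wirtinger2_cnj:
  assumes "wirtinger2 S f a b c"
  shows "wirtinger2 S (\<lambda>z. cnj (f z)) (\<lambda>z. cnj (b z)) (\<lambda>z. cnj (a z)) (\<lambda>z. cnj (c z))"
  using assms wirtinger_cnj[of S f a b] wirtinger_cnj[of S a _ c] wirtinger_cnj[of S b c]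
  unfolding wirtinger2_def by metis

lemma wirtinger2_add:
  assumes f: "wirtinger2 S f a b c" and g: "wirtinger2 S g a' b' c'"
  shows "wirtinger2 S (\<lambda>z. f z + g z) (\<lambda>z. a z + a' z) (\<lambda>z. b z + b' z) (\<lambda>z. c z + c' z)"
proof -
  from f obtain f1 f2 where f': "wirtinger S f a b" "wirtinger S a f1 c" "wirtinger S b c f2"
    unfolding wirtinger2_def by blast
  from g obtain g1 g2 where g': "wirtinger S g a' b'" "wirtinger S a' g1 c'" "wirtinger S b' c' g2"
    unfolding wirtinger2_def by blast
  from wirtinger_add[OF f'(1) g'(1)] wirtinger_add[OF f'(2) g'(2)] wirtinger_add[OF f'(3) g'(3)]
  show ?thesis unfolding wirtinger2_def by blast
qed

lemma wirtinger2_sum: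
  assumes "\<And>i. i \<in> I \<Longrightarrow> wirtinger2 S (f i) (a i) (b i) (c i)"
  shows "wirtinger2 S (\<lambda>z. \<Sum>i\<in>I. f i z) (\<lambda>z. \<Sum>i\<in>I. a i z) (\<lambda>z. \<Sum>i\<in>I. b i z) (\<lambda>z. \<Sum>i\<in>I. c i z)"
  using assms
proof (induction I rule: infinite_finite_induct)
  case (insert i I)
  then show ?case by (simp add: wirtinger2_add)
qed (simp_all add: wirtinger2_const)

lemma wirtinger2_mult:
  assumes f: "wirtinger2 S f a b c" and g: "wirtinger2 S g a' b' c'"
  shows "wirtinger2 S (\<lambda>z. f z * g z) (\<lambda>z. a z * g z + f z * a' z) (\<lambda>z. b z * g z + f z * b' z)
     (\<lambda>z. c z * g z + b z * a' z + a z * b' z + f z * c' z)"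
proof -
  from f obtain f1 f2 where f': "wirtinger S f a b" "wirtinger S a f1 c" "wirtinger S b c f2"
    unfolding wirtinger2_def by blast
  from g obtain g1 g2 where g': "wirtinger S g a' b'" "wirtinger S a' g1 c'" "wirtinger S b' c' g2"
    unfolding wirtinger2_def by blast
  note 1 = wirtinger_mult[OF f'(1) g'(1)]
  note 2 = wirtinger_add[OF wirtinger_mult[OF f'(2) g'(1)] wirtinger_mult[OF f'(1) g'(2)]]
  note 3 = wirtinger_add[OF wirtinger_mult[OF f'(3) g'(1)] wirtinger_mult[OF f'(1) g'(3)]]
  have 4: "wirtinger S (\<lambda>z. a z * g z + f z * a' z) (\<lambda>z. (f1 z * g z + a z * a' z) + (a z * a' z + f z * g1 z))
    (\<lambda>z. c z * g z + b z * a' z + a z * b' z + f z * c' z)"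
    by (rule wirtinger_cong[OF 2]) (simp_all add: algebra_simps)
  have 5: "wirtinger S (\<lambda>z. b z * g z + f z * b' z) 
    (\<lambda>z. c z * g z + b z * a' z + a z * b' z + f z * c' z) (\<lambda>z. (f2 z * g z + b z * b' z) + (b z * b' z + f z * g2 z))"
    by (rule wirtinger_cong[OF 3]) (simp_all add: algebra_simps)
  from 1 4 5 show ?thesis unfolding wirtinger2_def by blast
qed

lemma wirtinger2_real_comp:
  fixes k k' :: "real \<Rightarrow> real"
  assumes f: "wirtinger2 S f a b c" and real: "\<And>z. f z = of_real (r z)"
    and k: "\<And>x. (k has_real_derivative k' x) (at x)" "\<And>x. (k' has_real_derivative k'' x) (at x)"
      "continuous_on UNIV k''"
  shows "wirtinger2 S (\<lambda>z. of_real (k (r z)))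
     (\<lambda>z. of_real (k' (r z)) * a z) (\<lambda>z. of_real (k' (r z)) * b z)
     (\<lambda>z. of_real (k'' (r z)) * a z * b z + of_real (k' (r z)) * c z)"
proof -
  from f obtain f1 f2 where f': "wirtinger S f a b" "wirtinger S a f1 c" "wirtinger S b c f2"
    unfolding wirtinger2_def by blast
  have "continuous_on UNIV k'"
    using k(2) DERIV_isCont by (simp add: continuous_on_eq_continuous_at) blast
  note 1 = wirtinger_real_comp[OF f'(1) real k(1) this]
  note 2 = wirtinger_real_comp[OF f'(1) real k(2,3)]
  have 3: "wirtinger S (\<lambda>z. of_real (k' (r z)) * a z)
     (\<lambda>z. of_real (k'' (r z)) * a z * a z + of_real (k' (r z)) * f1 z)
     (\<lambda>z. of_real (k'' (r z)) * a z * b z + of_real (k' (r z)) * c z)"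
    by (rule wirtinger_cong[OF wirtinger_mult[OF 2 f'(2)]]) (simp_all add: algebra_simps)
  have 4: "wirtinger S (\<lambda>z. of_real (k' (r z)) * b z)
     (\<lambda>z. of_real (k'' (r z)) * a z * b z + of_real (k' (r z)) * c z)
     (\<lambda>z. of_real (k'' (r z)) * b z * b z + of_real (k' (r z)) * f2 z)"
    by (rule wirtinger_cong[OF wirtinger_mult[OF 2 f'(3)]]) (simp_all add: algebra_simps)
  from 1 3 4 show ?thesis unfolding wirtinger2_def by blast
qed

section \<open>The weighted area measure\<close>

text \<open>Both orders of the coordinates are covered, so that the slice argument can run along
  horizontal and along vertical lines.\<close>

lemma lborel_complex_distr:
  assumes "(\<forall>y x. p (y, x) = Complex x y) \<or> (\<forall>y x. p (y, x) = Complex y x)"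
  shows "distr (lborel \<Otimes>\<^sub>M lborel) borel p = (lborel :: complex measure)"
    and "p \<in> measurable (lborel \<Otimes>\<^sub>M lborel) borel"
proof -
  have m: "(\<lambda>(y, x). Complex x y) \<in> borel_measurable (lborel \<Otimes>\<^sub>M lborel)"
    "(\<lambda>(y, x). Complex y x) \<in> borel_measurable (lborel \<Otimes>\<^sub>M lborel)"
    by (simp_all add: Complex_eq case_prod_beta)
  have eq: "p = (\<lambda>(y, x). Complex x y) \<or> p = (\<lambda>(y, x). Complex y x)"
    using assms by auto
  then show p: "p \<in> measurable (lborel \<Otimes>\<^sub>M lborel) borel"
    using m by auto
  show "distr (lborel \<Otimes>\<^sub>M lborel) borel p = (lborel :: complex measure)"
  proof (rule lborel_eqI[symmetric])
    fix l u :: complex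
    assume lu: "\<And>b. b \<in> Basis \<Longrightarrow> l \<bullet> b \<le> u \<bullet> b"
    have le: "Re l \<le> Re u" "Im l \<le> Im u"
      using lu[of 1] lu[of \<i>] by (auto simp: Basis_complex_def inner_complex_def)
    have box: "box l u = {z. Re l < Re z \<and> Re z < Re u \<and> Im l < Im z \<and> Im z < Im u}"
      by (auto simp: box_def Basis_complex_def inner_complex_def)
    have "emeasure (distr (lborel \<Otimes>\<^sub>M lborel) borel p) (box l u) =
          emeasure (lborel \<Otimes>\<^sub>M lborel) (p -` box l u \<inter> space (lborel \<Otimes>\<^sub>M lborel))"
      using p by (intro emeasure_distr) auto
    also have "p -` box l u \<inter> space (lborel \<Otimes>\<^sub>M lborel) =
        {Im l<..<Im u} \<times> {Re l<..<Re u} \<or> 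
       p -` box l u \<inter> space (lborel \<Otimes>\<^sub>M lborel) = {Re l<..<Re u} \<times> {Im l<..<Im u}"
      using eq by (auto simp: box space_pair_measure)
    then have "emeasure (lborel \<Otimes>\<^sub>M lborel) (p -` box l u \<inter> space (lborel \<Otimes>\<^sub>M lborel)) =
       ennreal (Re u - Re l) * ennreal (Im u - Im l)"
      using le by (auto simp: lborel.emeasure_pair_measure_Times mult.commute)
    finally show "emeasure (distr (lborel \<Otimes>\<^sub>M lborel) borel p) (box l u) = (\<Prod>b\<in>Basis. (u - l) \<bullet> b)"
      using le by (simp add: Basis_complex_def inner_complex_def ennreal_mult)
  qed simp
qed

text \<open>Fubini makes almost every slice integrable, so the vanishing is demanded of integrable
  slices only.\<close>

lemma lborel_complex_integral_slices_0:
  fixes f :: "complex \<Rightarrow> complex"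
  assumes p: "(\<forall>y x. p (y, x) = Complex x y) \<or> (\<forall>y x. p (y, x) = Complex y x)"
    and f: "integrable lborel f"
    and slice: "\<And>y. integrable lborel (\<lambda>x. f (p (y, x))) \<Longrightarrow> (LINT x|lborel. f (p (y, x))) = 0"
  shows "(LINT z|lborel. f z) = 0"
proof -
  note d = lborel_complex_distr[OF p]
  have fm: "f \<in> borel_measurable borel" using f by auto
  have i: "integrable (lborel \<Otimes>\<^sub>M lborel) (\<lambda>q. f (p q))"
    using f fm d(2) by (subst integrable_distr_eq[symmetric]) (auto simp: d(1))
  have "(LINT z|lborel. f z) = (LINT q|(lborel \<Otimes>\<^sub>M lborel). f (p q))"
    unfolding d(1)[symmetric] by (rule integral_distr[OF d(2) fm])
  also have "\<dots> = (LINT y|lborel. LINT x|lborel. f (p (y, x)))"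
    using lborel_pair.integral_fst'[OF i] by simp
  also have "\<dots> = (LINT y|(lborel::real measure). 0)"
  proof (rule integral_cong_AE)
    show "AE y in lborel. (LINT x|lborel. f (p (y, x))) = 0"
      using lborel_pair.AE_integrable_fst'[OF i] by eventually_elim (use slice in simp)
  qed (use lborel_pair.integrable_fst'[OF i] in auto)
  finally show ?thesis by simp
qed

text \<open>For negative \<alpha>: a point with 1 - |z|^2 between 2^-(n+1) and 2^-n lies in the
  outer shell \<open>A n\<close>, whose area is a constant times 2^-n, and the integrand there is at
  most a constant times 2^(-\<alpha> n). The integral is dominated by a geometric series of ratio
  2^(-\<alpha>-1) < 1. For \<alpha> \<ge> 0 the integrand is at most 1.\<close>

lemma nn_integral_disc_powr_finite:
  assumes "\<alpha> > -1"
  shows "(\<integral>\<^sup>+z\<in>ball (0::complex) 1. ennreal ((1 - (cmod z)\<^sup>2) powr \<alpha>) \<partial>lborel) < \<infinity>"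
proof -
  define c where "c = unit_ball_vol (real DIM(complex))"
  have c: "c > 0" by (simp add: c_def)
  define A :: "nat \<Rightarrow> complex set" where "A n = ball 0 1 - ball 0 (sqrt (1 - 1 / 2 ^ n))" for n
  have mA: "emeasure lborel (A n) = ennreal (c / 2 ^ n)" for n
  proof -
    have "(1::real) / 2 ^ n \<le> 1" by simp
    then have s: "0 \<le> 1 - (1::real) / 2 ^ n" "1 - (1::real) / 2 ^ n \<le> 1" by simp_all
    have "emeasure lborel (A n) = emeasure lborel (ball (0::complex) 1) - emeasure lborel (ball (0::complex) (sqrt (1 - 1 / 2 ^ n)))"
      unfolding A_def using s emeasure_lborel_ball_finite
      by (intro emeasure_Diff) (auto simp: subset_ball less_top[symmetric])
    also have "\<dots> = ennreal c - ennreal (c * (1 - 1 / 2 ^ n))"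
      using s by (simp add: emeasure_ball c_def)
    also have "\<dots> = ennreal (c / 2 ^ n)"
      using c s by (subst ennreal_minus) (auto simp: field_simps)
    finally show ?thesis .
  qed
  define q where "q = 2 powr (- \<alpha> - 1)"
  have q: "0 < q" "q < 1"
    using assms powr_less_mono[of "- \<alpha> - 1" 0 2] by (auto simp: q_def)
  define K where "K = max 1 (2 powr - \<alpha>)"
  have bound: "ennreal ((1 - (cmod z)\<^sup>2) powr \<alpha>) * indicator (ball 0 1) z
     \<le> (\<Sum>n. ennreal (K * 2 powr (- \<alpha> * n)) * indicator (A n) z) + ennreal 1 * indicator (ball 0 1) z" for z
  proof (cases "z \<in> ball 0 1")
    case True
    then have s: "0 < 1 - (cmod z)\<^sup>2" "1 - (cmod z)\<^sup>2 \<le> 1"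
      by (auto simp: abs_square_less_1)
    show ?thesis
    proof (cases "\<alpha> \<ge> 0")
      case a: True
      have "(1 - (cmod z)\<^sup>2) powr \<alpha> \<le> 1"
        using s a powr_mono2[of \<alpha> "1 - (cmod z)\<^sup>2" 1] by simp
      then have "ennreal ((1 - (cmod z)\<^sup>2) powr \<alpha>) \<le> 1" by (metis ennreal_1 ennreal_leI)
      then show ?thesis using True by (auto intro: add_increasing)
    next
      case False
      define n where "n = nat \<lfloor>- log 2 (1 - (cmod z)\<^sup>2)\<rfloor>"
      have l0: "- log 2 (1 - (cmod z)\<^sup>2) \<ge> 0"
        using s by (simp add: log_le_zero_cancel_iff)
      then have n1: "n \<le> - log 2 (1 - (cmod z)\<^sup>2)" "- log 2 (1 - (cmod z)\<^sup>2) < n + 1"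
        unfolding n_def by linarith+
      have u1: "1 - (cmod z)\<^sup>2 \<le> 2 powr (- real n)"
        using n1(1) s by (subst log_le_iff[symmetric]) auto
      have u2: "2 powr (- real n - 1) \<le> 1 - (cmod z)\<^sup>2"
        using n1(2) s by (subst le_log_iff[symmetric]) auto
      have "z \<in> A n"
      proof -
        have "sqrt (1 - 1 / 2 ^ n) \<le> cmod z"
          using u1 by (intro real_le_lsqrt) (auto simp: powr_minus powr_realpow field_simps)
        then show ?thesis using True by (simp add: A_def)
      qed
      have "(1 - (cmod z)\<^sup>2) powr \<alpha> \<le> (2 powr (- real n - 1)) powr \<alpha>"
        using False u2 by (intro powr_mono2') auto
      also have "\<dots> = 2 powr - \<alpha> * 2 powr (- \<alpha> * n)"
      proof -
        have e: "(- real n - 1) * \<alpha> = - \<alpha> + - \<alpha> * n" by (simp add: algebra_simps)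
        show ?thesis by (simp only: powr_powr e powr_add)
      qed
      also have "\<dots> \<le> K * 2 powr (- \<alpha> * n)"
        by (intro mult_right_mono) (auto simp: K_def)
      finally have "ennreal ((1 - (cmod z)\<^sup>2) powr \<alpha>) \<le> ennreal (K * 2 powr (- \<alpha> * n)) * indicator (A n) z"
        using \<open>z \<in> A n\<close> by (simp add: ennreal_leI)
      also have "\<dots> \<le> (\<Sum>n. ennreal (K * 2 powr (- \<alpha> * n)) * indicator (A n) z)"
      proof -
        have "f n \<le> suminf f" for f :: "nat \<Rightarrow> ennreal"
          using sum_le_suminf[of f "{n}"] by simp
        then show ?thesis .
      qed
      finally show ?thesis using True by (auto intro: add_increasing2)
    qed
  qed simp
  have "(\<integral>\<^sup>+z\<in>ball (0::complex) 1. ennreal ((1 - (cmod z)\<^sup>2) powr \<alpha>) \<partial>lborel) \<le>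
    (\<integral>\<^sup>+z. (\<Sum>n. ennreal (K * 2 powr (- \<alpha> * n)) * indicator (A n) z) + ennreal 1 * indicator (ball 0 1) z \<partial>lborel)"
    by (intro nn_integral_mono) (use bound in auto)
  also have "\<dots> = (\<Sum>n. ennreal (K * 2 powr (- \<alpha> * n)) * emeasure lborel (A n)) + emeasure lborel (ball (0::complex) 1)"
  proof -
    have [measurable]: "A n \<in> sets borel" "ball (0::complex) 1 \<in> sets borel" for n
      unfolding A_def by simp_all
    have "(\<integral>\<^sup>+z. (\<Sum>n. ennreal (K * 2 powr (- \<alpha> * n)) * indicator (A n) z) \<partial>lborel)
        = (\<Sum>n. ennreal (K * 2 powr (- \<alpha> * n)) * emeasure lborel (A n))"
      by (subst nn_integral_suminf) (simp_all add: nn_integral_cmult_indicator)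
    then show ?thesis
      by (subst nn_integral_add) simp_all
  qed
  also have "(\<lambda>n. ennreal (K * 2 powr (- \<alpha> * n)) * emeasure lborel (A n)) = (\<lambda>n. ennreal (K * c * q ^ n))"
  proof
    fix n :: nat
    have "2 powr (- \<alpha> * n) / 2 ^ n = q ^ n"
      by (simp add: q_def powr_realpow[symmetric] powr_powr powr_diff[symmetric] powr_diff algebra_simps divide_powr_uminus power_divide)
    moreover have "K * 2 powr (- \<alpha> * n) * (c / 2 ^ n) = K * c * (2 powr (- \<alpha> * n) / 2 ^ n)"
      by simp
    ultimately have "K * 2 powr (- \<alpha> * n) * (c / 2 ^ n) = K * c * q ^ n"
      by (simp only:)
    then show "ennreal (K * 2 powr (- \<alpha> * n)) * emeasure lborel (A n) = ennreal (K * c * q ^ n)"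
      using c by (simp add: mA ennreal_mult[symmetric] K_def)
  qed
  also have "(\<Sum>n. ennreal (K * c * q ^ n)) + emeasure lborel (ball (0::complex) 1) < \<infinity>"
  proof -
    have "summable (\<lambda>n. K * c * q ^ n)"
      using q by (intro summable_mult summable_geometric) auto
    then have "(\<Sum>n. ennreal (K * c * q ^ n)) = ennreal (\<Sum>n. K * c * q ^ n)"
      using q c by (intro suminf_ennreal2) (auto simp: K_def)
    then show ?thesis using emeasure_lborel_ball_finite[of "0::complex" 1] by simp
  qed
  finally show ?thesis .
qed

definition bergman_density :: "real \<Rightarrow> complex \<Rightarrow> real" where
  "bergman_density \<alpha> z = (1 + \<alpha>) * (1 - (cmod z)\<^sup>2) powr \<alpha> / pi"

lemma bergman_density_measurable [measurable]: "bergman_density \<alpha> \<in> borel_measurable borel"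
  unfolding bergman_density_def by measurable

lemma bergman_density_nonneg: "\<alpha> > -1 \<Longrightarrow> bergman_density \<alpha> z \<ge> 0"
  by (simp add: bergman_density_def)

lemma space_bergman_measure [simp]: "space (bergman_measure \<alpha>) = ball 0 1"
  by (simp add: bergman_measure_def space_restrict_space)

lemma sets_bergman_measure: "sets (bergman_measure \<alpha>) = sets (restrict_space borel (ball 0 1))"
  by (simp add: bergman_measure_def sets_restrict_space)

lemma borel_measurable_bergman:
  "f \<in> borel_measurable (bergman_measure \<alpha>) \<longleftrightarrow> f \<in> borel_measurable (restrict_space borel (ball 0 1))"
  by (metis measurable_cong_sets sets_bergman_measure)

lemma bergman_measure_alt:
  "bergman_measure \<alpha> = density (restrict_space lborel (ball 0 1)) (\<lambda>z. ennreal (bergman_density \<alpha> z))"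
  by (simp add: bergman_measure_def bergman_density_def)

lemma borel_measurable_restrict_lborel:
  "f \<in> borel_measurable (restrict_space lborel (ball 0 1)) \<longleftrightarrow> f \<in> borel_measurable (restrict_space borel (ball (0::complex) 1))"
  by (metis measurable_cong_sets sets_lborel sets_restrict_space_cong)

lemma
  fixes f :: "complex \<Rightarrow> 'b :: {banach, second_countable_topology}"
  assumes "\<alpha> > -1" and f: "f \<in> borel_measurable (bergman_measure \<alpha>)"
  shows integrable_bergman_measure: "integrable (bergman_measure \<alpha>) f \<longleftrightarrow>
      integrable lborel (\<lambda>z. indicator (ball 0 1) z *\<^sub>R bergman_density \<alpha> z *\<^sub>R f z)"
    and integral_bergman_measure: "integral\<^sup>L (bergman_measure \<alpha>) f =
      (LINT z|lborel. indicator (ball 0 1) z *\<^sub>R bergman_density \<alpha> z *\<^sub>R f z)"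
proof -
  have f': "f \<in> borel_measurable (restrict_space lborel (ball 0 1))"
    using f by (simp add: borel_measurable_bergman borel_measurable_restrict_lborel)
  have m: "bergman_density \<alpha> \<in> borel_measurable (restrict_space lborel (ball 0 1))"
    by (rule measurable_restrict_space1) simp
  note nn = bergman_density_nonneg[OF assms(1)]
  show "integrable (bergman_measure \<alpha>) f \<longleftrightarrow>
      integrable lborel (\<lambda>z. indicator (ball 0 1) z *\<^sub>R bergman_density \<alpha> z *\<^sub>R f z)"
    unfolding bergman_measure_alt using f' m nn
    by (simp add: integrable_density integrable_restrict_space)
  show "integral\<^sup>L (bergman_measure \<alpha>) f =
      (LINT z|lborel. indicator (ball 0 1) z *\<^sub>R bergman_density \<alpha> z *\<^sub>R f z)"
    unfolding bergman_measure_alt using f' m nn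
    by (simp add: integral_density integral_restrict_space)
qed

lemma finite_measure_bergman:
  assumes "\<alpha> > -1"
  shows "finite_measure (bergman_measure \<alpha>)"
proof
  have m: "bergman_density \<alpha> \<in> borel_measurable (restrict_space lborel (ball 0 1))"
    by (rule measurable_restrict_space1) simp
  have "emeasure (bergman_measure \<alpha>) (ball 0 1) =
      (\<integral>\<^sup>+z\<in>ball 0 1. ennreal (bergman_density \<alpha> z) \<partial>restrict_space lborel (ball 0 1))"
    unfolding bergman_measure_alt using m
    by (subst emeasure_density) (auto simp: sets_restrict_space image_iff)
  also have "\<dots> = (\<integral>\<^sup>+z. ennreal ((1 + \<alpha>) / pi) * (ennreal ((1 - (cmod z)\<^sup>2) powr \<alpha>) * indicator (ball 0 1) z) \<partial>lborel)"
    using assms by (subst nn_integral_restrict_space)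
      (auto intro!: nn_integral_cong simp: bergman_density_def ennreal_mult[symmetric] split: split_indicator)
  also have "\<dots> = ennreal ((1 + \<alpha>) / pi) * (\<integral>\<^sup>+z\<in>ball (0::complex) 1. ennreal ((1 - (cmod z)\<^sup>2) powr \<alpha>) \<partial>lborel)"
  proof (rule nn_integral_cmult)
    have [measurable]: "ball (0::complex) 1 \<in> sets borel" by simp
    show "(\<lambda>z. ennreal ((1 - (cmod z)\<^sup>2) powr \<alpha>) * indicator (ball 0 1) z) \<in> borel_measurable lborel"
      by measurable
  qed
  also have "\<dots> < \<infinity>"
    using nn_integral_disc_powr_finite[OF assms] by (simp add: ennreal_mult_less_top)
  finally show "emeasure (bergman_measure \<alpha>) (space (bergman_measure \<alpha>)) \<noteq> \<infinity>" by simp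
qed

lemma continuous_on_borel_measurable_bergman:
  assumes "continuous_on (ball 0 1) f"
  shows "f \<in> borel_measurable (bergman_measure \<alpha>)"
  using borel_measurable_continuous_on_restrict[OF assms] by (simp add: borel_measurable_bergman)

lemma integrable_bergman_bounded:
  fixes f :: "complex \<Rightarrow> 'b :: {banach, second_countable_topology}"
  assumes "\<alpha> > -1" "f \<in> borel_measurable (bergman_measure \<alpha>)" "\<And>z. z \<in> ball 0 1 \<Longrightarrow> norm (f z) \<le> B"
  shows "integrable (bergman_measure \<alpha>) f"
proof -
  interpret finite_measure "bergman_measure \<alpha>" by (rule finite_measure_bergman[OF assms(1)])
  show ?thesis
    by (rule integrable_const_bound[where B=B]) (use assms in \<open>auto intro!: AE_I2\<close>)
qed

lemma integrable_bergman_continuous: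
  fixes f :: "complex \<Rightarrow> 'b :: {banach, second_countable_topology}"
  assumes "\<alpha> > -1" "continuous_on (cball 0 1) f"
  shows "integrable (bergman_measure \<alpha>) f"
proof -
  have "bounded (f ` cball 0 1)"
    using assms by (intro compact_imp_bounded compact_continuous_image) auto
  then obtain B where "\<And>z. z \<in> cball 0 1 \<Longrightarrow> norm (f z) \<le> B"
    unfolding bounded_iff by blast
  moreover have "continuous_on (ball 0 1) f"
    using assms(2) continuous_on_subset ball_subset_cball by blast
  ultimately show ?thesis
    using assms(1)
    by (intro integrable_bergman_bounded[where B=B] continuous_on_borel_measurable_bergman) auto
qed

section \<open>Stokes' theorem\<close>

text \<open>Along each chord in direction \<open>e\<close> the integrand times (1-|z|^2)^\<alpha> is
  the derivative of (1-|z|^2)^(\<alpha>+1) N, which is zero at both ends since \<alpha>+1 >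
  0.\<close>

lemma bergman_partial_integral_0:
  fixes N a b :: "complex \<Rightarrow> complex" and e :: complex
  assumes \<alpha>: "\<alpha> > -1" and N: "wirtinger S N a b" and S: "cball 0 1 \<subseteq> S" and e: "e = 1 \<or> e = \<i>"
  shows "(LINT z|bergman_measure \<alpha>. of_real (1 - (cmod z)\<^sup>2) * (a z * e + b z * cnj e)
      - of_real ((\<alpha> + 1) * (2 * Re (z * cnj e))) * N z) = 0"
    (is "integral\<^sup>L _ ?f = 0")
proof -
  define e' where "e' = (if e = 1 then \<i> else 1)"
  define p where "p = (\<lambda>(y, x). of_real y * e' + of_real x * e)"
  have p: "(\<forall>y x. p (y, x) = Complex x y) \<or> (\<forall>y x. p (y, x) = Complex y x)"
    using e by (auto simp: p_def e'_def Complex_eq)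
  have pn: "(cmod (p (y, x)))\<^sup>2 = y\<^sup>2 + x\<^sup>2" and pe: "Re (p (y, x) * cnj e) = x" for x y
    using e by (auto simp: p_def e'_def cmod_power2)
  have c: "continuous_on (cball 0 1) N" "continuous_on (cball 0 1) a" "continuous_on (cball 0 1) b"
    using wirtinger_continuous[OF N] S continuous_on_subset by blast+
  have cf: "continuous_on (cball 0 1) ?f"
    by (intro continuous_intros c)
  have meas: "?f \<in> borel_measurable (bergman_measure \<alpha>)"
    by (rule continuous_on_borel_measurable_bergman) (use cf continuous_on_subset ball_subset_cball in blast)
  define F where "F z = indicator (ball 0 1) z *\<^sub>R bergman_density \<alpha> z *\<^sub>R ?f z" for z
  have int: "integrable lborel F"
    unfolding F_def integrable_bergman_measure[OF \<alpha> meas, symmetric]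
    by (rule integrable_bergman_continuous[OF \<alpha> cf])
  have "(LINT z|lborel. F z) = 0"
  proof (rule lborel_complex_integral_slices_0[OF p int])
    fix y :: real
    assume i: "integrable lborel (\<lambda>x. F (p (y, x)))"
    show "(LINT x|lborel. F (p (y, x))) = 0"
    proof (cases "y\<^sup>2 < 1")
      case False
      have "F (p (y, x)) = 0" for x
      proof -
        have "(cmod (p (y, x)))\<^sup>2 \<ge> 1" using False by (simp add: pn add_increasing2)
        then have "cmod (p (y, x)) \<ge> 1" by (simp add: abs_square_less_1 linorder_not_less[symmetric])
        then show ?thesis by (simp add: F_def)
      qed
      then show ?thesis by simp
    next
      case True
      define d where "d = sqrt (1 - y\<^sup>2)"
      have d: "d > 0" "d\<^sup>2 = 1 - y\<^sup>2" using True by (auto simp: d_def)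
      have ball: "p (y, x) \<in> ball 0 1 \<longleftrightarrow> x \<in> {-d<..<d}" for x
      proof -
        have "p (y, x) \<in> ball 0 1 \<longleftrightarrow> (cmod (p (y, x)))\<^sup>2 < 1" by (simp add: abs_square_less_1)
        also have "\<dots> \<longleftrightarrow> x\<^sup>2 < d\<^sup>2" by (simp add: pn d) linarith
        also have "\<dots> \<longleftrightarrow> \<bar>x\<bar> < d" using d(1) by (metis abs_of_pos abs_le_square_iff linorder_not_less)
        finally show ?thesis by auto
      qed
      have cball: "p (y, x) \<in> cball 0 1" if "x \<in> {-d..d}" for x
      proof -
        have "x\<^sup>2 \<le> d\<^sup>2" using that d(1) by (auto simp: abs_le_square_iff[symmetric] abs_le_iff)
        then have "(cmod (p (y, x)))\<^sup>2 \<le> 1" by (simp add: pn d)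
        then show ?thesis by (simp add: abs_square_le_1)
      qed
      define G where "G x = of_real ((1 - (y\<^sup>2 + x\<^sup>2)) powr (\<alpha> + 1)) * N (p (y, x))" for x
      define G' where "G' x = of_real ((1 - (y\<^sup>2 + x\<^sup>2)) powr \<alpha>) * ?f (p (y, x))" for x
      have pc: "continuous_on A (\<lambda>x. p (y, x))" for A
        unfolding p_def by (auto intro!: continuous_intros)
      \<comment> \<open>For negative \<alpha> the derivative may blow up at the ends of the chord,
        so differentiability is used in the interior and mere continuity at the ends.\<close>
      have "(G' has_integral (G d - G (-d))) {-d..d}"
      proof (rule fundamental_theorem_of_calculus_interior)
        show "- d \<le> d" using d by simp
        have nn: "1 - (y\<^sup>2 + x\<^sup>2) \<ge> 0" if "x \<in> {-d..d}" for x
          using cball[OF that] pn[of y x] abs_square_le_1[of "cmod (p (y, x))"] by simp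
        show "continuous_on {- d..d} G"
          unfolding G_def
        proof (intro continuous_on_mult continuous_on_of_real continuous_on_powr')
          show "continuous_on {- d..d} (\<lambda>x. N (p (y, x)))"
            by (rule continuous_on_compose2[OF c(1) pc]) (use cball in auto)
        qed (use nn \<alpha> in \<open>auto intro!: continuous_intros\<close>)
      next
        fix x assume x: "x \<in> {-d<..<d}"
        then have s: "1 - (y\<^sup>2 + x\<^sup>2) > 0"
          using ball[of x] pn[of y x] abs_square_less_1[of "cmod (p (y, x))"] by simp
        have zS: "p (y, x) \<in> S" using ball[of x] x S by auto
        have "((\<lambda>x. p (y, x)) has_derivative (\<lambda>h. of_real h * e)) (at x)"
          unfolding p_def by (auto intro!: derivative_eq_intros)
        from has_derivative_compose[OF this wirtingerD[OF N zS]]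
        have D1: "((\<lambda>x. N (p (y, x))) has_vector_derivative (a (p (y, x)) * e + b (p (y, x)) * cnj e)) (at x)"
          unfolding has_vector_derivative_def by (rule has_derivative_eq_rhs) (auto simp: scaleR_conv_of_real algebra_simps)
        have "((\<lambda>x. (1 - (y\<^sup>2 + x\<^sup>2)) powr (\<alpha> + 1)) has_real_derivative
            (\<alpha> + 1) * (1 - (y\<^sup>2 + x\<^sup>2)) powr \<alpha> * (- 2 * x)) (at x)"
          using s by (auto intro!: derivative_eq_intros simp: powr_diff)
        from has_vector_derivative_of_real[OF this]
        have D2: "((\<lambda>x. complex_of_real ((1 - (y\<^sup>2 + x\<^sup>2)) powr (\<alpha> + 1))) has_vector_derivative
            of_real ((\<alpha> + 1) * (1 - (y\<^sup>2 + x\<^sup>2)) powr \<alpha> * (- 2 * x))) (at x)" .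
        have pw: "(1 - (y\<^sup>2 + x\<^sup>2)) powr (\<alpha> + 1) = (1 - (y\<^sup>2 + x\<^sup>2)) powr \<alpha> * (1 - (y\<^sup>2 + x\<^sup>2))"
          using s by (simp add: powr_add)
        show "(G has_vector_derivative G' x) (at x)"
          unfolding G_def using has_vector_derivative_mult[OF D2 D1]
          by (rule has_vector_derivative_eq_rhs) (unfold G'_def pe pn pw, simp add: algebra_simps)
      qed
      moreover have "G d = 0" "G (-d) = 0" by (simp_all add: G_def d)
      ultimately have hi: "(G' has_integral 0) {-d<..<d}" by (simp add: has_integral_Icc_iff_Ioo)
      have FG: "F (p (y, x)) = indicator {-d<..<d} x *\<^sub>R (of_real ((1 + \<alpha>) / pi) * G' x)" for x
        using ball[of x] by (auto simp: F_def G'_def bergman_density_def pn scaleR_conv_of_real split: split_indicator)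
      have "set_integrable lborel {-d<..<d} (\<lambda>x. of_real ((1 + \<alpha>) / pi) * G' x)"
        using i unfolding FG set_integrable_def .
      from set_borel_integral_eq_integral(2)[OF this]
      have "(LINT x|lborel. F (p (y, x))) = integral {-d<..<d} (\<lambda>x. of_real ((1 + \<alpha>) / pi) * G' x)"
        unfolding FG set_lebesgue_integral_def .
      also have "\<dots> = 0"
        using has_integral_mult_right[OF hi, of "of_real ((1 + \<alpha>) / pi)"] by (intro integral_unique) simp
      finally show ?thesis .
    qed
  qed
  then show ?thesis unfolding F_def integral_bergman_measure[OF \<alpha> meas] .
qed

text \<open>This is Stokes' theorem for \<open>(1 - |z|\<^sup>2) powr (\<alpha> + 1) * N z\<close>, which
  vanishes on the unit circle; the two integrands below are its Wirtinger derivatives divided by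
  \<open>(1 - |z|\<^sup>2) powr \<alpha>\<close>.\<close>

lemma bergman_stokes:
  fixes N a b :: "complex \<Rightarrow> complex"
  assumes \<alpha>: "\<alpha> > -1" and N: "wirtinger S N a b" and S: "cball 0 1 \<subseteq> S"
  shows "(LINT z|bergman_measure \<alpha>. of_real (1 - (cmod z)\<^sup>2) * a z - of_real (\<alpha> + 1) * cnj z * N z) = 0"
    and "(LINT z|bergman_measure \<alpha>. of_real (1 - (cmod z)\<^sup>2) * b z - of_real (\<alpha> + 1) * z * N z) = 0"
proof -
  have c: "continuous_on (cball 0 1) N" "continuous_on (cball 0 1) a" "continuous_on (cball 0 1) b"
    using wirtinger_continuous[OF N] S continuous_on_subset by blast+
  define f where "f e z = of_real (1 - (cmod z)\<^sup>2) * (a z * e + b z * cnj e)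
      - of_real ((\<alpha> + 1) * (2 * Re (z * cnj e))) * N z" for e z
  have i: "integrable (bergman_measure \<alpha>) (f e)" for e
    unfolding f_def by (intro integrable_bergman_continuous[OF \<alpha>] continuous_intros c)
  have 0: "(LINT z|bergman_measure \<alpha>. f 1 z) = 0" "(LINT z|bergman_measure \<alpha>. f \<i> z) = 0"
    unfolding f_def using bergman_partial_integral_0[OF assms] by blast+
  \<comment> \<open>The z-derivative is half of (derivative along 1) - i (derivative along i); the
    conjugate derivative has the opposite sign.\<close>
  have "of_real (1 - (cmod z)\<^sup>2) * a z - of_real (\<alpha> + 1) * cnj z * N z = (f 1 z - \<i> * f \<i> z) / 2"
    "of_real (1 - (cmod z)\<^sup>2) * b z - of_real (\<alpha> + 1) * z * N z = (f 1 z + \<i> * f \<i> z) / 2" for z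
  proof -
    have re: "of_real (2 * Re z) = z + cnj z" "of_real (2 * Im z) = - \<i> * (z - cnj z)"
      by (simp_all add: complex_eq_iff)
    have fs: "f 1 z = of_real (1 - (cmod z)\<^sup>2) * (a z + b z) - of_real (\<alpha> + 1) * (z + cnj z) * N z"
      "f \<i> z = of_real (1 - (cmod z)\<^sup>2) * (a z * \<i> - b z * \<i>) - of_real (\<alpha> + 1) * (- \<i> * (z - cnj z)) * N z"
      unfolding f_def re[symmetric] by (simp_all del: of_real_add)
    show "of_real (1 - (cmod z)\<^sup>2) * a z - of_real (\<alpha> + 1) * cnj z * N z = (f 1 z - \<i> * f \<i> z) / 2"
      "of_real (1 - (cmod z)\<^sup>2) * b z - of_real (\<alpha> + 1) * z * N z = (f 1 z + \<i> * f \<i> z) / 2"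
      unfolding fs by (simp_all add: field_simps)
  qed
  note eq = this
  show "(LINT z|bergman_measure \<alpha>. of_real (1 - (cmod z)\<^sup>2) * a z - of_real (\<alpha> + 1) * cnj z * N z) = 0"
    "(LINT z|bergman_measure \<alpha>. of_real (1 - (cmod z)\<^sup>2) * b z - of_real (\<alpha> + 1) * z * N z) = 0"
    unfolding eq using i[of 1] i[of \<i>] 0 by simp_all
qed

section \<open>Antiderivatives of kernel functions\<close>

text \<open>For |w| < 1 an open neighbourhood of the closed disk on which everything attached to
  \<open>w\<close> stays holomorphic, so that Stokes' theorem applies without a limit at the
  circle.\<close>

definition kernel_dom :: "complex \<Rightarrow> complex set" where
  "kernel_dom w = {z. cmod w * cmod z < 1}"

text \<open>The power (1 - cnj w z)^-(2+\<alpha>), up to a constant the reproducing kernel at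
  \<open>w\<close>. The principal logarithm is a legitimate branch, because its argument has
  positive real part on \<open>kernel_dom w\<close>.\<close>

definition bergman_ker :: "real \<Rightarrow> complex \<Rightarrow> complex \<Rightarrow> complex" where
  "bergman_ker \<alpha> w z = exp (- of_real (2 + \<alpha>) * Ln (1 - cnj w * z))"

lemma open_kernel_dom: "open (kernel_dom w)"
  unfolding kernel_dom_def by (intro open_Collect_less continuous_intros)

lemma cball_subset_kernel_dom: "cmod w < 1 \<Longrightarrow> cball 0 1 \<subseteq> kernel_dom w"
proof
  fix z :: complex assume "cmod w < 1" "z \<in> cball 0 1"
  then show "z \<in> kernel_dom w"
    using mult_left_le[of "cmod z" "cmod w"] by (simp add: kernel_dom_def)
qed

lemma Re_kernel_dom: "z \<in> kernel_dom w \<Longrightarrow> Re (1 - cnj w * z) > 0"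
  using complex_Re_le_cmod[of "cnj w * z"] by (simp add: kernel_dom_def norm_mult)

lemma kernel_dom_nz:
  assumes "z \<in> kernel_dom w"
  shows "1 - cnj w * z \<noteq> 0" "1 - w * cnj z \<noteq> 0"
proof -
  show 1: "1 - cnj w * z \<noteq> 0" using Re_kernel_dom[OF assms] by fastforce
  have "1 - w * cnj z = cnj (1 - cnj w * z)" by simp
  then show "1 - w * cnj z \<noteq> 0" using 1 by (metis complex_cnj_zero_iff)
qed

lemma bergman_ker_deriv:
  assumes "z \<in> kernel_dom w"
  shows "(bergman_ker \<alpha> w has_field_derivative
     of_real (2 + \<alpha>) * cnj w / (1 - cnj w * z) * bergman_ker \<alpha> w z) (at z)"
proof -
  have "1 - cnj w * z \<notin> \<real>\<^sub>\<le>\<^sub>0"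
    using Re_kernel_dom[OF assms] by (auto simp: complex_nonpos_Reals_iff)
  then show ?thesis
    unfolding bergman_ker_def[abs_def]
    by (auto intro!: derivative_eq_intros simp: divide_inverse algebra_simps)
qed

lemma disk_aut_deriv:
  assumes "z \<in> kernel_dom w"
  shows "(disk_aut w has_field_derivative (w * cnj w - 1) / (1 - cnj w * z)\<^sup>2) (at z)"
  unfolding disk_aut_def[abs_def]
  by (rule derivative_eq_intros refl kernel_dom_nz(1)[OF assms])+
     (use kernel_dom_nz(1)[OF assms] in \<open>simp add: field_simps power2_eq_square\<close>)

lemma bergman_ker_holomorphic: "bergman_ker \<alpha> w holomorphic_on kernel_dom w"
  using bergman_ker_deriv open_kernel_dom by (metis holomorphic_on_open)

lemma disk_aut_holomorphic: "disk_aut w holomorphic_on kernel_dom w"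
  using disk_aut_deriv open_kernel_dom by (metis holomorphic_on_open)

lemma one_minus_norm_disk_aut:
  assumes "z \<in> kernel_dom w"
  shows "1 - disk_aut w z * cnj (disk_aut w z) =
    (1 - z * cnj z) * (1 - w * cnj w) / ((1 - cnj w * z) * (1 - w * cnj z))"
proof -
  have eq: "disk_aut w z * cnj (disk_aut w z) = (w - z) * (cnj w - cnj z) / ((1 - cnj w * z) * (1 - w * cnj z))"
    by (simp add: disk_aut_def)
  have "(1 - cnj w * z) * (1 - w * cnj z) - (w - z) * (cnj w - cnj z) = (1 - z * cnj z) * (1 - w * cnj w)"
    by (simp add: algebra_simps)
  moreover have "1 - a / b = (b - a) / b" if "b \<noteq> 0" for a b :: complex
    using that by (simp add: diff_divide_distrib)
  ultimately show ?thesis unfolding eq using kernel_dom_nz[OF assms] by simp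
qed

lemma one_minus_cmod_disk_aut:
  assumes "z \<in> kernel_dom w"
  shows "1 - (cmod (disk_aut w z))\<^sup>2 = (1 - (cmod z)\<^sup>2) * (1 - (cmod w)\<^sup>2) / (cmod (1 - cnj w * z))\<^sup>2"
proof -
  have "complex_of_real (1 - (cmod (disk_aut w z))\<^sup>2) =
    of_real ((1 - (cmod z)\<^sup>2) * (1 - (cmod w)\<^sup>2) / (cmod (1 - cnj w * z))\<^sup>2)"
    using one_minus_norm_disk_aut[OF assms]
    by (simp add: complex_norm_square del: of_real_power)
  then show ?thesis by (simp only: of_real_eq_iff)
qed

lemma disk_aut_in_ball:
  assumes "w \<in> ball 0 1" "z \<in> ball 0 1"
  shows "disk_aut w z \<in> ball 0 1"
proof -
  have z: "z \<in> kernel_dom w" using assms cball_subset_kernel_dom[of w] by auto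
  have "(1 - (cmod z)\<^sup>2) * (1 - (cmod w)\<^sup>2) / (cmod (1 - cnj w * z))\<^sup>2 > 0"
    using assms kernel_dom_nz(1)[OF z] by (simp add: abs_square_less_1)
  then have "(cmod (disk_aut w z))\<^sup>2 < 1"
    using one_minus_cmod_disk_aut[OF z] by linarith
  then show ?thesis by (simp add: abs_square_less_1)
qed

text \<open>\<open>R\<close> is a density for which \<open>R (1 - |z|\<^sup>2) powr \<alpha>\<close> is the \<open>z\<close>-derivative
  of \<open>q (1 - |z|\<^sup>2) powr (\<alpha> + 1)\<close>.\<close>

definition bergman_potential ::
  "real \<Rightarrow> complex set \<Rightarrow> (complex \<Rightarrow> complex) \<Rightarrow> (complex \<Rightarrow> complex) \<Rightarrow> bool" where
  "bergman_potential \<alpha> S q R \<longleftrightarrow> (\<exists>a b c. wirtinger2 S q a b c \<and>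
     (\<forall>z\<in>S. of_real (1 - (cmod z)\<^sup>2) * a z - of_real (\<alpha> + 1) * cnj z * q z = R z))"

lemma bergman_potential_cong:
  "bergman_potential \<alpha> S q R \<Longrightarrow> (\<And>z. z \<in> S \<Longrightarrow> R z = R' z) \<Longrightarrow> bergman_potential \<alpha> S q R'"
  unfolding bergman_potential_def by fastforce

lemma wirtinger2_subset: "wirtinger2 S f a b c \<Longrightarrow> T \<subseteq> S \<Longrightarrow> wirtinger2 T f a b c"
  unfolding wirtinger2_def using wirtinger_subset by meson

lemma bergman_potential_subset:
  "bergman_potential \<alpha> S q R \<Longrightarrow> T \<subseteq> S \<Longrightarrow> bergman_potential \<alpha> T q R"
  unfolding bergman_potential_def using wirtinger2_subset by blast

lemma bergman_potential_0: "bergman_potential \<alpha> S (\<lambda>_. 0) (\<lambda>_. 0)"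
  unfolding bergman_potential_def using wirtinger2_const[of S 0] by fastforce

lemma bergman_potential_add:
  assumes "bergman_potential \<alpha> S q R" "bergman_potential \<alpha> S q' R'"
  shows "bergman_potential \<alpha> S (\<lambda>z. q z + q' z) (\<lambda>z. R z + R' z)"
proof -
  obtain a b c where 1: "wirtinger2 S q a b c"
     "\<forall>z\<in>S. of_real (1 - (cmod z)\<^sup>2) * a z - of_real (\<alpha> + 1) * cnj z * q z = R z"
    using assms(1) unfolding bergman_potential_def by blast
  obtain a' b' c' where 2: "wirtinger2 S q' a' b' c'"
     "\<forall>z\<in>S. of_real (1 - (cmod z)\<^sup>2) * a' z - of_real (\<alpha> + 1) * cnj z * q' z = R' z"
    using assms(2) unfolding bergman_potential_def by blast
  have eq: "X * (x + x') - Y * (y + y') = (X * x - Y * y) + (X * x' - Y * y')" for X Y x x' y y' :: complex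
    by (simp add: algebra_simps)
  show ?thesis unfolding bergman_potential_def
  proof (intro exI conjI ballI)
    fix z assume z: "z \<in> S"
    show "of_real (1 - (cmod z)\<^sup>2) * (a z + a' z) - of_real (\<alpha> + 1) * cnj z * (q z + q' z) = R z + R' z"
      by (simp only: eq 1(2)[rule_format, OF z] 2(2)[rule_format, OF z])
  qed (rule wirtinger2_add[OF 1(1) 2(1)])
qed

text \<open>Antiholomorphic factors are constants for the z-derivative. This is how poles in the
  conjugate variable are cleared from potentials and put back.\<close>

lemma bergman_potential_mult_cnj:
  assumes "bergman_potential \<alpha> S q R" "open S" "f holomorphic_on S"
  shows "bergman_potential \<alpha> S (\<lambda>z. q z * cnj (f z)) (\<lambda>z. R z * cnj (f z))"
proof -
  obtain a b c where 1: "wirtinger2 S q a b c"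
     "\<forall>z\<in>S. of_real (1 - (cmod z)\<^sup>2) * a z - of_real (\<alpha> + 1) * cnj z * q z = R z"
    using assms(1) unfolding bergman_potential_def by blast
  note w = wirtinger2_mult[OF 1(1) wirtinger2_cnj[OF wirtinger2_holomorphic[OF assms(2,3)]]]
  have eq: "X * (x * y' + x' * 0) - Y * (x' * y') = (X * x - Y * x') * y'" for X Y x x' y' :: complex
    by (simp add: algebra_simps)
  show ?thesis unfolding bergman_potential_def
  proof (intro exI conjI ballI)
    fix z assume z: "z \<in> S"
    show "of_real (1 - (cmod z)\<^sup>2) * (a z * cnj (f z) + q z * cnj 0)
        - of_real (\<alpha> + 1) * cnj z * (q z * cnj (f z)) = R z * cnj (f z)"
      by (simp only: eq complex_cnj_zero 1(2)[rule_format, OF z])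
  qed (rule w)
qed

lemma bergman_potential_cmult:
  assumes "bergman_potential \<alpha> S q R" "open S"
  shows "bergman_potential \<alpha> S (\<lambda>z. k * q z) (\<lambda>z. k * R z)"
  using bergman_potential_mult_cnj[OF assms, of "\<lambda>_. cnj k"] by (simp add: mult.commute)

lemma bergman_potential_sum:
  assumes "\<And>i. i \<in> I \<Longrightarrow> bergman_potential \<alpha> S (q i) (R i)"
  shows "bergman_potential \<alpha> S (\<lambda>z. \<Sum>i\<in>I. q i z) (\<lambda>z. \<Sum>i\<in>I. R i z)"
  using assms
proof (induction I rule: infinite_finite_induct)
  case (insert i I)
  then show ?case by (simp add: bergman_potential_add)
qed (simp_all add: bergman_potential_0)

lemma bergman_potential_integral_0:
  assumes "\<alpha> > -1" "bergman_potential \<alpha> S q R" "cball 0 1 \<subseteq> S"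
  shows "(LINT z|bergman_measure \<alpha>. R z) = 0"
proof -
  obtain a b c where 1: "wirtinger2 S q a b c"
     "\<forall>z\<in>S. of_real (1 - (cmod z)\<^sup>2) * a z - of_real (\<alpha> + 1) * cnj z * q z = R z"
    using assms(2) unfolding bergman_potential_def by blast
  then have "wirtinger S q a b" by (simp add: wirtinger2_def)
  from bergman_stokes(1)[OF assms(1) this assms(3)]
  have "(LINT z|bergman_measure \<alpha>. of_real (1 - (cmod z)\<^sup>2) * a z - of_real (\<alpha> + 1) * cnj z * q z) = 0" .
  moreover have "(LINT z|bergman_measure \<alpha>. of_real (1 - (cmod z)\<^sup>2) * a z - of_real (\<alpha> + 1) * cnj z * q z)
    = (LINT z|bergman_measure \<alpha>. R z)"
    by (rule Bochner_Integration.integral_cong[OF refl], rule 1(2)[rule_format]) (use assms(3) in auto)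
  ultimately show ?thesis by simp
qed

text \<open>Origin of the formula: with \<phi> = \<open>disk_aut w\<close>, take the z-derivative of
  (1-|\<phi>|^2)^(\<alpha>+1) \<phi>^k cnj \<phi>^n, insert 1-|\<phi>|^2 = (1-|z|^2) (1-|w|^2) / |1
  - cnj w z|^2, and divide by constants and by an antiholomorphic power of 1 - w cnj z. This leaves
  the factor 1 - cnj w z next to the kernel and its conjugate inverse.\<close>

lemma bergman_potential_basic:
  assumes "S \<subseteq> kernel_dom w" "open S"
  shows "bergman_potential \<alpha> S
     (\<lambda>z. (bergman_ker \<alpha> w z * (1 - cnj w * z) * disk_aut w z ^ k) * cnj (disk_aut w z ^ n / (1 - cnj w * z)))
     (\<lambda>z. bergman_ker \<alpha> w z * (of_real (\<alpha> + 1 + k) * disk_aut w z ^ k * cnj (disk_aut w z) ^ (n + 1)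
        - of_nat k * disk_aut w z ^ (k - 1) * cnj (disk_aut w z) ^ n))"
proof -
  define A where "A z = bergman_ker \<alpha> w z * (1 - cnj w * z) * disk_aut w z ^ k" for z
  define B where "B z = disk_aut w z ^ n / (1 - cnj w * z)" for z
  define A' where "A' z = bergman_ker \<alpha> w z * (of_real (\<alpha> + 1) * cnj w * disk_aut w z ^ k +
      of_nat k * disk_aut w z ^ (k - 1) * (w * cnj w - 1) / (1 - cnj w * z))" for z
  have A': "(A has_field_derivative A' z) (at z)" if z: "z \<in> kernel_dom w" for z
  proof -
    define Y where "Y = 1 - cnj w * z"
    have Y: "Y \<noteq> 0" using kernel_dom_nz[OF z] by (simp add: Y_def)
    have dY: "((\<lambda>z. 1 - cnj w * z) has_field_derivative - cnj w) (at z)"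
      by (auto intro!: derivative_eq_intros)
    have "(A has_field_derivative
       (of_real (2 + \<alpha>) * cnj w / Y * bergman_ker \<alpha> w z * Y + - cnj w * bergman_ker \<alpha> w z) * disk_aut w z ^ k
       + (of_nat k * ((w * cnj w - 1) / Y\<^sup>2 * disk_aut w z ^ (k - Suc 0))) * (bergman_ker \<alpha> w z * Y)) (at z)"
      unfolding A_def Y_def
      by (rule DERIV_mult[OF DERIV_mult[OF bergman_ker_deriv[OF z] dY] DERIV_power[OF disk_aut_deriv[OF z]]])
    then show ?thesis
      by (rule DERIV_cong) (use Y in \<open>simp add: A'_def Y_def[symmetric] divide_simps power2_eq_square, simp add: algebra_simps\<close>)
  qed
  have holA: "A holomorphic_on S"
    using A' assms by (meson holomorphic_on_open subsetD)
  have "B holomorphic_on kernel_dom w"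
    unfolding B_def using kernel_dom_nz by (intro holomorphic_intros disk_aut_holomorphic) auto
  then have holB: "B holomorphic_on S" using assms holomorphic_on_subset by blast
  have dA: "deriv A z = A' z" if "z \<in> S" for z
    using A' assms that by (meson DERIV_imp_deriv subsetD)
  note w2 = wirtinger2_mult[OF wirtinger2_holomorphic[OF assms(2) holA]
      wirtinger2_cnj[OF wirtinger2_holomorphic[OF assms(2) holB]]]
  have eq: "of_real (1 - (cmod z)\<^sup>2) * A' z * cnj (B z) - of_real (\<alpha> + 1) * cnj z * (A z * cnj (B z)) =
    bergman_ker \<alpha> w z * (of_real (\<alpha> + 1 + k) * disk_aut w z ^ k * cnj (disk_aut w z) ^ (n + 1)
        - of_nat k * disk_aut w z ^ (k - 1) * cnj (disk_aut w z) ^ n)" if "z \<in> S" for z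
  proof -
    have z: "z \<in> kernel_dom w" using that assms by auto
    define Y where "Y = 1 - cnj w * z"
    define \<phi> where "\<phi> = disk_aut w z"
    have Y: "Y \<noteq> 0" "cnj Y \<noteq> 0" using kernel_dom_nz[OF z] by (auto simp: Y_def)
    have cY: "cnj Y = 1 - w * cnj z" by (simp add: Y_def)
    have s: "of_real (1 - (cmod z)\<^sup>2) = 1 - z * cnj z"
      using complex_norm_square[of z] by simp
    have c\<phi>: "cnj \<phi> * cnj Y = cnj w - cnj z"
      using Y(2) by (simp add: \<phi>_def disk_aut_def Y_def)
    have t: "(1 - z * cnj z) * (w * cnj w - 1) = - (1 - \<phi> * cnj \<phi>) * Y * cnj Y"
      using one_minus_norm_disk_aut[OF z] Y unfolding \<phi>_def[symmetric] cY[symmetric] Y_def[symmetric]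
      by (simp add: field_simps)
    have k: "of_nat k * \<phi> ^ (k - 1) * \<phi> = of_nat k * \<phi> ^ k"
      by (cases k) auto
    let ?D = "bergman_ker \<alpha> w z"
    have "of_real (1 - (cmod z)\<^sup>2) * A' z * cnj (B z) - of_real (\<alpha> + 1) * cnj z * (A z * cnj (B z)) =
      ?D * cnj \<phi> ^ n / cnj Y * (of_real (\<alpha> + 1) * \<phi> ^ k * ((1 - z * cnj z) * cnj w - cnj z * Y)
        + of_nat k * \<phi> ^ (k - 1) * ((1 - z * cnj z) * (w * cnj w - 1)) / Y)"
      unfolding s A'_def A_def B_def \<phi>_def[symmetric] Y_def[symmetric]
      using Y by (simp add: field_simps)
    also have "(1 - z * cnj z) * cnj w - cnj z * Y = cnj \<phi> * cnj Y"
      unfolding c\<phi> by (simp add: Y_def algebra_simps)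
    also have "?D * cnj \<phi> ^ n / cnj Y * (of_real (\<alpha> + 1) * \<phi> ^ k * (cnj \<phi> * cnj Y)
        + of_nat k * \<phi> ^ (k - 1) * ((1 - z * cnj z) * (w * cnj w - 1)) / Y) =
      ?D * (of_real (\<alpha> + 1) * \<phi> ^ k * cnj \<phi> ^ (n + 1) - of_nat k * \<phi> ^ (k - 1) * cnj \<phi> ^ n
        + of_nat k * \<phi> ^ (k - 1) * \<phi> * cnj \<phi> ^ (n + 1))"
      unfolding t using Y by (simp add: field_simps)
    also have "\<dots> = ?D * (of_real (\<alpha> + 1 + k) * \<phi> ^ k * cnj \<phi> ^ (n + 1) - of_nat k * \<phi> ^ (k - 1) * cnj \<phi> ^ n)"
      unfolding k by (simp add: algebra_simps)
    finally show ?thesis by (simp add: \<phi>_def)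
  qed
  show ?thesis
    unfolding bergman_potential_def A_def[symmetric] B_def[symmetric]
    apply (intro exI conjI, rule w2)
    using eq dA by (simp add: mult.assoc)
qed

text \<open>Each use of the basic potential trades \<phi>^j cnj \<phi>^m for \<phi>^(j-1) cnj
  \<phi>^(m-1). Since j < m, the descent ends at a pure positive power of cnj \<phi>, which is the
  case k = 0 of the basic potential. Hence one conjugate factor of order m serves all j < m.\<close>

lemma bergman_potential_exists:
  assumes "S \<subseteq> kernel_dom w" "open S" "\<alpha> > -1" "j < m"
  shows "\<exists>q. bergman_potential \<alpha> S q (\<lambda>z. bergman_ker \<alpha> w z * disk_aut w z ^ j * cnj (disk_aut w z) ^ m)"
  using \<open>j < m\<close>
proof (induction j arbitrary: m)
  case 0
  then obtain n where m: "m = Suc n" by (cases m) auto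
  note 1 = bergman_potential_cmult[OF bergman_potential_basic[OF assms(1,2), of \<alpha> 0 n] assms(2), of "inverse (of_real (\<alpha> + 1))"]
  have nz: "complex_of_real (\<alpha> + 1) \<noteq> 0" using assms(3) by (subst of_real_eq_0_iff) simp
  show ?case
    apply (rule exI, rule bergman_potential_cong[OF 1])
    using nz by (simp add: m field_simps del: of_real_add)
next
  case (Suc j)
  then obtain n where m: "m = Suc n" by (cases m) auto
  with Suc obtain q where q: "bergman_potential \<alpha> S q (\<lambda>z. bergman_ker \<alpha> w z * disk_aut w z ^ j * cnj (disk_aut w z) ^ n)"
    by force
  note 1 = bergman_potential_cmult[OF bergman_potential_add[OF bergman_potential_basic[OF assms(1,2), of \<alpha> "Suc j" n]
      bergman_potential_cmult[OF q assms(2), of "of_nat (Suc j)"]] assms(2), of "inverse (of_real (\<alpha> + 1 + Suc j))"]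
  have nz: "complex_of_real (\<alpha> + 1 + Suc j) \<noteq> 0" using assms(3) by (subst of_real_eq_0_iff) simp
  show ?case
    apply (rule exI, rule bergman_potential_cong[OF 1])
    using nz by (simp add: m field_simps del: of_real_add of_nat_Suc)
qed

section \<open>Moments and the reproducing kernel\<close>

definition bcoef :: "real \<Rightarrow> nat \<Rightarrow> real" where
  "bcoef \<alpha> n = pochhammer (2 + \<alpha>) n / fact n"

lemma bcoef_0 [simp]: "bcoef \<alpha> 0 = 1"
  by (simp add: bcoef_def)

lemma bcoef_pos: "\<alpha> > -1 \<Longrightarrow> bcoef \<alpha> n > 0"
  by (simp add: bcoef_def pochhammer_pos)

lemma bcoef_Suc: "real (Suc n) * bcoef \<alpha> (Suc n) = (2 + \<alpha> + n) * bcoef \<alpha> n"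
  by (simp add: bcoef_def pochhammer_Suc field_simps del: of_nat_Suc)

text \<open>Differentiating the generating function raises \<alpha> by one; this puts the first
  moment of the coefficients into closed form.\<close>

lemma bcoef_Suc_shift: "real (Suc n) * bcoef \<alpha> (Suc n) = (2 + \<alpha>) * bcoef (\<alpha> + 1) n"
proof -
  have "pochhammer (2 + \<alpha>) (Suc n) = (2 + \<alpha>) * pochhammer (2 + (\<alpha> + 1)) n"
    by (simp add: pochhammer_rec add_ac)
  then show ?thesis by (simp add: bcoef_def field_simps del: of_nat_Suc)
qed

lemma bergman_basis_bcoef:
  assumes "\<alpha> > -1"
  shows "bergman_basis \<alpha> n z = of_real (sqrt (bcoef \<alpha> n)) * z ^ n"
proof -
  have "2 + \<alpha> \<notin> \<int>\<^sub>\<le>\<^sub>0" using assms by (auto elim!: nonpos_Ints_cases)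
  then have "pochhammer (2 + \<alpha>) n = Gamma (2 + \<alpha> + real n) / Gamma (2 + \<alpha>)"
    by (rule pochhammer_Gamma)
  then show ?thesis by (simp add: bergman_basis_def bcoef_def add_ac mult.commute)
qed

lemma gbinomial_minus_power:
  fixes b x :: "'a :: field_char_0"
  shows "(- b gchoose n) * (- x) ^ n = pochhammer b n / fact n * x ^ n"
proof -
  have "(- b gchoose n) * (- x) ^ n = ((-1) ^ n * (-1) ^ n) * (pochhammer b n / fact n * x ^ n)"
    unfolding gbinomial_pochhammer minus_minus power_minus[of x] by (simp add: mult_ac)
  also have "((-1) ^ n * (-1) ^ n :: 'a) = 1"
    by (simp flip: power_mult_distrib)
  finally show ?thesis by simp
qed

lemma bcoef_sums_complex:
  assumes "cmod u < 1"
  shows "(\<lambda>n. of_real (bcoef \<alpha> n) * u ^ n) sums exp (- of_real (2 + \<alpha>) * Ln (1 - u))"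
proof -
  have nz: "1 + - u \<noteq> 0" using assms by auto
  have "(\<lambda>n. (- of_real (2 + \<alpha>) gchoose n) * (- u) ^ n) sums (1 + - u) powr (- of_real (2 + \<alpha>))"
    using assms by (intro gen_binomial_complex) simp
  moreover have "complex_of_real (bcoef \<alpha> n) = pochhammer (of_real (2 + \<alpha>)) n / fact n" for n
    unfolding bcoef_def pochhammer_of_real of_real_divide by simp
  ultimately show ?thesis using nz
    unfolding gbinomial_minus_power by (simp add: powr_def)
qed

lemma bcoef_sums_real:
  assumes "\<bar>t\<bar> < 1"
  shows "(\<lambda>n. bcoef \<alpha> n * t ^ n) sums (1 - t) powr (- (2 + \<alpha>))"
proof -
  have "(\<lambda>n. (- (2 + \<alpha>) gchoose n) * (- t) ^ n) sums (1 + - t) powr (- (2 + \<alpha>))"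
    using assms by (intro gen_binomial_real) simp
  then show ?thesis
    unfolding gbinomial_minus_power by (simp add: bcoef_def)
qed

text \<open>Markov's inequality: a term with n \<ge> m is at most n/m times itself, and the sum of
  all n \<open>bcoef \<alpha> n\<close> t^n is (2+\<alpha>) t (1-t)^-(3+\<alpha>).\<close>

lemma bcoef_tail:
  assumes "\<alpha> > -1" "0 \<le> t" "t < 1" "m > 0"
  shows "(\<Sum>n. if n < m then 0 else bcoef \<alpha> n * t ^ n) \<le>
     (1 - t) powr (- (2 + \<alpha>)) * ((2 + \<alpha>) * t / ((1 - t) * m))"
    and "summable (\<lambda>n. if n < m then 0 else bcoef \<alpha> n * t ^ n)"
proof -
  have 1: "(\<lambda>n. bcoef (\<alpha> + 1) n * t ^ n) sums (1 - t) powr (- (3 + \<alpha>))"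
    using bcoef_sums_real[of t "\<alpha> + 1"] assms by (simp add: add_ac)
  have "(\<lambda>n. real (Suc n) * bcoef \<alpha> (Suc n) * t ^ Suc n) sums ((2 + \<alpha>) * t * (1 - t) powr (- (3 + \<alpha>)))"
    using sums_mult[OF 1, of "(2 + \<alpha>) * t"] unfolding bcoef_Suc_shift by (simp add: mult_ac)
  then have 2: "(\<lambda>n. real n * bcoef \<alpha> n * t ^ n) sums ((2 + \<alpha>) * t * (1 - t) powr (- (3 + \<alpha>)))"
    by (subst (asm) sums_Suc_iff) simp
  have 3: "(\<lambda>n. real n * bcoef \<alpha> n * t ^ n / m) sums ((2 + \<alpha>) * t * (1 - t) powr (- (3 + \<alpha>)) / m)"
    by (rule sums_divide[OF 2])
  have le: "(if n < m then 0 else bcoef \<alpha> n * t ^ n) \<le> real n * bcoef \<alpha> n * t ^ n / m" for n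
  proof (cases "n < m")
    case False
    then have "1 * (bcoef \<alpha> n * t ^ n) \<le> (real n / m) * (bcoef \<alpha> n * t ^ n)"
      using assms bcoef_pos[of \<alpha> n] by (intro mult_right_mono) (auto simp: field_simps)
    then show ?thesis using False by (simp add: mult_ac)
  qed (use assms bcoef_pos[of \<alpha> n] in auto)
  show s: "summable (\<lambda>n. if n < m then 0 else bcoef \<alpha> n * t ^ n)"
    by (rule summable_comparison_test'[OF sums_summable[OF 3], of 0])
       (use le assms bcoef_pos[of \<alpha>, THEN less_imp_le] in auto)
  have "(\<Sum>n. if n < m then 0 else bcoef \<alpha> n * t ^ n) \<le> (2 + \<alpha>) * t * (1 - t) powr (- (3 + \<alpha>)) / m"
    using suminf_le[OF le s sums_summable[OF 3]] sums_unique[OF 3] by simp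
  also have "(1 - t) powr (- (3 + \<alpha>)) = (1 - t) powr (- (2 + \<alpha>)) / (1 - t)"
  proof -
    have "- (3 + \<alpha>) = - (2 + \<alpha>) - 1" by simp
    then show ?thesis using assms by (simp only: powr_diff powr_one)
  qed
  finally show "(\<Sum>n. if n < m then 0 else bcoef \<alpha> n * t ^ n) \<le>
     (1 - t) powr (- (2 + \<alpha>)) * ((2 + \<alpha>) * t / ((1 - t) * m))"
    by (simp add: field_simps)
qed

section \<open>Orthogonality and norms of the kernel times powers of
  \<open>disk_aut w\<close>\<close>

definition moment :: "real \<Rightarrow> complex \<Rightarrow> nat \<Rightarrow> nat \<Rightarrow> complex" where
  "moment \<alpha> w a b = (LINT z|bergman_measure \<alpha>.
     (bergman_ker \<alpha> w z * disk_aut w z ^ a) * cnj (bergman_ker \<alpha> w z * disk_aut w z ^ b))"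

lemma continuous_on_ker_cball:
  assumes "w \<in> ball 0 1"
  shows "continuous_on (cball 0 1) (bergman_ker \<alpha> w)" "continuous_on (cball 0 1) (disk_aut w)"
  using cball_subset_kernel_dom[of w] bergman_ker_holomorphic[of \<alpha> w] disk_aut_holomorphic[of w] assms
    holomorphic_on_imp_continuous_on continuous_on_subset by (metis dist_0_norm mem_ball)+

text \<open>Stokes' theorem for the basic potential multiplied by the conjugate kernel.
  Orthogonality and norms thus come without a change of variables under \<open>disk_aut w\<close>.
  For a = 0 the factor \<open>of_nat a\<close> kills the term with the truncated difference
  \<open>a - 1\<close>, and the recursion says that the moment is zero.\<close>

lemma moment_rec:
  assumes "\<alpha> > -1" "w \<in> ball 0 1"
  shows "of_real (\<alpha> + 1 + a) * moment \<alpha> w a (b + 1) = of_nat a * moment \<alpha> w (a - 1) b"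
proof -
  let ?k = "bergman_ker \<alpha> w" and ?f = "disk_aut w"
  note c = continuous_on_ker_cball[OF assms(2)]
  have "bergman_potential \<alpha> (kernel_dom w)
     (\<lambda>z. ?k z * (1 - cnj w * z) * ?f z ^ a * cnj (?f z ^ b / (1 - cnj w * z)) * cnj (?k z))
     (\<lambda>z. ?k z * (of_real (\<alpha> + 1 + a) * ?f z ^ a * cnj (?f z) ^ (b + 1)
        - of_nat a * ?f z ^ (a - 1) * cnj (?f z) ^ b) * cnj (?k z))"
    by (rule bergman_potential_mult_cnj[OF bergman_potential_basic])
       (auto simp: open_kernel_dom bergman_ker_holomorphic)
  from bergman_potential_integral_0[OF assms(1) this cball_subset_kernel_dom] assms(2)
  have "0 = (LINT z|bergman_measure \<alpha>. ?k z * (of_real (\<alpha> + 1 + a) * ?f z ^ a * cnj (?f z) ^ (b + 1)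
        - of_nat a * ?f z ^ (a - 1) * cnj (?f z) ^ b) * cnj (?k z))" by simp
  also have "\<dots> = (LINT z|bergman_measure \<alpha>. 
       of_real (\<alpha> + 1 + a) * ((?k z * ?f z ^ a) * cnj (?k z * ?f z ^ (b + 1))) -
       of_nat a * ((?k z * ?f z ^ (a - 1)) * cnj (?k z * ?f z ^ b)))"
    by (rule Bochner_Integration.integral_cong[OF refl]) (simp add: algebra_simps)
  also have "\<dots> = of_real (\<alpha> + 1 + a) * moment \<alpha> w a (b + 1) - of_nat a * moment \<alpha> w (a - 1) b"
    unfolding moment_def
    by (subst Bochner_Integration.integral_diff)
       (intro integrable_bergman_continuous[OF assms(1)] continuous_intros c, intro integrable_bergman_continuous[OF assms(1)] continuous_intros c, simp)
  finally show ?thesis by simp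
qed

lemma moment_cnj: "moment \<alpha> w b a = cnj (moment \<alpha> w a b)"
  unfolding moment_def Bochner_Integration.integral_cnj[symmetric] by (simp add: mult_ac)

lemma moment_less_0:
  assumes "\<alpha> > -1" "w \<in> ball 0 1" "a < b"
  shows "moment \<alpha> w a b = 0"
  using \<open>a < b\<close>
proof (induction a arbitrary: b)
  case 0
  then obtain n where "b = n + 1" by (cases b) auto
  moreover have "complex_of_real (\<alpha> + 1 + real 0) \<noteq> 0" using assms(1) by (subst of_real_eq_0_iff) simp
  ultimately show ?case using moment_rec[OF assms(1,2), of 0 n] by (simp del: of_real_add)
next
  case (Suc a)
  then obtain n where n: "b = n + 1" by (cases b) auto
  then have "moment \<alpha> w a n = 0" using Suc by simp
  moreover have "complex_of_real (\<alpha> + 1 + real (Suc a)) \<noteq> 0" using assms(1) by (subst of_real_eq_0_iff) simp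
  ultimately show ?case using moment_rec[OF assms(1,2), of "Suc a" n] n by (simp del: of_real_add)
qed

lemma moment_neq_0:
  assumes "\<alpha> > -1" "w \<in> ball 0 1" "a \<noteq> b"
  shows "moment \<alpha> w a b = 0"
  using assms moment_less_0[OF assms(1,2)] moment_cnj[of \<alpha> w a b] by (cases "a < b") auto

lemma moment_diag:
  assumes "\<alpha> > -1" "w \<in> ball 0 1"
  shows "moment \<alpha> w a a = moment \<alpha> w 0 0 / of_real (bcoef \<alpha> a)"
proof (induction a)
  case (Suc a)
  have nz: "complex_of_real (bcoef \<alpha> n) \<noteq> 0" for n
    using bcoef_pos[OF assms(1), of n] by simp
  have nz2: "complex_of_real (\<alpha> + 1 + real (Suc a)) \<noteq> 0" using assms(1) by (subst of_real_eq_0_iff) simp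
  have b: "complex_of_real (of_nat (Suc a)) * of_real (bcoef \<alpha> (Suc a)) = of_real (\<alpha> + 1 + real (Suc a)) * of_real (bcoef \<alpha> a)"
    unfolding of_real_mult[symmetric] bcoef_Suc by (simp add: add_ac)
  have "of_real (\<alpha> + 1 + real (Suc a)) * moment \<alpha> w (Suc a) (Suc a) = of_nat (Suc a) * moment \<alpha> w a a"
    using moment_rec[OF assms, of "Suc a" a] by simp
  then have "of_real (\<alpha> + 1 + real (Suc a)) * of_real (bcoef \<alpha> a) * of_real (bcoef \<alpha> (Suc a)) * moment \<alpha> w (Suc a) (Suc a)
     = complex_of_real (of_nat (Suc a)) * of_real (bcoef \<alpha> (Suc a)) * of_real (bcoef \<alpha> a) * moment \<alpha> w a a"
    by (simp add: mult_ac)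
  then have "of_real (bcoef \<alpha> (Suc a)) * moment \<alpha> w (Suc a) (Suc a) = of_real (bcoef \<alpha> a) * moment \<alpha> w a a"
    unfolding b using nz[of a] nz2 by (simp add: mult.assoc del: of_real_add)
  also have "\<dots> = moment \<alpha> w 0 0" unfolding Suc.IH using nz[of a] by simp
  finally show ?case using nz[of "Suc a"] by (simp add: field_simps)
qed simp

text \<open>The squared norm of the kernel. Its value at w = 0 is the total mass of the measure,
  carried along as a positive constant instead of being evaluated.\<close>

definition ker_norm :: "real \<Rightarrow> complex \<Rightarrow> real" where
  "ker_norm \<alpha> w = (LINT z|bergman_measure \<alpha>. (cmod (bergman_ker \<alpha> w z))\<^sup>2)"

lemma moment_0_0: "moment \<alpha> w 0 0 = of_real (ker_norm \<alpha> w)"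
  unfolding moment_def ker_norm_def
    power_0 mult_1_right complex_norm_square[symmetric]
  by (rule integral_complex_of_real)

lemma ker_poly_norm:
  assumes "\<alpha> > -1" "w \<in> ball 0 1" "finite I"
  shows "(LINT z|bergman_measure \<alpha>. (cmod (bergman_ker \<alpha> w z * (\<Sum>n\<in>I. c n * disk_aut w z ^ n)))\<^sup>2)
     = (\<Sum>n\<in>I. ker_norm \<alpha> w * (cmod (c n))\<^sup>2 / bcoef \<alpha> n)"
proof -
  let ?k = "bergman_ker \<alpha> w" and ?f = "disk_aut w"
  note co = continuous_on_ker_cball[OF assms(2)]
  have "complex_of_real (LINT z|bergman_measure \<alpha>. (cmod (?k z * (\<Sum>n\<in>I. c n * ?f z ^ n)))\<^sup>2) =
    (LINT z|bergman_measure \<alpha>. of_real ((cmod (?k z * (\<Sum>n\<in>I. c n * ?f z ^ n)))\<^sup>2))"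
    by (rule integral_complex_of_real[symmetric])
  also have "\<dots> = (LINT z|bergman_measure \<alpha>. (\<Sum>i\<in>I. \<Sum>j\<in>I. (c i * cnj (c j)) * ((?k z * ?f z ^ i) * cnj (?k z * ?f z ^ j))))"
    by (rule Bochner_Integration.integral_cong[OF refl])
       (simp add: complex_norm_square sum_product sum_distrib_left mult_ac del: of_real_power, rule sum.swap)
  also have "\<dots> = (\<Sum>i\<in>I. \<Sum>j\<in>I. (c i * cnj (c j)) * moment \<alpha> w i j)"
    unfolding moment_def
    by (subst Bochner_Integration.integral_sum, intro integrable_bergman_continuous[OF assms(1)] continuous_intros co,
        rule sum.cong[OF refl], subst Bochner_Integration.integral_sum,
        intro integrable_bergman_continuous[OF assms(1)] continuous_intros co, simp)
  also have "\<dots> = (\<Sum>i\<in>I. (c i * cnj (c i)) * moment \<alpha> w i i)"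
  proof (rule sum.cong[OF refl])
    fix i assume i: "i \<in> I"
    have "(\<Sum>j\<in>I. (c i * cnj (c j)) * moment \<alpha> w i j) = (\<Sum>j\<in>{i}. (c i * cnj (c j)) * moment \<alpha> w i j)"
      using i assms(3) moment_neq_0[OF assms(1,2)] by (intro sum.mono_neutral_right) auto
    then show "(\<Sum>j\<in>I. (c i * cnj (c j)) * moment \<alpha> w i j) = (c i * cnj (c i)) * moment \<alpha> w i i" by simp
  qed
  also have "\<dots> = of_real (\<Sum>n\<in>I. ker_norm \<alpha> w * (cmod (c n))\<^sup>2 / bcoef \<alpha> n)"
    unfolding moment_diag[OF assms(1,2)] moment_0_0
    by (simp add: complex_norm_square[symmetric] mult_ac)
  finally show ?thesis by (simp only: of_real_eq_iff)
qed

text \<open>Absolute summability of \<open>c\<close> bounds all partial sums uniformly, because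
  |\<open>disk_aut w z\<close>| < 1 in the disk; the finite case then passes to the limit by
  dominated convergence.\<close>

lemma ker_series_norm:
  assumes "\<alpha> > -1" "w \<in> ball 0 1" and s: "summable (\<lambda>n. cmod (c n))"
  shows "(\<lambda>n. ker_norm \<alpha> w * (cmod (c n))\<^sup>2 / bcoef \<alpha> n) sums
    (LINT z|bergman_measure \<alpha>. (cmod (bergman_ker \<alpha> w z * (\<Sum>n. c n * disk_aut w z ^ n)))\<^sup>2)"
proof -
  let ?k = "bergman_ker \<alpha> w" and ?f = "disk_aut w" and ?M = "bergman_measure \<alpha>"
  note co = continuous_on_ker_cball[OF assms(2)]
  have f1: "cmod (?f z) \<le> 1" if "z \<in> ball 0 1" for z
    using disk_aut_in_ball[OF assms(2) that] by simp
  have b: "cmod (c n * ?f z ^ n) \<le> cmod (c n)" if "z \<in> ball 0 1" for z n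
    using f1[OF that] by (simp add: norm_mult norm_power mult_left_le power_le_one)
  have sm: "summable (\<lambda>n. c n * ?f z ^ n)" if "z \<in> ball 0 1" for z
    by (rule summable_comparison_test'[OF s, of 0]) (use b that in auto)
  define B where "B = (\<Sum>n. cmod (c n))"
  have bd: "cmod (\<Sum>n<N. c n * ?f z ^ n) \<le> B" if "z \<in> ball 0 1" for z N
  proof -
    have "cmod (\<Sum>n<N. c n * ?f z ^ n) \<le> (\<Sum>n<N. cmod (c n))"
      by (rule order_trans[OF norm_sum sum_mono]) (use b that in auto)
    also have "\<dots> \<le> B" unfolding B_def by (rule sum_le_suminf[OF s]) auto
    finally show ?thesis .
  qed
  have conv: "(\<lambda>N. (cmod (?k z * (\<Sum>n<N. c n * ?f z ^ n)))\<^sup>2) \<longlonglongrightarrow> (cmod (?k z * (\<Sum>n. c n * ?f z ^ n)))\<^sup>2"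
    if "z \<in> ball 0 1" for z
    by (intro tendsto_intros summable_LIMSEQ sm that)
  have cN: "continuous_on (cball 0 1) (\<lambda>z. (cmod (?k z * (\<Sum>n<N. c n * ?f z ^ n)))\<^sup>2)" for N
    by (intro continuous_intros co)
  have mN: "(\<lambda>z. (cmod (?k z * (\<Sum>n<N. c n * ?f z ^ n)))\<^sup>2) \<in> borel_measurable ?M" for N
    by (rule continuous_on_borel_measurable_bergman, rule continuous_on_subset[OF cN]) auto
  have "(\<lambda>N. LINT z|?M. (cmod (?k z * (\<Sum>n<N. c n * ?f z ^ n)))\<^sup>2) \<longlonglongrightarrow>
     (LINT z|?M. (cmod (?k z * (\<Sum>n. c n * ?f z ^ n)))\<^sup>2)"
  proof (rule integral_dominated_convergence[where w="\<lambda>z. (cmod (?k z) * B)\<^sup>2"])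
    show "(\<lambda>z. (cmod (?k z * (\<Sum>n. c n * ?f z ^ n)))\<^sup>2) \<in> borel_measurable ?M"
      by (rule borel_measurable_LIMSEQ_metric[OF mN]) (use conv in simp)
    show "integrable ?M (\<lambda>z. (cmod (?k z) * B)\<^sup>2)"
      by (intro integrable_bergman_continuous[OF assms(1)] continuous_intros co)
    show "AE z in ?M. norm ((cmod (?k z * (\<Sum>n<N. c n * ?f z ^ n)))\<^sup>2) \<le> (cmod (?k z) * B)\<^sup>2" for N
    proof (rule AE_I2)
      fix z assume "z \<in> space ?M"
      then show "norm ((cmod (?k z * (\<Sum>n<N. c n * ?f z ^ n)))\<^sup>2) \<le> (cmod (?k z) * B)\<^sup>2"
        using bd[of z N] by (auto simp: norm_mult intro!: power_mono mult_left_mono)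
    qed
  qed (use mN conv in auto)
  then show ?thesis
    unfolding sums_def ker_poly_norm[OF assms(1,2) finite_lessThan] .
qed

lemma bergman_ker_expand:
  assumes "cmod w * cmod z < 1"
  shows "(\<lambda>n. of_real (bcoef \<alpha> n) * cnj w ^ n * z ^ n) sums bergman_ker \<alpha> w z"
  using bcoef_sums_complex[of "cnj w * z" \<alpha>] assms
  by (simp add: bergman_ker_def norm_mult power_mult_distrib mult_ac)

lemma ker_norm_0_pos:
  assumes "\<alpha> > -1"
  shows "ker_norm \<alpha> 0 > 0"
proof -
  let ?M = "bergman_measure \<alpha>"
  interpret finite_measure ?M by (rule finite_measure_bergman[OF assms])
  have "ker_norm \<alpha> 0 = measure ?M (space ?M)"
    by (simp add: ker_norm_def bergman_ker_def)
  moreover have "emeasure ?M (space ?M) \<noteq> 0"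
  proof
    assume 0: "emeasure ?M (space ?M) = 0"
    have m: "(\<lambda>z. ennreal (bergman_density \<alpha> z)) \<in> borel_measurable (restrict_space lborel (ball 0 1))"
      by (rule measurable_restrict_space1) simp
    have "emeasure ?M (ball 0 1) =
      (\<integral>\<^sup>+z\<in>ball 0 1. ennreal (bergman_density \<alpha> z) \<partial>restrict_space lborel (ball 0 1))"
      unfolding bergman_measure_alt using m
      by (subst emeasure_density) (auto simp: sets_restrict_space image_iff)
    also have "\<dots> = (\<integral>\<^sup>+z. ennreal (bergman_density \<alpha> z) * indicator (ball 0 1) z \<partial>lborel)"
      by (subst nn_integral_restrict_space) (auto intro!: nn_integral_cong split: split_indicator)
    finally have "(\<integral>\<^sup>+z. ennreal (bergman_density \<alpha> z) * indicator (ball 0 1) z \<partial>lborel) = 0"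
      using 0 by simp
    moreover have [measurable]: "ball (0::complex) 1 \<in> sets borel" by simp
    ultimately have "AE z in lborel. ennreal (bergman_density \<alpha> z) * indicator (ball 0 1) z = 0"
      by (subst (asm) nn_integral_0_iff_AE) auto
    then have "AE z in lborel. z \<notin> ball (0::complex) 1"
    proof eventually_elim
      case (elim z)
      show ?case
      proof
        assume z: "z \<in> ball 0 1"
        then have "1 - (cmod z)\<^sup>2 > 0" by (simp add: abs_square_less_1)
        then have "bergman_density \<alpha> z > 0" using assms by (simp add: bergman_density_def)
        then show False using elim z by simp
      qed
    qed
    then have "ball (0::complex) 1 \<in> null_sets lborel"
      by (subst AE_iff_null_sets) auto
    then have "emeasure lborel (ball (0::complex) 1) = 0" by auto
    moreover have "measure lborel (ball (0::complex) 1) > 0" by (rule content_ball_pos) simp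
    ultimately show False by (simp add: measure_def)
  qed
  ultimately show ?thesis
    by (simp add: emeasure_eq_measure zero_less_measure_iff)
qed

text \<open>The binomial series of the kernel at \<open>w\<close> is an expansion around 0, where
  the kernel is 1 and \<open>disk_aut 0 z\<close> is -z (hence the sign in the coefficients);
  orthogonality turns its norm into the binomial series at |w|^2.\<close>

lemma ker_norm_eq:
  assumes "\<alpha> > -1" "w \<in> ball 0 1"
  shows "ker_norm \<alpha> w = ker_norm \<alpha> 0 * (1 - (cmod w)\<^sup>2) powr (- (2 + \<alpha>))"
proof -
  have 0: "disk_aut 0 z = - z" "bergman_ker \<alpha> 0 z = 1" for z
    by (simp_all add: disk_aut_def bergman_ker_def)
  define c where "c n = of_real (bcoef \<alpha> n) * (- cnj w) ^ n" for n
  have w: "cmod w < 1" "\<bar>(cmod w)\<^sup>2\<bar> < 1" using assms by (auto simp: abs_square_less_1)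
  have s: "summable (\<lambda>n. cmod (c n))"
    using sums_summable[OF bcoef_sums_real[of "cmod w" \<alpha>]] w bcoef_pos[OF assms(1), THEN less_imp_le]
    by (simp add: c_def norm_mult norm_power)
  have "(LINT z|bergman_measure \<alpha>. (cmod (bergman_ker \<alpha> 0 z * (\<Sum>n. c n * disk_aut 0 z ^ n)))\<^sup>2) = ker_norm \<alpha> w"
    unfolding ker_norm_def
  proof (rule Bochner_Integration.integral_cong[OF refl])
    fix z assume z: "z \<in> space (bergman_measure \<alpha>)"
    then have "cmod w * cmod z < 1"
      using w(1) subsetD[OF cball_subset_kernel_dom, of w z] by (simp add: kernel_dom_def)
    from sums_unique[OF bergman_ker_expand[OF this, of \<alpha>]]
    have "bergman_ker \<alpha> w z = (\<Sum>n. c n * (- z) ^ n)"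
      by (simp add: c_def mult.assoc flip: power_mult_distrib)
    then show "(cmod (bergman_ker \<alpha> 0 z * (\<Sum>n. c n * disk_aut 0 z ^ n)))\<^sup>2 = (cmod (bergman_ker \<alpha> w z))\<^sup>2"
      by (simp add: 0)
  qed
  with ker_series_norm[OF assms(1) _ s, of 0]
  have 1: "(\<lambda>n. ker_norm \<alpha> 0 * (cmod (c n))\<^sup>2 / bcoef \<alpha> n) sums ker_norm \<alpha> w" by simp
  have "ker_norm \<alpha> 0 * (cmod (c n))\<^sup>2 / bcoef \<alpha> n = ker_norm \<alpha> 0 * (bcoef \<alpha> n * ((cmod w)\<^sup>2) ^ n)" for n
    using bcoef_pos[OF assms(1), of n]
    by (simp add: c_def norm_mult norm_power power_mult_distrib power2_eq_square flip: power_mult)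
  with 1 have "(\<lambda>n. ker_norm \<alpha> 0 * (bcoef \<alpha> n * ((cmod w)\<^sup>2) ^ n)) sums ker_norm \<alpha> w" by simp
  moreover have "(\<lambda>n. ker_norm \<alpha> 0 * (bcoef \<alpha> n * ((cmod w)\<^sup>2) ^ n)) sums (ker_norm \<alpha> 0 * (1 - (cmod w)\<^sup>2) powr (- (2 + \<alpha>)))"
    by (rule sums_mult[OF bcoef_sums_real[OF w(2)]])
  ultimately show ?thesis by (rule sums_unique2)
qed

section \<open>Branches of the logarithm and change of base point\<close>

lemma exp_const_imp_const:
  assumes "f holomorphic_on ball 0 1" "\<And>z. z \<in> ball 0 1 \<Longrightarrow> exp (f z) = k" "z \<in> ball 0 1"
  shows "f z = f 0"
proof -
  have "(f has_field_derivative 0) (at z within ball 0 1)" if z: "z \<in> ball 0 1" for z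
  proof -
    have d: "(f has_field_derivative deriv f z) (at z)"
      using assms(1) z by (simp add: holomorphic_derivI)
    then have "((\<lambda>z. exp (f z)) has_field_derivative exp (f z) * deriv f z) (at z)"
      by (auto intro!: derivative_eq_intros)
    moreover have "((\<lambda>z. exp (f z)) has_field_derivative 0) (at z)"
      by (rule has_field_derivative_transform_within_open[OF DERIV_const[of k] open_ball z])
         (use assms(2) in auto)
    ultimately have "exp (f z) * deriv f z = 0" using DERIV_unique by blast
    then have "deriv f z = 0" by simp
    then show ?thesis using d DERIV_subset by (metis has_field_derivative_at_within)
  qed
  then obtain c where "\<And>z. z \<in> ball 0 1 \<Longrightarrow> f z = c"
    using has_field_derivative_zero_constant[of "ball 0 1" f] by auto
  then show ?thesis using assms(3) by simp
qed

lemma Ln_kernel_holomorphic: "(\<lambda>z. Ln (1 - cnj w * z)) holomorphic_on kernel_dom w"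
proof (intro holomorphic_intros)
  fix z assume "z \<in> kernel_dom w"
  then show "1 - cnj w * z \<notin> \<real>\<^sub>\<le>\<^sub>0"
    using Re_kernel_dom by (fastforce simp: complex_nonpos_Reals_iff)
qed

text \<open>L z + 2 Ln (1 - cnj w z) is a logarithm of the constant |w|^2 - 1, hence itself
  constant. Every branch therefore yields the kernel times one number, whose modulus is the same for
  all branches.\<close>

lemma deriv_log_branch_ker:
  assumes "w \<in> ball 0 1" "deriv_log_branch w L"
  obtains \<theta> where "(cmod \<theta>)\<^sup>2 = (1 - (cmod w)\<^sup>2) powr (2 + \<alpha>)"
    "\<And>z. z \<in> ball 0 1 \<Longrightarrow> exp (of_real ((2 + \<alpha>) / 2) * L z) = \<theta> * bergman_ker \<alpha> w z"
proof -
  have sub: "ball 0 1 \<subseteq> kernel_dom w"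
    using cball_subset_kernel_dom[of w] assms(1) ball_subset_cball[of "0::complex" 1] by auto
  have w: "(cmod w)\<^sup>2 < 1" using assms(1) by (simp add: abs_square_less_1)
  define f where "f z = L z + 2 * Ln (1 - cnj w * z)" for z
  have "f holomorphic_on ball 0 1"
    unfolding f_def using assms(2) holomorphic_on_subset[OF Ln_kernel_holomorphic sub]
    by (intro holomorphic_on_add holomorphic_on_mult holomorphic_on_const) (auto simp: deriv_log_branch_def)
  moreover have e: "exp (f z) = w * cnj w - 1" if "z \<in> ball 0 1" for z
  proof -
    have z: "z \<in> kernel_dom w" using sub that by auto
    have "exp (L z) = (w * cnj w - 1) / (1 - cnj w * z)\<^sup>2"
      using assms(2) that DERIV_imp_deriv[OF disk_aut_deriv[OF z]] by (simp add: deriv_log_branch_def)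
    then show ?thesis using kernel_dom_nz[OF z]
      by (simp add: f_def exp_add exp_double)
  qed
  ultimately have f0: "f z = f 0" if "z \<in> ball 0 1" for z
    using exp_const_imp_const that by blast
  show ?thesis
  proof
    show "exp (of_real ((2 + \<alpha>) / 2) * L z) = exp (of_real ((2 + \<alpha>) / 2) * f 0) * bergman_ker \<alpha> w z"
      if "z \<in> ball 0 1" for z
    proof -
      have "L z = f 0 - 2 * Ln (1 - cnj w * z)" using f0[OF that] by (simp add: f_def algebra_simps)
      moreover have "of_real (2 + \<alpha>) = 2 * complex_of_real ((2 + \<alpha>) / 2)" by simp
      moreover have "q * (a - 2 * b) = q * a + - (2 * q) * b" for q a b :: complex
        by (simp add: algebra_simps)
      ultimately show ?thesis unfolding bergman_ker_def exp_add[symmetric] by (simp only:)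
    qed
    have "complex_of_real ((cmod w)\<^sup>2 - 1) = w * cnj w - 1" using complex_norm_square[of w] by simp
    then have "cmod (exp (f 0)) = \<bar>(cmod w)\<^sup>2 - 1\<bar>" using e[of 0] by (metis norm_of_real centre_in_ball zero_less_one)
    then have 1: "exp (Re (f 0)) = 1 - (cmod w)\<^sup>2" using w by simp
    then have "Re (f 0) = ln (1 - (cmod w)\<^sup>2)" by (metis ln_exp)
    then show "(cmod (exp (of_real ((2 + \<alpha>) / 2) * f 0)))\<^sup>2 = (1 - (cmod w)\<^sup>2) powr (2 + \<alpha>)"
      using w by (simp add: powr_def exp_double[symmetric] field_simps)
  qed
qed

text \<open>For \<zeta> = \<open>disk_aut w z0\<close>, the function 1 - cnj \<zeta>
  \<open>disk_aut w z\<close> is a constant times (1 - cnj z0 z) / (1 - cnj w z). So a combination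
  of principal logarithms is a logarithm of a constant, and the corresponding powers differ by one
  constant factor.\<close>

lemma bergman_ker_compose:
  assumes "w \<in> ball 0 1" "z0 \<in> ball 0 1"
  obtains c where "\<And>z. z \<in> ball 0 1 \<Longrightarrow>
    bergman_ker \<alpha> z0 z = c * (bergman_ker \<alpha> w z * bergman_ker \<alpha> (disk_aut w z0) (disk_aut w z))"
proof -
  define \<zeta> where "\<zeta> = disk_aut w z0"
  have \<zeta>: "\<zeta> \<in> ball 0 1" unfolding \<zeta>_def by (rule disk_aut_in_ball[OF assms])
  have dom: "z \<in> kernel_dom v" if "z \<in> ball 0 1" "v \<in> ball 0 1" for z v
    using cball_subset_kernel_dom[of v] that by auto
  define f where "f z = Ln (1 - cnj w * z) + Ln (1 - cnj \<zeta> * disk_aut w z) - Ln (1 - cnj z0 * z)" for z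
  have h: "disk_aut w holomorphic_on ball 0 1"
    using disk_aut_holomorphic dom assms holomorphic_on_subset by blast
  have hL: "(\<lambda>z. Ln (1 - cnj v * z)) holomorphic_on ball 0 1" if "v \<in> ball 0 1" for v
    using holomorphic_on_subset[OF Ln_kernel_holomorphic] dom that by blast
  have "disk_aut w ` ball 0 1 \<subseteq> ball 0 1" by (intro image_subsetI disk_aut_in_ball assms)
  then have "(\<lambda>z. Ln (1 - cnj \<zeta> * disk_aut w z)) holomorphic_on ball 0 1"
    using holomorphic_on_compose[OF h holomorphic_on_subset[OF hL[OF \<zeta>]]] by (simp add: o_def)
  then have "f holomorphic_on ball 0 1"
    unfolding f_def by (intro holomorphic_on_add holomorphic_on_diff hL assms)
  moreover have "exp (f z) = (1 - w * cnj w) / (1 - w * cnj z0)" if z: "z \<in> ball 0 1" for z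
  proof -
    note d = dom[OF z assms(1)] dom[OF z assms(2)] dom[OF disk_aut_in_ball[OF assms(1) z] \<zeta>] dom[OF assms(2,1)]
    define Y where "Y = 1 - cnj w * z"
    define V where "V = 1 - w * cnj z0"
    have nz: "Y \<noteq> 0" "1 - cnj \<zeta> * disk_aut w z \<noteq> 0" "1 - cnj z0 * z \<noteq> 0" "V \<noteq> 0"
      using d kernel_dom_nz by (auto simp: Y_def V_def)
    have "cnj \<zeta> * disk_aut w z = (cnj w - cnj z0) * (w - z) / (V * Y)"
      by (simp add: \<zeta>_def disk_aut_def Y_def V_def)
    moreover have "V * Y - (cnj w - cnj z0) * (w - z) = (1 - w * cnj w) * (1 - cnj z0 * z)"
      by (simp add: V_def Y_def algebra_simps)
    moreover have "1 - a / b = (b - a) / b" if "b \<noteq> 0" for a b :: complex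
      using that by (simp add: diff_divide_distrib)
    ultimately have "1 - cnj \<zeta> * disk_aut w z = (1 - w * cnj w) * (1 - cnj z0 * z) / (V * Y)"
      using nz by simp
    moreover have "exp (f z) = Y * (1 - cnj \<zeta> * disk_aut w z) / (1 - cnj z0 * z)"
      using nz by (simp add: f_def exp_add exp_diff Y_def)
    ultimately show ?thesis using nz by (simp add: V_def)
  qed
  ultimately have f0: "f z = f 0" if "z \<in> ball 0 1" for z
    using exp_const_imp_const that by blast
  show ?thesis
  proof
    fix z :: complex assume "z \<in> ball 0 1"
    from f0[OF this] have "Ln (1 - cnj z0 * z) = Ln (1 - cnj w * z) + Ln (1 - cnj \<zeta> * disk_aut w z) - f 0"
      by (simp add: f_def algebra_simps)
    moreover have "- b * (x + y - a) = b * a + (- b * x + - b * y)" for a b x y :: complex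
      by (simp add: algebra_simps)
    ultimately show "bergman_ker \<alpha> z0 z = exp (of_real (2 + \<alpha>) * f 0) *
       (bergman_ker \<alpha> w z * bergman_ker \<alpha> (disk_aut w z0) (disk_aut w z))"
      unfolding bergman_ker_def exp_add[symmetric] \<zeta>_def[symmetric] by (simp only:)
  qed
qed

text \<open>This is T_w e_j up to a factor depending on \<open>w\<close> alone, but defined and
  holomorphic beyond the closed disk, where the branch \<open>L\<close> gives no
  information.\<close>

definition ker_basis :: "real \<Rightarrow> complex \<Rightarrow> nat \<Rightarrow> complex \<Rightarrow> complex" where
  "ker_basis \<alpha> w j z = of_real (sqrt (bcoef \<alpha> j)) * (bergman_ker \<alpha> w z * disk_aut w z ^ j)"

lemma ker_basis_holomorphic: "ker_basis \<alpha> w j holomorphic_on kernel_dom w"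
  unfolding ker_basis_def by (intro holomorphic_intros bergman_ker_holomorphic disk_aut_holomorphic)

lemma ker_basis_continuous: "w \<in> ball 0 1 \<Longrightarrow> continuous_on (cball 0 1) (ker_basis \<alpha> w j)"
  unfolding ker_basis_def by (intro continuous_intros continuous_on_ker_cball)

lemma ker_basis_sum_norm:
  assumes "\<alpha> > -1" "w \<in> ball 0 1" "finite I"
  shows "(LINT z|bergman_measure \<alpha>. (cmod (\<Sum>j\<in>I. c j * ker_basis \<alpha> w j z))\<^sup>2) = ker_norm \<alpha> w * (\<Sum>j\<in>I. (cmod (c j))\<^sup>2)"
proof -
  have "(\<Sum>j\<in>I. c j * ker_basis \<alpha> w j z) = bergman_ker \<alpha> w z * (\<Sum>j\<in>I. (c j * of_real (sqrt (bcoef \<alpha> j))) * disk_aut w z ^ j)" for z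
    by (simp add: ker_basis_def sum_distrib_left mult_ac)
  then have "(LINT z|bergman_measure \<alpha>. (cmod (\<Sum>j\<in>I. c j * ker_basis \<alpha> w j z))\<^sup>2) =
    (\<Sum>j\<in>I. ker_norm \<alpha> w * (cmod (c j * of_real (sqrt (bcoef \<alpha> j))))\<^sup>2 / bcoef \<alpha> j)"
    by (simp only: ker_poly_norm[OF assms])
  also have "\<dots> = ker_norm \<alpha> w * (\<Sum>j\<in>I. (cmod (c j))\<^sup>2)"
    unfolding sum_distrib_left
  proof (rule sum.cong[OF refl])
    fix j
    show "ker_norm \<alpha> w * (cmod (c j * of_real (sqrt (bcoef \<alpha> j))))\<^sup>2 / bcoef \<alpha> j = ker_norm \<alpha> w * (cmod (c j))\<^sup>2"
      using bcoef_pos[OF assms(1), of j] by (simp add: norm_mult power_mult_distrib)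
  qed
  finally show ?thesis .
qed

text \<open>The relation for the modulus of \<theta> is the isometry property of T_w in the form
  needed here: it matches the norms of \<open>ker_basis\<close>.\<close>

lemma bergman_shift_basis:
  assumes "\<alpha> > -1" "w \<in> ball 0 1" "deriv_log_branch w L"
  obtains \<theta> where "(cmod \<theta>)\<^sup>2 * ker_norm \<alpha> w = ker_norm \<alpha> 0" "\<theta> \<noteq> 0"
    "\<And>j z. z \<in> ball 0 1 \<Longrightarrow> bergman_shift \<alpha> L w (bergman_basis \<alpha> j) z = \<theta> * ker_basis \<alpha> w j z"
proof -
  from deriv_log_branch_ker[OF assms(2,3), of \<alpha>] obtain \<theta> where
    \<theta>: "(cmod \<theta>)\<^sup>2 = (1 - (cmod w)\<^sup>2) powr (2 + \<alpha>)"
       "\<And>z. z \<in> ball 0 1 \<Longrightarrow> exp (of_real ((2 + \<alpha>) / 2) * L z) = \<theta> * bergman_ker \<alpha> w z"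
    by blast
  have w: "1 - (cmod w)\<^sup>2 > 0" using assms(2) by (simp add: abs_square_less_1)
  show ?thesis
  proof
    show "(cmod \<theta>)\<^sup>2 * ker_norm \<alpha> w = ker_norm \<alpha> 0"
    proof -
      have "(1 - (cmod w)\<^sup>2) powr (2 + \<alpha>) \<noteq> 0" using w by simp
      moreover have "p * (k * inverse p) = k" if "p \<noteq> 0" for p k :: real
        using that by simp
      ultimately show ?thesis unfolding \<theta>(1) ker_norm_eq[OF assms(1,2)] powr_minus by blast
    qed
    have "(cmod \<theta>)\<^sup>2 > 0" unfolding \<theta>(1) using w by simp
    then show "\<theta> \<noteq> 0" by auto
    show "bergman_shift \<alpha> L w (bergman_basis \<alpha> j) z = \<theta> * ker_basis \<alpha> w j z" if "z \<in> ball 0 1" for j z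
      using \<theta>(2)[OF that] by (simp add: bergman_shift_def bergman_basis_bcoef[OF assms(1)] ker_basis_def mult_ac)
  qed
qed

lemma ker_norm_pos: "\<alpha> > -1 \<Longrightarrow> w \<in> ball 0 1 \<Longrightarrow> ker_norm \<alpha> w > 0"
  using abs_square_less_1[of "cmod w"] by (subst ker_norm_eq) (simp_all add: ker_norm_0_pos)

text \<open>The normalised reproducing kernel at a point \<open>z0\<close> whose pseudohyperbolic distance from \<open>w\<close> is \<open>\<surd>t\<close>
  has its expansion along \<open>T_w e_n\<close> distributed like a negative binomial variable, of mean \<open>(2 + \<alpha>) t / (1 - t)\<close>;
  Markov's inequality bounds the part beyond \<open>m\<close>.\<close>

lemma kernel_approx:
  assumes \<alpha>: "\<alpha> > -1" and w: "w \<in> ball 0 1" and z0: "z0 \<in> ball 0 1" and m: "m > 0"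
    and L: "deriv_log_branch w L"
  defines "t \<equiv> (cmod (disk_aut w z0))\<^sup>2"
  defines "\<tau> \<equiv> (2 + \<alpha>) * t / ((1 - t) * m)"
  shows "\<exists>x. (LINT z|bergman_measure \<alpha>. (cmod (of_real (1 / sqrt (ker_norm \<alpha> z0)) * bergman_ker \<alpha> z0 z -
      (\<Sum>j<m. x j * bergman_shift \<alpha> L w (bergman_basis \<alpha> j) z)))\<^sup>2) \<le> \<tau> \<and>
      1 - \<tau> \<le> ker_norm \<alpha> 0 * (\<Sum>j<m. (cmod (x j))\<^sup>2) \<and> ker_norm \<alpha> 0 * (\<Sum>j<m. (cmod (x j))\<^sup>2) \<le> 1"
proof -
  let ?M = "bergman_measure \<alpha>"
  define \<zeta> where "\<zeta> = disk_aut w z0"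
  have \<zeta>: "cmod \<zeta> < 1" using disk_aut_in_ball[OF w z0] by (simp add: \<zeta>_def)
  have t: "0 \<le> t" "t < 1" using \<zeta> by (auto simp: t_def \<zeta>_def[symmetric] abs_square_less_1)
  define P where "P = (1 - t) powr (- (2 + \<alpha>))"
  have P: "P > 0" using t by (simp add: P_def)
  from bergman_ker_compose[OF w z0, of \<alpha>] obtain c' where
    c': "\<And>z. z \<in> ball 0 1 \<Longrightarrow> bergman_ker \<alpha> z0 z = c' * (bergman_ker \<alpha> w z * bergman_ker \<alpha> \<zeta> (disk_aut w z))"
    unfolding \<zeta>_def by blast
  define c where "c = of_real (1 / sqrt (ker_norm \<alpha> z0)) * c'"
  define K where "K z = of_real (1 / sqrt (ker_norm \<alpha> z0)) * bergman_ker \<alpha> z0 z" for z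
  define d where "d n = c * (of_real (bcoef \<alpha> n) * cnj \<zeta> ^ n)" for n
  have d2: "(cmod (d n))\<^sup>2 / bcoef \<alpha> n = (cmod c)\<^sup>2 * (bcoef \<alpha> n * t ^ n)" for n
    using bcoef_pos[OF \<alpha>, of n]
    by (simp add: d_def t_def \<zeta>_def[symmetric] norm_mult norm_power power_mult_distrib power2_eq_square flip: power_mult)
  have sd: "summable (\<lambda>n. cmod (d n))"
    using sums_summable[OF bcoef_sums_real[of "cmod \<zeta>" \<alpha>]] \<zeta> bcoef_pos[OF \<alpha>, THEN less_imp_le]
    by (simp add: d_def norm_mult norm_power)
  have kz: "bergman_ker \<alpha> w z \<noteq> 0" for z by (simp add: bergman_ker_def)
  have K: "(\<lambda>n. d n * disk_aut w z ^ n) sums (K z / bergman_ker \<alpha> w z)" if z: "z \<in> ball 0 1" for z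
  proof -
    have "cmod \<zeta> * cmod (disk_aut w z) < 1"
      using subsetD[OF cball_subset_kernel_dom[OF \<zeta>], of "disk_aut w z"] disk_aut_in_ball[OF w z]
      by (simp add: kernel_dom_def)
    from sums_mult[OF bergman_ker_expand[OF this, of \<alpha>], of c]
    have "(\<lambda>n. d n * disk_aut w z ^ n) sums (c * bergman_ker \<alpha> \<zeta> (disk_aut w z))"
      by (simp add: d_def mult_ac)
    moreover have "K z / bergman_ker \<alpha> w z = c * bergman_ker \<alpha> \<zeta> (disk_aut w z)"
      unfolding K_def c_def c'[OF z] using kz[of z] by simp
    ultimately show ?thesis by simp
  qed
  \<comment> \<open>\<open>K\<close> has norm 1, while its expansion gives
    \<open>ker_norm \<alpha> w\<close> |c|^2 (1-t)^-(2+\<alpha>). Comparing the two determines |c|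
    without computing the constant of \<open>bergman_ker_compose\<close>.\<close>
  have "(\<lambda>n. ker_norm \<alpha> w * (cmod (d n))\<^sup>2 / bcoef \<alpha> n) sums (LINT z|?M. (cmod (K z))\<^sup>2)"
  proof -
    have "(LINT z|?M. (cmod (bergman_ker \<alpha> w z * (\<Sum>n. d n * disk_aut w z ^ n)))\<^sup>2) = (LINT z|?M. (cmod (K z))\<^sup>2)"
      by (rule Bochner_Integration.integral_cong[OF refl])
         (use sums_unique[OF K, symmetric] kz in auto)
    then show ?thesis using ker_series_norm[OF \<alpha> w sd] by simp
  qed
  moreover have "(LINT z|?M. (cmod (K z))\<^sup>2) = 1"
    using ker_norm_pos[OF \<alpha> z0]
    by (simp add: K_def norm_mult norm_divide power_mult_distrib power_divide ker_norm_def[symmetric])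
  moreover have "(\<lambda>n. ker_norm \<alpha> w * (cmod (d n))\<^sup>2 / bcoef \<alpha> n) sums (ker_norm \<alpha> w * (cmod c)\<^sup>2 * P)"
    using sums_mult[OF bcoef_sums_real[of t \<alpha>], of "ker_norm \<alpha> w * (cmod c)\<^sup>2"] t
    unfolding P_def times_divide_eq_right[symmetric] d2 by (simp add: mult_ac)
  ultimately have N: "ker_norm \<alpha> w * (cmod c)\<^sup>2 * P = 1"
    using sums_unique2 by metis
  define d' where "d' n = (if n < m then 0 else d n)" for n
  have sd': "summable (\<lambda>n. cmod (d' n))"
    by (rule summable_comparison_test'[OF sd, of 0]) (simp add: d'_def)
  define Tl where "Tl = (\<Sum>n. if n < m then 0 else bcoef \<alpha> n * t ^ n)"
  note tail = bcoef_tail[OF \<alpha> t m]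
  have Tl: "Tl \<le> P * \<tau>" unfolding Tl_def P_def \<tau>_def by (rule tail(1))
  have Tl0: "0 \<le> Tl" unfolding Tl_def using bcoef_pos[OF \<alpha>, THEN less_imp_le] t
    by (intro suminf_nonneg tail(2)) auto
  have split: "P = (\<Sum>n<m. bcoef \<alpha> n * t ^ n) + Tl"
  proof -
    have "(\<lambda>n. if n < m then bcoef \<alpha> n * t ^ n else 0) sums (\<Sum>n<m. bcoef \<alpha> n * t ^ n)"
      using sums_If_finite_set[of "{..<m}" "\<lambda>n. bcoef \<alpha> n * t ^ n"] by simp
    from sums_add[OF this summable_sums[OF tail(2)]]
    have "(\<lambda>n. bcoef \<alpha> n * t ^ n) sums ((\<Sum>n<m. bcoef \<alpha> n * t ^ n) + Tl)"
      unfolding Tl_def by (simp add: if_distrib cong: if_cong)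
    moreover have "(\<lambda>n. bcoef \<alpha> n * t ^ n) sums P"
      unfolding P_def using bcoef_sums_real[of t \<alpha>] t by simp
    ultimately show ?thesis using sums_unique2 by blast
  qed
  obtain \<theta> where \<theta>: "(cmod \<theta>)\<^sup>2 * ker_norm \<alpha> w = ker_norm \<alpha> 0" "\<theta> \<noteq> 0"
    "\<And>j z. z \<in> ball 0 1 \<Longrightarrow> bergman_shift \<alpha> L w (bergman_basis \<alpha> j) z = \<theta> * ker_basis \<alpha> w j z"
    using bergman_shift_basis[OF \<alpha> w L] by blast
  define x where "x j = d j / (\<theta> * of_real (sqrt (bcoef \<alpha> j)))" for j
  have "(LINT z|?M. (cmod (K z - (\<Sum>j<m. x j * bergman_shift \<alpha> L w (bergman_basis \<alpha> j) z)))\<^sup>2)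
     = (LINT z|?M. (cmod (bergman_ker \<alpha> w z * (\<Sum>n. d' n * disk_aut w z ^ n)))\<^sup>2)"
  proof (rule Bochner_Integration.integral_cong[OF refl])
    fix z assume "z \<in> space ?M"
    then have z: "z \<in> ball 0 1" by simp
    have e: "x j * bergman_shift \<alpha> L w (bergman_basis \<alpha> j) z = bergman_ker \<alpha> w z * (d j * disk_aut w z ^ j)" for j
    proof -
      have "complex_of_real (sqrt (bcoef \<alpha> j)) \<noteq> 0" using bcoef_pos[OF \<alpha>, of j] by simp
      then show ?thesis using \<theta>(2) by (simp add: x_def \<theta>(3)[OF z] ker_basis_def)
    qed
    have "(\<lambda>n. if n < m then d n * disk_aut w z ^ n else 0) sums (\<Sum>n<m. d n * disk_aut w z ^ n)"
      using sums_If_finite_set[of "{..<m}" "\<lambda>n. d n * disk_aut w z ^ n"] by simp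
    from sums_diff[OF K[OF z] this]
    have "(\<lambda>n. d' n * disk_aut w z ^ n) sums (K z / bergman_ker \<alpha> w z - (\<Sum>n<m. d n * disk_aut w z ^ n))"
      by (rule sums_cong[THEN iffD1, rotated]) (simp add: d'_def)
    note su = sums_unique[OF this, symmetric]
    have "bergman_ker \<alpha> w z * (\<Sum>n. d' n * disk_aut w z ^ n) =
      K z - bergman_ker \<alpha> w z * (\<Sum>n<m. d n * disk_aut w z ^ n)"
      unfolding su using kz[of z] by (simp add: right_diff_distrib)
    then show "(cmod (K z - (\<Sum>j<m. x j * bergman_shift \<alpha> L w (bergman_basis \<alpha> j) z)))\<^sup>2 =
       (cmod (bergman_ker \<alpha> w z * (\<Sum>n. d' n * disk_aut w z ^ n)))\<^sup>2"
      by (simp only: e sum_distrib_left)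
  qed
  also have "\<dots> = ker_norm \<alpha> w * (cmod c)\<^sup>2 * Tl"
  proof -
    have "ker_norm \<alpha> w * (cmod (d' n))\<^sup>2 / bcoef \<alpha> n = ker_norm \<alpha> w * (cmod c)\<^sup>2 * (if n < m then 0 else bcoef \<alpha> n * t ^ n)" for n
      by (cases "n < m") (simp_all add: d'_def d2 mult.assoc flip: times_divide_eq_right)
    then have "(\<lambda>n. ker_norm \<alpha> w * (cmod (d' n))\<^sup>2 / bcoef \<alpha> n) sums (ker_norm \<alpha> w * (cmod c)\<^sup>2 * Tl)"
      unfolding Tl_def using sums_mult[OF summable_sums[OF tail(2)]] by simp
    then show ?thesis using ker_series_norm[OF \<alpha> w sd'] sums_unique2 by blast
  qed
  also have "\<dots> \<le> ker_norm \<alpha> w * (cmod c)\<^sup>2 * (P * \<tau>)"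
    using Tl ker_norm_pos[OF \<alpha> w] by (intro mult_left_mono) auto
  also have "\<dots> = \<tau>" using N by (simp add: mult.assoc[symmetric])
  finally have 1: "(LINT z|?M. (cmod (K z - (\<Sum>j<m. x j * bergman_shift \<alpha> L w (bergman_basis \<alpha> j) z)))\<^sup>2) \<le> \<tau>" .
  have "ker_norm \<alpha> 0 * (\<Sum>j<m. (cmod (x j))\<^sup>2) = ker_norm \<alpha> w * (cmod c)\<^sup>2 * (P - Tl)"
  proof -
    have "ker_norm \<alpha> 0 * (cmod (x j))\<^sup>2 = ker_norm \<alpha> w * (cmod c)\<^sup>2 * (bcoef \<alpha> j * t ^ j)" for j
    proof -
      have "(cmod (x j))\<^sup>2 = ((cmod (d j))\<^sup>2 / bcoef \<alpha> j) / (cmod \<theta>)\<^sup>2"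
        using bcoef_pos[OF \<alpha>, of j] by (simp add: x_def norm_divide norm_mult power_divide power_mult_distrib mult.commute)
      then show ?thesis unfolding d2 \<theta>(1)[symmetric] using \<theta>(2) by simp
    qed
    then show ?thesis unfolding split by (simp add: sum_distrib_left)
  qed
  also have "\<dots> = 1 - ker_norm \<alpha> w * (cmod c)\<^sup>2 * Tl" using N by (simp add: right_diff_distrib)
  finally have 2: "ker_norm \<alpha> 0 * (\<Sum>j<m. (cmod (x j))\<^sup>2) = 1 - ker_norm \<alpha> w * (cmod c)\<^sup>2 * Tl" .
  have 3: "ker_norm \<alpha> w * (cmod c)\<^sup>2 * Tl \<le> \<tau>"
  proof -
    have "ker_norm \<alpha> w * (cmod c)\<^sup>2 * Tl \<le> ker_norm \<alpha> w * (cmod c)\<^sup>2 * (P * \<tau>)"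
      using Tl ker_norm_pos[OF \<alpha> w] by (intro mult_left_mono) auto
    also have "\<dots> = \<tau>" using N by (simp add: mult.assoc[symmetric])
    finally show ?thesis .
  qed
  have 4: "ker_norm \<alpha> w * (cmod c)\<^sup>2 * Tl \<ge> 0"
    using Tl0 ker_norm_pos[OF \<alpha> w] by simp
  show ?thesis
    using 1 2 3 4 unfolding K_def by (intro exI[of _ x]) auto
qed

section \<open>Products of square integrable functions\<close>

lemma integrable_mult_cnj_L2:
  fixes f g :: "'a \<Rightarrow> complex"
  assumes [measurable]: "f \<in> borel_measurable M" "g \<in> borel_measurable M"
    and "integrable M (\<lambda>z. (cmod (f z))\<^sup>2)" "integrable M (\<lambda>z. (cmod (g z))\<^sup>2)"
  shows "integrable M (\<lambda>z. f z * cnj (g z))"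
proof (rule Bochner_Integration.integrable_bound)
  have [measurable]: "cnj \<in> borel_measurable borel"
    by (intro borel_measurable_continuous_onI continuous_intros)
  show "(\<lambda>z. f z * cnj (g z)) \<in> borel_measurable M" by measurable
  show "integrable M (\<lambda>z. (cmod (f z))\<^sup>2 + (cmod (g z))\<^sup>2)" using assms by simp
  show "AE z in M. norm (f z * cnj (g z)) \<le> norm ((cmod (f z))\<^sup>2 + (cmod (g z))\<^sup>2)"
  proof (rule AE_I2)
    fix z
    have "0 \<le> (cmod (f z) - cmod (g z))\<^sup>2" by simp
    then have "2 * (cmod (f z) * cmod (g z)) \<le> (cmod (f z))\<^sup>2 + (cmod (g z))\<^sup>2"
      by (simp add: power2_diff)
    moreover have "0 \<le> cmod (f z) * cmod (g z)" by simp
    ultimately have "cmod (f z) * cmod (g z) \<le> (cmod (f z))\<^sup>2 + (cmod (g z))\<^sup>2"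
      by linarith
    then show "norm (f z * cnj (g z)) \<le> norm ((cmod (f z))\<^sup>2 + (cmod (g z))\<^sup>2)"
      by (simp add: norm_mult)
  qed
qed

text \<open>Cauchy-Schwarz through 2xy \<le> \<eta> x^2 + y^2/\<eta>, which avoids square roots of
  integrals; the free \<eta> balances factors of very different size.\<close>

lemma norm_integral_mult_cnj_le:
  fixes f g :: "'a \<Rightarrow> complex"
  assumes "f \<in> borel_measurable M" "g \<in> borel_measurable M"
    and "integrable M (\<lambda>z. (cmod (f z))\<^sup>2)" "integrable M (\<lambda>z. (cmod (g z))\<^sup>2)" "\<eta> > 0"
  shows "2 * cmod (LINT z|M. f z * cnj (g z)) \<le>
    \<eta> * (LINT z|M. (cmod (f z))\<^sup>2) + (LINT z|M. (cmod (g z))\<^sup>2) / \<eta>"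
proof -
  have "cmod (LINT z|M. f z * cnj (g z)) \<le> (LINT z|M. cmod (f z * cnj (g z)))"
    by (rule integral_norm_bound)
  also have "\<dots> \<le> (LINT z|M. (\<eta> * (cmod (f z))\<^sup>2 + (cmod (g z))\<^sup>2 / \<eta>) / 2)"
  proof (rule integral_mono)
    show "integrable M (\<lambda>z. cmod (f z * cnj (g z)))"
      using integrable_mult_cnj_L2[OF assms(1-4)] by (rule integrable_norm)
    fix z
    have "0 \<le> (sqrt \<eta> * cmod (f z) - cmod (g z) / sqrt \<eta>)\<^sup>2" by simp
    also have "\<dots> = \<eta> * (cmod (f z))\<^sup>2 + (cmod (g z))\<^sup>2 / \<eta> - 2 * (cmod (f z) * cmod (g z))"
      using assms(5) by (simp add: power2_diff power_mult_distrib power_divide)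
    finally show "cmod (f z * cnj (g z)) \<le> (\<eta> * (cmod (f z))\<^sup>2 + (cmod (g z))\<^sup>2 / \<eta>) / 2"
      by (simp add: norm_mult)
  qed (use assms in simp)
  also have "\<dots> = (\<eta> * (LINT z|M. (cmod (f z))\<^sup>2) + (LINT z|M. (cmod (g z))\<^sup>2) / \<eta>) / 2"
    using assms by simp
  finally show ?thesis by simp
qed

section \<open>Necessity\<close>

lemma bergman_shift_basis_L2:
  assumes "\<alpha> > -1" "w \<in> ball 0 1" "deriv_log_branch w L"
  shows "bergman_shift \<alpha> L w (bergman_basis \<alpha> j) \<in> borel_measurable (bergman_measure \<alpha>)"
    and "integrable (bergman_measure \<alpha>) (\<lambda>z. (cmod (bergman_shift \<alpha> L w (bergman_basis \<alpha> j) z))\<^sup>2)"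
proof -
  obtain \<theta> where "(cmod \<theta>)\<^sup>2 * ker_norm \<alpha> w = ker_norm \<alpha> 0" "\<theta> \<noteq> 0"
    and \<theta>: "\<And>j z. z \<in> ball 0 1 \<Longrightarrow> bergman_shift \<alpha> L w (bergman_basis \<alpha> j) z = \<theta> * ker_basis \<alpha> w j z"
    using bergman_shift_basis[OF assms] by blast
  have c: "continuous_on (cball 0 1) (\<lambda>z. \<theta> * ker_basis \<alpha> w j z)"
    by (intro continuous_intros ker_basis_continuous assms)
  have "(\<lambda>z. \<theta> * ker_basis \<alpha> w j z) \<in> borel_measurable (bergman_measure \<alpha>)"
    by (rule continuous_on_borel_measurable_bergman, rule continuous_on_subset[OF c]) auto
  then show "bergman_shift \<alpha> L w (bergman_basis \<alpha> j) \<in> borel_measurable (bergman_measure \<alpha>)"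
    by (rule measurable_cong[THEN iffD1, rotated]) (simp add: \<theta>)
  have "integrable (bergman_measure \<alpha>) (\<lambda>z. (cmod (\<theta> * ker_basis \<alpha> w j z))\<^sup>2)"
    by (intro integrable_bergman_continuous assms continuous_intros ker_basis_continuous)
  then show "integrable (bergman_measure \<alpha>) (\<lambda>z. (cmod (bergman_shift \<alpha> L w (bergman_basis \<alpha> j) z))\<^sup>2)"
    by (rule Bochner_Integration.integrable_cong[THEN iffD1, OF refl, rotated]) (simp add: \<theta>)
qed

lemma norm_add_square_le: "(cmod (a + b))\<^sup>2 \<le> 2 * (cmod a)\<^sup>2 + 2 * (cmod b)\<^sup>2"
proof -
  have "(cmod (a + b))\<^sup>2 \<le> (cmod a + cmod b)\<^sup>2"
    by (intro power_mono norm_triangle_ineq) auto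
  moreover have "0 \<le> (cmod a - cmod b)\<^sup>2" by simp
  ultimately show ?thesis by (simp add: power2_sum power2_diff)
qed

lemma integrable_L2_add:
  fixes f g :: "'a \<Rightarrow> complex"
  assumes [measurable]: "f \<in> borel_measurable M" "g \<in> borel_measurable M"
    and "integrable M (\<lambda>z. (cmod (f z))\<^sup>2)" "integrable M (\<lambda>z. (cmod (g z))\<^sup>2)"
  shows "integrable M (\<lambda>z. (cmod (f z + g z))\<^sup>2)"
proof (rule Bochner_Integration.integrable_bound)
  show "integrable M (\<lambda>z. 2 * (cmod (f z))\<^sup>2 + 2 * (cmod (g z))\<^sup>2)" using assms by simp
qed (use norm_add_square_le in \<open>auto intro!: AE_I2\<close>)

lemma integrable_L2_sum:
  fixes f :: "'i \<Rightarrow> 'a \<Rightarrow> complex"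
  assumes "\<And>i. i \<in> I \<Longrightarrow> f i \<in> borel_measurable M" "\<And>i. i \<in> I \<Longrightarrow> integrable M (\<lambda>z. (cmod (f i z))\<^sup>2)"
  shows "integrable M (\<lambda>z. (cmod (\<Sum>i\<in>I. c i * f i z))\<^sup>2)"
  using assms
proof (induction I rule: infinite_finite_induct)
  case (insert i I)
  then have "integrable M (\<lambda>z. (cmod (c i * f i z + (\<Sum>i\<in>I. c i * f i z)))\<^sup>2)"
    by (intro integrable_L2_add borel_measurable_times borel_measurable_const borel_measurable_sum)
       (auto simp: norm_mult power_mult_distrib)
  then show ?case using insert by simp
qed simp_all

text \<open>The radii are tuned to the Markov bound of \<open>kernel_approx\<close>: t <
  (m-C)/(m+\<alpha>+1) gives t (C+\<alpha>+1) \<le> (1-t) m, so the error is at most \<tau> whatever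
  m is. Both finite sums approximate the same normalised kernel at \<open>z0\<close> with squared
  error \<tau>, whence 4 \<tau> for their difference.\<close>

lemma pseudohyp_disk_overlap:
  assumes \<alpha>: "\<alpha> > -1" and "w \<in> ball 0 1" "u \<in> ball 0 1" and C: "C > 0" "real m > C" "real n > C"
    and L: "deriv_log_branch w L" "deriv_log_branch u L'"
    and z0: "z0 \<in> pseudohyp_disk w (sqrt ((m - C) / (m + \<alpha> + 1)))"
      "z0 \<in> pseudohyp_disk u (sqrt ((n - C) / (n + \<alpha> + 1)))"
  defines "\<tau> \<equiv> (2 + \<alpha>) / (C + \<alpha> + 1)"
  shows "\<exists>x y. (LINT z|bergman_measure \<alpha>. (cmod ((\<Sum>j<m. x j * bergman_shift \<alpha> L w (bergman_basis \<alpha> j) z) -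
      (\<Sum>j<n. y j * bergman_shift \<alpha> L' u (bergman_basis \<alpha> j) z)))\<^sup>2) \<le> 4 * \<tau> \<and>
      1 - \<tau> \<le> ker_norm \<alpha> 0 * (\<Sum>j<m. (cmod (x j))\<^sup>2) \<and> ker_norm \<alpha> 0 * (\<Sum>j<m. (cmod (x j))\<^sup>2) \<le> 1"
proof -
  let ?M = "bergman_measure \<alpha>"
  have \<tau>: "(2 + \<alpha>) * t / ((1 - t) * m) \<le> \<tau>" "m > 0"
    if m: "real m > C" and z: "z0 \<in> pseudohyp_disk v (sqrt ((m - C) / (m + \<alpha> + 1)))"
     and t: "t = (cmod (disk_aut v z0))\<^sup>2" for m t v
  proof -
    show "m > 0" using m C by linarith
    have q: "(m - C) / (m + \<alpha> + 1) > 0" using m C \<alpha> by simp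
    have "cmod (disk_aut v z0) < sqrt ((m - C) / (m + \<alpha> + 1))"
      using z by (simp add: pseudohyp_disk_def pseudohyp_dist_def)
    then have "t < (sqrt ((m - C) / (m + \<alpha> + 1)))\<^sup>2"
      unfolding t by (intro power_strict_mono) auto
    then have "t < (m - C) / (m + \<alpha> + 1)" using q by simp
    then have t1: "t * (m + \<alpha> + 1) < m - C"
      using m C \<alpha> by (simp add: pos_less_divide_eq)
    have "(1 - t) * (m + \<alpha> + 1) > C + \<alpha> + 1" using t1 by (simp add: algebra_simps)
    moreover have "C + \<alpha> + 1 > 0" using C \<alpha> by linarith
    ultimately have "(1 - t) * (m + \<alpha> + 1) > 0" by linarith
    then have t2: "1 - t > 0" using m C \<alpha> by (simp add: zero_less_mult_iff)
    have t0: "t \<ge> 0" by (simp add: t)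
    have "t * (C + \<alpha> + 1) \<le> (1 - t) * m"
    proof (rule ccontr)
      assume "\<not> ?thesis"
      then have "t * (m + \<alpha> + 1) + t * C > m" by (simp add: algebra_simps)
      moreover have "t * C \<le> 1 * C" using t2 C by (intro mult_right_mono) auto
      ultimately show False using t1 by linarith
    qed
    then have "t / ((1 - t) * m) \<le> 1 / (C + \<alpha> + 1)"
      using t2 \<open>m > 0\<close> C \<alpha> by (simp add: field_simps)
    then have "(2 + \<alpha>) * (t / ((1 - t) * m)) \<le> (2 + \<alpha>) * (1 / (C + \<alpha> + 1))"
      using \<alpha> by (intro mult_left_mono) auto
    then show "(2 + \<alpha>) * t / ((1 - t) * m) \<le> \<tau>" by (simp add: \<tau>_def)
  qed
  have z0b: "z0 \<in> ball 0 1" using z0 by (simp add: pseudohyp_disk_def)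
  define K where "K z = of_real (1 / sqrt (ker_norm \<alpha> z0)) * bergman_ker \<alpha> z0 z" for z
  define T where "T L w j = bergman_shift \<alpha> L w (bergman_basis \<alpha> j)" for L w j
  from kernel_approx[OF \<alpha> assms(2) z0b \<tau>(2)[OF C(2) z0(1) refl] L(1)] \<tau>(1)[OF C(2) z0(1) refl]
  obtain x where x: "(LINT z|?M. (cmod (K z - (\<Sum>j<m. x j * T L w j z)))\<^sup>2) \<le> \<tau>"
    "1 - \<tau> \<le> ker_norm \<alpha> 0 * (\<Sum>j<m. (cmod (x j))\<^sup>2)" "ker_norm \<alpha> 0 * (\<Sum>j<m. (cmod (x j))\<^sup>2) \<le> 1"
    unfolding K_def[symmetric] T_def[symmetric] by (smt (verit, best))
  from kernel_approx[OF \<alpha> assms(3) z0b \<tau>(2)[OF C(3) z0(2) refl] L(2)] \<tau>(1)[OF C(3) z0(2) refl]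
  obtain y where y: "(LINT z|?M. (cmod (K z - (\<Sum>j<n. y j * T L' u j z)))\<^sup>2) \<le> \<tau>"
    unfolding K_def[symmetric] T_def[symmetric] by (smt (verit, best))
  have cK: "continuous_on (cball 0 1) K"
    unfolding K_def by (intro continuous_intros continuous_on_ker_cball z0b)
  have mK: "K \<in> borel_measurable ?M"
    by (rule continuous_on_borel_measurable_bergman, rule continuous_on_subset[OF cK]) auto
  have iK: "integrable ?M (\<lambda>z. (cmod (K z))\<^sup>2)"
    by (intro integrable_bergman_continuous[OF \<alpha>] continuous_intros cK)
  define X where "X z = (\<Sum>j<m. x j * T L w j z)" for z
  define Y where "Y z = (\<Sum>j<n. y j * T L' u j z)" for z
  note TL = bergman_shift_basis_L2[OF \<alpha> assms(2) L(1), folded T_def] bergman_shift_basis_L2[OF \<alpha> assms(3) L(2), folded T_def]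
  have mX: "X \<in> borel_measurable ?M" "Y \<in> borel_measurable ?M"
    unfolding X_def Y_def using TL by auto
  have iX: "integrable ?M (\<lambda>z. (cmod (X z))\<^sup>2)" "integrable ?M (\<lambda>z. (cmod (Y z))\<^sup>2)"
    unfolding X_def Y_def using TL by (auto intro!: integrable_L2_sum)
  have iKX: "integrable ?M (\<lambda>z. (cmod (K z - X z))\<^sup>2)" "integrable ?M (\<lambda>z. (cmod (K z - Y z))\<^sup>2)"
    using integrable_L2_add[OF mK borel_measurable_uminus[OF mX(1)] iK]
      integrable_L2_add[OF mK borel_measurable_uminus[OF mX(2)] iK] iX by auto
  have "(LINT z|?M. (cmod (X z - Y z))\<^sup>2) \<le> (LINT z|?M. 2 * (cmod (K z - X z))\<^sup>2 + 2 * (cmod (K z - Y z))\<^sup>2)"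
  proof (rule integral_mono)
    show "integrable ?M (\<lambda>z. (cmod (X z - Y z))\<^sup>2)"
      using integrable_L2_add[OF mX(1) borel_measurable_uminus[OF mX(2)] iX(1)] iX(2) by simp
    show "(cmod (X z - Y z))\<^sup>2 \<le> 2 * (cmod (K z - X z))\<^sup>2 + 2 * (cmod (K z - Y z))\<^sup>2" for z
      using norm_add_square_le[of "X z - K z" "K z - Y z"] by (simp add: norm_minus_commute)
  qed (use iKX in simp)
  also have "\<dots> \<le> 4 * \<tau>" using x(1) y iKX by (simp add: X_def Y_def)
  finally show ?thesis using x(2,3) unfolding X_def Y_def T_def by blast
qed

text \<open>If every C fails, there are overlapping pairs with arbitrarily small error. Prescribe
  2^-k \<open>x k\<close> at \<open>w k\<close> and 0 at \<open>u k\<close>. Pairing the interpolant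
  with the difference of the two almost equal sums gives at least a constant times 2^-k, but
  Cauchy-Schwarz allows only a constant times 4^-k.\<close>

lemma interpolating_imp_disjoint:
  assumes \<alpha>: "\<alpha> > -1" and div: "divisor \<Lambda> m" and L: "\<forall>w\<in>\<Lambda>. deriv_log_branch w (L w)"
    and interp: "interpolating \<alpha> L \<Lambda> m"
  shows "\<exists>C::real. C > 0 \<and> disjoint_family_on
      (\<lambda>w. pseudohyp_disk w (sqrt ((real (m w) - C) / (real (m w) + \<alpha> + 1)))) {w\<in>\<Lambda>. real (m w) > C}"
proof (rule ccontr)
  assume no: "\<not> ?thesis"
  let ?M = "bergman_measure \<alpha>"
  define T where "T w j = bergman_shift \<alpha> (L w) w (bergman_basis \<alpha> j)" for w j
  \<comment> \<open>Chosen so that (2+\<alpha>) / \<open>Ck k\<close> is \<open>\<tau> k\<close>;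
    powers of 16 make the norms of the differences decay like 4^-k, faster than the masses 2^-k of
    the datum.\<close>
  define Ck where "Ck k = 2 * (2 + \<alpha>) * 16 ^ k" for k :: nat
  have Ck: "Ck k > 0" for k using \<alpha> by (simp add: Ck_def)
  define \<tau> :: "nat \<Rightarrow> real" where "\<tau> k = (1/2) / 16 ^ k" for k
  define P where "P k wu \<longleftrightarrow> (case wu of (w, u) \<Rightarrow> w \<in> \<Lambda> \<and> u \<in> \<Lambda> \<and> w \<noteq> u \<and>
     (\<exists>x y. (LINT z|?M. (cmod ((\<Sum>j<m w. x j * T w j z) - (\<Sum>j<m u. y j * T u j z)))\<^sup>2) \<le> 4 * \<tau> k \<and>
      1 - \<tau> k \<le> ker_norm \<alpha> 0 * (\<Sum>j<m w. (cmod (x j))\<^sup>2) \<and> ker_norm \<alpha> 0 * (\<Sum>j<m w. (cmod (x j))\<^sup>2) \<le> 1))" for k :: nat and wu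
  define big where "big B wu \<longleftrightarrow> m (fst wu) > B \<and> m (snd wu) > B" for B :: nat and wu
  have step: "\<exists>wu. P k wu \<and> big B wu" for k B
  proof -
    \<comment> \<open>Taking C at least \<open>B\<close> forces both multiplicities of the
      overlapping pair above \<open>B\<close>.\<close>
    define C where "C = max (Ck k) (real B)"
    have C: "C > 0" using Ck[of k] by (simp add: C_def)
    then obtain w u z0 where wu: "w \<in> \<Lambda>" "u \<in> \<Lambda>" "w \<noteq> u" "real (m w) > C" "real (m u) > C"
      "z0 \<in> pseudohyp_disk w (sqrt ((real (m w) - C) / (real (m w) + \<alpha> + 1)))"
      "z0 \<in> pseudohyp_disk u (sqrt ((real (m u) - C) / (real (m u) + \<alpha> + 1)))"
      using no unfolding disjoint_family_on_def by blast
    have b: "w \<in> ball 0 1" "u \<in> ball 0 1" using div wu by (auto simp: divisor_def)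
    have "(2 + \<alpha>) / (C + \<alpha> + 1) \<le> (2 + \<alpha>) / Ck k"
      using Ck[of k] \<alpha> by (intro divide_left_mono) (auto simp: C_def)
    also have "\<dots> = \<tau> k"     proof -
      have "a / (2 * a * b) = (1/2) / b" if "a \<noteq> 0" for a b :: real using that by simp
      from this[of "2 + \<alpha>" "16 ^ k"] show ?thesis using \<alpha> unfolding Ck_def \<tau>_def by linarith
    qed
    finally have t: "(2 + \<alpha>) / (C + \<alpha> + 1) \<le> \<tau> k" .
    have "P k (w, u)"
      using pseudohyp_disk_overlap[OF \<alpha> b C wu(4,5) L[rule_format, OF wu(1)] L[rule_format, OF wu(2)] wu(6,7)] wu(1-3) t
      unfolding P_def prod.case T_def[symmetric] by (smt (verit, best))
    moreover have "big B (w, u)" using wu(4,5) by (simp add: big_def C_def)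
    ultimately show ?thesis by blast
  qed
  \<comment> \<open>Multiplicities increase strictly from pair to pair. Hence the \<open>w k\<close>
    are distinct and no \<open>u k\<close> is a \<open>w k'\<close>, so the datum can be prescribed
    at all of them at once.\<close>
  have "\<exists>f. \<forall>k. P k (f k) \<and> big (max (m (fst (f k))) (m (snd (f k)))) (f (Suc k))"
    by (rule dependent_nat_choice) (use step in blast)+
  then obtain f where f: "\<And>k. P k (f k)" "\<And>k. big (max (m (fst (f k))) (m (snd (f k)))) (f (Suc k))"
    by blast
  define w where "w k = fst (f k)" for k
  define u where "u k = snd (f k)" for k
  have lt: "max (m (w k)) (m (u k)) < min (m (w k')) (m (u k'))" if "k < k'" for k k'
    using that
  proof (induction k')
    case (Suc k')
    have 1: "max (m (w k')) (m (u k')) < min (m (w (Suc k'))) (m (u (Suc k')))"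
      using f(2)[of k'] by (simp add: big_def w_def u_def)
    show ?case
    proof (cases "k = k'")
      case False
      then have "max (m (w k)) (m (u k)) < min (m (w k')) (m (u k'))" using Suc by simp
      with 1 show ?thesis by linarith
    qed (use 1 in simp)
  qed simp
  have \<Lambda>: "w k \<in> \<Lambda>" "u k \<in> \<Lambda>" "w k \<noteq> u k" for k
    using f(1)[of k] by (auto simp: P_def w_def u_def)
  have inj: "inj w"
  proof (rule injI)
    fix k k' assume "w k = w k'"
    then show "k = k'" using lt[of k k'] lt[of k' k] by (cases k k' rule: linorder_cases) auto
  qed
  have uw: "u k \<noteq> w k'" for k k'
    using lt[of k k'] lt[of k' k] \<Lambda>(3)[of k] by (cases k k' rule: linorder_cases) auto
  define Q where "Q k x y \<longleftrightarrow> (LINT z|?M. (cmod ((\<Sum>j<m (w k). x j * T (w k) j z) - (\<Sum>j<m (u k). y j * T (u k) j z)))\<^sup>2) \<le> 4 * \<tau> k \<and>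
      1 - \<tau> k \<le> ker_norm \<alpha> 0 * (\<Sum>j<m (w k). (cmod (x j))\<^sup>2) \<and> ker_norm \<alpha> 0 * (\<Sum>j<m (w k). (cmod (x j))\<^sup>2) \<le> 1" for k x y
  have "\<forall>k. \<exists>x y. Q k x y"
    using f(1) by (auto simp: P_def Q_def w_def u_def case_prod_beta)
  then obtain x y where "\<And>k. Q k (x k) (y k)" by metis
  then have xy:
    "\<And>k. (LINT z|?M. (cmod ((\<Sum>j<m (w k). x k j * T (w k) j z) - (\<Sum>j<m (u k). y k j * T (u k) j z)))\<^sup>2) \<le> 4 * \<tau> k"
    "\<And>k. 1 - \<tau> k \<le> ker_norm \<alpha> 0 * (\<Sum>j<m (w k). (cmod (x k j))\<^sup>2)"
    "\<And>k. ker_norm \<alpha> 0 * (\<Sum>j<m (w k). (cmod (x k j))\<^sup>2) \<le> 1"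
    unfolding Q_def by blast+
  define v where "v z j = (if z \<in> range w then of_real ((1/2) ^ inv w z) * x (inv w z) j else 0)" for z j
  have vw: "v (w k) j = of_real ((1/2) ^ k) * x k j" for k j
    using inj by (simp add: v_def inv_f_f)
  have vu: "v (u k) j = 0" for k j using uw[of k] by (auto simp: v_def)
  have K: "ker_norm \<alpha> 0 > 0" by (rule ker_norm_0_pos[OF \<alpha>])
  have "v \<in> ell2 \<Lambda> m"
  proof -
    define S where "S k = (\<Sum>j<m (w k). (cmod (v (w k) j))\<^sup>2)" for k
    have "S k \<le> (1/4) ^ k / ker_norm \<alpha> 0" for k
    proof -
      have "S k = (1/4) ^ k * (\<Sum>j<m (w k). (cmod (x k j))\<^sup>2)"
      proof -
        have "((1/2::real) ^ k)\<^sup>2 = ((1/2)\<^sup>2) ^ k" by (metis power_mult mult.commute)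
        also have "(1/2::real)\<^sup>2 = 1/4" by (simp add: power2_eq_square)
        finally have "(cmod (of_real ((1/2) ^ k) * x k j))\<^sup>2 = (1/4) ^ k * (cmod (x k j))\<^sup>2" for j
          unfolding norm_mult norm_of_real power_mult_distrib by simp
        then show ?thesis unfolding S_def vw sum_distrib_left by simp
      qed
      also have "\<dots> \<le> (1/4) ^ k * (1 / ker_norm \<alpha> 0)"
        using xy(3)[of k] K by (intro mult_left_mono) (auto simp: field_simps)
      finally show ?thesis by simp
    qed
    moreover have "summable (\<lambda>k. (1/4) ^ k / ker_norm \<alpha> 0)"
      by (intro summable_divide summable_geometric) simp
    moreover have S0: "S k \<ge> 0" for k unfolding S_def by (intro sum_nonneg) auto
    ultimately have S1: "\<And>k. S k \<le> (1/4) ^ k / ker_norm \<alpha> 0" "summable (\<lambda>k. (1/4) ^ k / ker_norm \<alpha> 0)"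
      by blast+
    have "summable S"
    proof (rule summable_comparison_test'[OF S1(2), of 0])
      show "norm (S k) \<le> (1/4) ^ k / ker_norm \<alpha> 0" for k
        using S0[of k] S1(1)[of k] by (simp only: real_norm_def abs_of_nonneg)
    qed
    then have "S summable_on UNIV"
      using S0 by (simp add: summable_on_UNIV_nonneg_real_iff)
    then have "(\<lambda>z. \<Sum>j<m z. (cmod (v z j))\<^sup>2) summable_on range w"
      using summable_on_reindex[OF inj, of "\<lambda>z. \<Sum>j<m z. (cmod (v z j))\<^sup>2"]
      by (simp add: S_def[abs_def] o_def)
    then have "(\<lambda>z. \<Sum>j<m z. (cmod (v z j))\<^sup>2) summable_on \<Lambda>"
      by (rule summable_on_cong_neutral[THEN iffD1, rotated -1]) (use \<Lambda> in \<open>auto simp: v_def\<close>)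
    then show ?thesis by (simp add: ell2_def)
  qed
  with interp obtain F where F: "F \<in> bergman_space \<alpha>"
    "\<And>z j. z \<in> \<Lambda> \<Longrightarrow> j < m z \<Longrightarrow> bergman_inner \<alpha> F (T z j) = v z j"
    unfolding interpolating_def T_def by blast
  have Fi: "integrable ?M (\<lambda>z. (cmod (F z))\<^sup>2)" using F(1) by (simp add: bergman_space_def)
  have Fm: "F \<in> borel_measurable ?M"
    using F(1) by (intro continuous_on_borel_measurable_bergman) (auto simp: bergman_space_def holomorphic_on_imp_continuous_on)
  define A where "A = (LINT z|?M. (cmod (F z))\<^sup>2)"
  have b: "z \<in> ball 0 1" if "z \<in> \<Lambda>" for z using div that by (auto simp: divisor_def)
  note TL = bergman_shift_basis_L2[OF \<alpha> b L[rule_format], folded T_def]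
  have bound: "2 ^ k \<le> (A + 2) * ker_norm \<alpha> 0" for k
  proof -
    define g where "g z = (\<Sum>j<m (w k). x k j * T (w k) j z)" for z
    define h where "h z = (\<Sum>j<m (u k). y k j * T (u k) j z)" for z
    have mgh: "g \<in> borel_measurable ?M" "h \<in> borel_measurable ?M"
      unfolding g_def h_def using TL \<Lambda> by auto
    have igh: "integrable ?M (\<lambda>z. (cmod (g z))\<^sup>2)" "integrable ?M (\<lambda>z. (cmod (h z))\<^sup>2)"
      unfolding g_def h_def using TL \<Lambda> by (auto intro!: integrable_L2_sum)
    have i: "integrable ?M (\<lambda>z. (cmod (g z - h z))\<^sup>2)"
      using integrable_L2_add[OF mgh(1) borel_measurable_uminus[OF mgh(2)] igh(1)] igh(2) by simp
    have iT: "integrable ?M (\<lambda>z. F z * cnj (T z' j z))" if "z' \<in> \<Lambda>" for z' j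
      by (rule integrable_mult_cnj_L2[OF Fm TL(1)[OF that that] Fi TL(2)[OF that that]])
    have "(LINT z|?M. F z * cnj (g z - h z)) =
       (LINT z|?M. (\<Sum>j<m (w k). cnj (x k j) * (F z * cnj (T (w k) j z))) - (\<Sum>j<m (u k). cnj (y k j) * (F z * cnj (T (u k) j z))))"
      by (rule Bochner_Integration.integral_cong[OF refl]) (simp add: g_def h_def sum_distrib_left algebra_simps)
    also have "\<dots> = (\<Sum>j<m (w k). cnj (x k j) * v (w k) j) - (\<Sum>j<m (u k). cnj (y k j) * v (u k) j)"
    proof -
      have "(LINT z|?M. F z * cnj (T z' j z)) = v z' j" if "z' \<in> \<Lambda>" "j < m z'" for z' j
        using F(2)[OF that] by (simp add: bergman_inner_def)
      then show ?thesis
        using iT \<Lambda> by (subst Bochner_Integration.integral_diff) (auto simp: Bochner_Integration.integral_sum)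
    qed
    also have "\<dots> = of_real ((1/2) ^ k * (\<Sum>j<m (w k). (cmod (x k j))\<^sup>2))"
      unfolding vw vu by (simp add: sum_distrib_left complex_norm_square mult_ac del: of_real_power)
    finally have "cmod (LINT z|?M. F z * cnj (g z - h z)) = (1/2) ^ k * (\<Sum>j<m (w k). (cmod (x k j))\<^sup>2)"
      by (simp only: norm_of_real) (simp add: sum_nonneg)
    \<comment> \<open>The squared norms are bounded by a constant and by a constant times 16^-k;
      this \<eta> makes both terms of order 4^-k.\<close>
    with norm_integral_mult_cnj_le[OF Fm borel_measurable_diff[OF mgh] Fi i, of "(1/4) ^ k"]
    have "2 * ((1/2) ^ k * (\<Sum>j<m (w k). (cmod (x k j))\<^sup>2)) \<le> (1/4) ^ k * A + (LINT z|?M. (cmod (g z - h z))\<^sup>2) / (1/4) ^ k"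
      by (simp add: A_def)
    also have "\<dots> \<le> (1/4) ^ k * A + 4 * \<tau> k / (1/4) ^ k"
      using xy(1)[of k] unfolding g_def h_def by (intro add_left_mono divide_right_mono) auto
    also have "4 * \<tau> k / (1/4) ^ k = (1/4) ^ k * 2"
    proof -
      have "(16::real) ^ k = 4 ^ k * 4 ^ k" by (simp flip: power_mult_distrib)
      then show ?thesis by (simp add: \<tau>_def field_simps power_divide)
    qed
    finally have 1: "2 * ((1/2) ^ k * (\<Sum>j<m (w k). (cmod (x k j))\<^sup>2)) \<le> (1/4) ^ k * (A + 2)"
      by (simp add: algebra_simps)
    have "\<tau> k \<le> 1/2" by (simp add: \<tau>_def field_simps)
    then have "1 \<le> 2 * (ker_norm \<alpha> 0 * (\<Sum>j<m (w k). (cmod (x k j))\<^sup>2))"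
      using xy(2)[of k] by linarith
    then have "(1/2) ^ k * 1 \<le> (1/2) ^ k * (2 * (ker_norm \<alpha> 0 * (\<Sum>j<m (w k). (cmod (x k j))\<^sup>2)))"
      by (intro mult_left_mono) auto
    also have "\<dots> = ker_norm \<alpha> 0 * (2 * ((1/2) ^ k * (\<Sum>j<m (w k). (cmod (x k j))\<^sup>2)))" by simp
    also have "\<dots> \<le> ker_norm \<alpha> 0 * ((1/4) ^ k * (A + 2))"
      using 1 K by (intro mult_left_mono) auto
    finally have "4 ^ k * (1/2) ^ k \<le> 4 ^ k * (ker_norm \<alpha> 0 * ((1/4) ^ k * (A + 2)))"
      by (intro mult_left_mono) auto
    moreover have "(4::real) ^ k * (1/2) ^ k = 2 ^ k" "(4::real) ^ k * (1/4) ^ k = 1"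
      by (simp_all flip: power_mult_distrib)
    ultimately show ?thesis by (simp add: mult_ac)
  qed
  obtain k where "(A + 2) * ker_norm \<alpha> 0 < 2 ^ k"
    using real_arch_pow[of 2] by auto
  with bound[of k] show False by simp
qed

section \<open>The weighted d-bar inequality\<close>

lemma wirtinger2E:
  assumes "wirtinger2 S f a b c"
  obtains a' b' where "wirtinger S f a b" "wirtinger S a a' c" "wirtinger S b c b'"
  using assms unfolding wirtinger2_def by blast

lemma wirtinger_one_minus_norm:
  "wirtinger S (\<lambda>z. of_real (1 - (cmod z)\<^sup>2)) (\<lambda>z. - cnj z) (\<lambda>z. - z)"
proof -
  have "wirtinger S (\<lambda>z. 1 - z * cnj z) (\<lambda>z. - cnj z) (\<lambda>z. - z)"
    using wirtinger_diff[OF wirtinger_const[of S 1] wirtinger_mult[OF wirtinger_id wirtinger_cnj[OF wirtinger_id]]]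
    by simp
  then show ?thesis by (simp add: complex_norm_square del: of_real_power)
qed

text \<open>With \<open>\<psi> = k - (\<alpha> + 2) ln (1 - |z|\<^sup>2)\<close> and \<open>V = (1 - |z|\<^sup>2) powr (\<alpha> + 2) Q\<close> this is the commutator identity
  \<open>\<integral>|\<partial>V|\<^sup>2 e\<^sup>\<psi> = \<integral>|\<partial>\<^sub>bV + V \<partial>\<^sub>b\<psi>|\<^sup>2 e\<^sup>\<psi> + \<integral>|V|\<^sup>2 \<partial>\<partial>\<^sub>b\<psi> e\<^sup>\<psi>\<close> (\<open>\<partial>\<^sub>b\<close> is the derivative in the conjugate variable).\<close>

lemma dbar_energy_identity:
  assumes \<alpha>: "\<alpha> > -1" and S: "open S" "cball 0 1 \<subseteq> S" and Q: "wirtinger2 S Q a b c"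
    and k: "wirtinger2 S k k1 k2 k12" and real: "\<And>z. z \<in> S \<Longrightarrow> cnj (k2 z) = k1 z"
      "\<And>z. z \<in> S \<Longrightarrow> k z = of_real (kr z)" "\<And>z. z \<in> S \<Longrightarrow> k12 z = of_real (kl z)"
  shows "(LINT z|bergman_measure \<alpha>. exp (kr z) * ((\<alpha> + 2) + (1 - (cmod z)\<^sup>2)\<^sup>2 * kl z) * (cmod (Q z))\<^sup>2) \<le>
    (LINT z|bergman_measure \<alpha>. exp (kr z) * (cmod (of_real (1 - (cmod z)\<^sup>2) * a z - of_real (\<alpha> + 2) * cnj z * Q z))\<^sup>2)"
proof -
  let ?M = "bergman_measure \<alpha>"
  obtain a' b' where wQ: "wirtinger S Q a b" "wirtinger S a a' c" "wirtinger S b c b'"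
    using Q by (rule wirtinger2E)
  obtain k1' k2' where wk: "wirtinger S k k1 k2" "wirtinger S k1 k1' k12" "wirtinger S k2 k12 k2'"
    using k by (rule wirtinger2E)
  define u where "u z = complex_of_real (1 - (cmod z)\<^sup>2)" for z
  have wu: "wirtinger S u (\<lambda>z. - cnj z) (\<lambda>z. - z)"
    unfolding u_def[abs_def] by (rule wirtinger_one_minus_norm)
  define X where "X z = u z * a z - of_real (\<alpha> + 2) * (cnj z * Q z)" for z
  define Y where "Y z = b z + k2 z * Q z" for z
  define E where "E z = exp (k z)" for z
  note wE = wirtinger_exp[OF wk(1), folded E_def]
  note wX = wirtinger_diff[OF wirtinger_mult[OF wu wQ(2)] wirtinger_cmult[OF wirtinger_mult[OF wirtinger_cnj[OF wirtinger_id] wQ(1)], of "of_real (\<alpha> + 2)"], folded X_def]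
  note wY = wirtinger_add[OF wQ(3) wirtinger_mult[OF wk(3) wQ(1)], folded Y_def]
  \<comment> \<open>Multiplied by (1-|z|^2)^(\<alpha>+1), the functions of \<open>wN1\<close> and
    \<open>wN2\<close> are cnj V e^\<psi> times the z-derivative of V, and cnj V e^\<psi> times the
    d-bar derivative of V plus V times that of \<psi>. The power in e^\<psi> cancels the one in cnj
    V; in terms of Q the two derivatives are \<open>X\<close> and \<open>Y\<close> up to powers of
    1-|z|^2.\<close>
  note wN1 = wirtinger_mult[OF wirtinger_mult[OF wirtinger_cnj[OF wQ(1)] wX] wE]
  note wN2 = wirtinger_mult[OF wu wirtinger_mult[OF wirtinger_mult[OF wirtinger_cnj[OF wQ(1)] wY] wE]]
  note St1 = bergman_stokes(2)[OF \<alpha> wN1 S(2), folded u_def]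
  note St2 = bergman_stokes(1)[OF \<alpha> wN2 S(2), folded u_def]
  have cu: "continuous_on S u" using wirtinger_continuous(1)[OF wu] .
  note cc = cu wirtinger_continuous[OF wQ(1)] wirtinger_continuous[OF wQ(2)] wirtinger_continuous[OF wQ(3)]
     wirtinger_continuous[OF wk(1)] wirtinger_continuous[OF wk(2)] wirtinger_continuous[OF wk(3)]
     wirtinger_continuous[OF wX] wirtinger_continuous[OF wY] wirtinger_continuous[OF wE]
     wirtinger_continuous[OF wN1] wirtinger_continuous[OF wN2]
  have int: "integrable ?M f" if "continuous_on S f" for f :: "complex \<Rightarrow> complex"
    using integrable_bergman_continuous[OF \<alpha>] continuous_on_subset[OF that S(2)] by blast
  define R where "R z = E z * (X z * cnj (X z)) - E z * (u z ^ 2 * (Y z * cnj (Y z)))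
     - E z * ((of_real (\<alpha> + 2) + u z ^ 2 * k12 z) * (Q z * cnj (Q z)))" for z
  define D1 where "D1 z = u z * (((cnj (a z)) * X z + cnj (Q z) * ((- z * a z + u z * c z) - of_real (\<alpha> + 2) * (1 * Q z + cnj z * b z))) * E z
       + cnj (Q z) * X z * (E z * k2 z)) - of_real (\<alpha> + 1) * z * (cnj (Q z) * X z * E z)" for z
  define D2 where "D2 z = u z * (- cnj z * (cnj (Q z) * Y z * E z) + u z * ((cnj (b z) * Y z + cnj (Q z) * (c z + (k12 z * Q z + k2 z * a z))) * E z
       + cnj (Q z) * Y z * (E z * k1 z))) - of_real (\<alpha> + 1) * cnj z * (u z * (cnj (Q z) * Y z * E z))" for z
  have cX: "continuous_on S X" "continuous_on S Y" "continuous_on S E" using cc by auto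
  have cD: "continuous_on S D1" "continuous_on S D2"
    unfolding D1_def D2_def by (intro continuous_intros cX cc)+
  have iD: "(LINT z|?M. D1 z) = 0" "(LINT z|?M. D2 z) = 0"
    unfolding D1_def D2_def using St1 St2 by (simp_all add: algebra_simps)
  \<comment> \<open>The mixed derivative \<open>c\<close> cancels in the difference, as do the cross
    terms. What survives of the commutator is curvature: \<open>k12\<close> from \<open>k\<close>,
    and \<alpha>+2 from -(\<alpha>+2) ln (1-|z|^2).\<close>
  have id: "D1 z - D2 z = R z" if "z \<in> S" for z
  proof -
    have u: "u z = 1 - z * cnj z" using complex_norm_square[of z] by (simp add: u_def)
    have k1: "k1 z = cnj (k2 z)" using real(1)[OF that] by simp
    show ?thesis
      unfolding D1_def D2_def R_def X_def Y_def u k1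
      by (simp add: algebra_simps power2_eq_square)
  qed
  have "(LINT z|?M. R z) = (LINT z|?M. D1 z - D2 z)"
    by (rule Bochner_Integration.integral_cong[OF refl], rule id[symmetric]) (use S(2) in auto)
  also have "\<dots> = 0" using iD int[OF cD(1)] int[OF cD(2)] by simp
  finally have R0: "(LINT z|?M. R z) = 0" .
  define f1 where "f1 z = exp (kr z) * (cmod (X z))\<^sup>2" for z
  define f2 where "f2 z = exp (kr z) * ((1 - (cmod z)\<^sup>2)\<^sup>2 * (cmod (Y z))\<^sup>2)" for z
  define f3 where "f3 z = exp (kr z) * ((\<alpha> + 2) + (1 - (cmod z)\<^sup>2)\<^sup>2 * kl z) * (cmod (Q z))\<^sup>2" for z
  have ckr: "continuous_on S kr" "continuous_on S kl"
  proof -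
    have "continuous_on S (\<lambda>z. Re (k z))" "continuous_on S (\<lambda>z. Re (k12 z))"
      by (intro continuous_intros cc)+
    then show "continuous_on S kr" "continuous_on S kl"
      by (auto elim!: continuous_on_eq simp: real)
  qed
  have cf: "continuous_on S f1" "continuous_on S f2" "continuous_on S f3"
    unfolding f1_def f2_def f3_def by (intro continuous_intros ckr cX cc)+
  have intf: "integrable ?M f" if "continuous_on S f" for f :: "complex \<Rightarrow> real"
    using integrable_bergman_continuous[OF \<alpha>] continuous_on_subset[OF that S(2)] by blast
  have Rf: "R z = of_real (f1 z - f2 z - f3 z)" if "z \<in> S" for z
    using real(2,3)[OF that] unfolding R_def f1_def f2_def f3_def complex_norm_square[symmetric] E_def u_def
    by (simp add: exp_of_real)
  have "(LINT z|?M. R z) = (LINT z|?M. of_real (f1 z - f2 z - f3 z))"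
    by (rule Bochner_Integration.integral_cong[OF refl], rule Rf) (use S(2) in auto)
  also have "\<dots> = of_real (LINT z|?M. f1 z - f2 z - f3 z)" by (rule integral_complex_of_real)
  finally have "complex_of_real (LINT z|?M. f1 z - f2 z - f3 z) = 0" using R0 by simp
  then have "(LINT z|?M. f1 z - f2 z - f3 z) = 0" by (simp only: of_real_eq_0_iff)
  then have "(LINT z|?M. f1 z) = (LINT z|?M. f2 z) + (LINT z|?M. f3 z)"
    using intf[OF cf(1)] intf[OF cf(2)] intf[OF cf(3)] by simp
  moreover have "(LINT z|?M. f2 z) \<ge> 0" by (rule integral_nonneg_AE) (simp add: f2_def)
  ultimately have "(LINT z|?M. f3 z) \<le> (LINT z|?M. f1 z)" by simp
  then show ?thesis unfolding f1_def f3_def X_def u_def by (simp add: mult.assoc)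
qed

lemma norm_diff_square_le:
  assumes "\<eta> > 0"
  shows "(cmod (x - y))\<^sup>2 \<le> (1 + 1/\<eta>) * (cmod x)\<^sup>2 + (1 + \<eta>) * (cmod y)\<^sup>2"
proof -
  have "(cmod (x - y))\<^sup>2 \<le> (cmod x + cmod y)\<^sup>2"
    by (intro power_mono norm_triangle_ineq4) auto
  moreover have "0 \<le> (cmod x / sqrt \<eta> - sqrt \<eta> * cmod y)\<^sup>2" by simp
  moreover have "(cmod x / sqrt \<eta> - sqrt \<eta> * cmod y)\<^sup>2 = (cmod x)\<^sup>2 / \<eta> + \<eta> * (cmod y)\<^sup>2 - 2 * (cmod x * cmod y)"
    using assms by (simp add: power2_diff power_mult_distrib power_divide)
  ultimately show ?thesis by (simp add: power2_sum algebra_simps)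
qed

text \<open>The potential has exponent \<alpha>+1, the energy identity \<alpha>+2. The additional
  factor 1-|z|^2 raises the curvature from \<alpha> to \<alpha>+2, and its own derivative puts the
  term cnj z Q beside R, at a cost of |z|^2 < 1. The net threshold is \<alpha>+1; half of the
  surplus \<delta> pays for the cross term and the other half is the gain.\<close>

lemma dbar_estimate:
  assumes \<alpha>: "\<alpha> > -1" and S: "open S" "cball 0 1 \<subseteq> S" and Q: "bergman_potential \<alpha> S Q R"
    and k: "wirtinger2 S k k1 k2 k12" and real: "\<And>z. z \<in> S \<Longrightarrow> cnj (k2 z) = k1 z"
      "\<And>z. z \<in> S \<Longrightarrow> k z = of_real (kr z)" "\<And>z. z \<in> S \<Longrightarrow> k12 z = of_real (kl z)"
    and \<delta>: "\<delta> > 0" "\<And>z. z \<in> ball 0 1 \<Longrightarrow> (1 - (cmod z)\<^sup>2)\<^sup>2 * kl z \<ge> \<delta> - (\<alpha> + 1)"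
  shows "\<delta> / 2 * (LINT z|bergman_measure \<alpha>. exp (kr z) * (cmod (Q z))\<^sup>2) \<le>
    (1 + 2 / \<delta>) * (LINT z|bergman_measure \<alpha>. exp (kr z) * (cmod (R z))\<^sup>2)"
proof -
  let ?M = "bergman_measure \<alpha>"
  obtain a b c where w: "wirtinger2 S Q a b c"
     and R: "\<And>z. z \<in> S \<Longrightarrow> of_real (1 - (cmod z)\<^sup>2) * a z - of_real (\<alpha> + 1) * cnj z * Q z = R z"
    using Q unfolding bergman_potential_def by blast
  have c: "continuous_on S Q" "continuous_on S a" "continuous_on S k" "continuous_on S k12"
    using w k by (auto elim!: wirtinger2E dest: wirtinger_continuous)
  have "continuous_on S (\<lambda>z. of_real (1 - (cmod z)\<^sup>2) * a z - of_real (\<alpha> + 1) * cnj z * Q z)"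
    by (intro continuous_intros c)
  then have cR: "continuous_on S R" by (rule continuous_on_eq) (use R in auto)
  have ckr: "continuous_on S kr" "continuous_on S kl"
  proof -
    have "continuous_on S (\<lambda>z. Re (k z))" "continuous_on S (\<lambda>z. Re (k12 z))"
      by (intro continuous_intros c)+
    then show "continuous_on S kr" "continuous_on S kl"
      by (auto elim!: continuous_on_eq simp: real)
  qed
  have int: "integrable ?M f" if "continuous_on S f" for f :: "complex \<Rightarrow> real"
    using integrable_bergman_continuous[OF \<alpha>] continuous_on_subset[OF that S(2)] by blast
  have iQ: "integrable ?M (\<lambda>z. exp (kr z) * (cmod (Q z))\<^sup>2)"
    and iR: "integrable ?M (\<lambda>z. exp (kr z) * (cmod (R z))\<^sup>2)"
    by (intro int continuous_intros c cR ckr)+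
  have "(1 + \<delta>) * (LINT z|?M. exp (kr z) * (cmod (Q z))\<^sup>2) = (LINT z|?M. (1 + \<delta>) * (exp (kr z) * (cmod (Q z))\<^sup>2))"
    by simp
  also have "\<dots> \<le> (LINT z|?M. exp (kr z) * ((\<alpha> + 2) + (1 - (cmod z)\<^sup>2)\<^sup>2 * kl z) * (cmod (Q z))\<^sup>2)"
  proof (rule integral_mono)
    show "integrable ?M (\<lambda>z. (1 + \<delta>) * (exp (kr z) * (cmod (Q z))\<^sup>2))" using iQ by simp
    show "integrable ?M (\<lambda>z. exp (kr z) * ((\<alpha> + 2) + (1 - (cmod z)\<^sup>2)\<^sup>2 * kl z) * (cmod (Q z))\<^sup>2)"
      by (intro int continuous_intros c ckr)
    fix z assume "z \<in> space ?M"
    then have "1 + \<delta> \<le> (\<alpha> + 2) + (1 - (cmod z)\<^sup>2)\<^sup>2 * kl z" using \<delta>(2)[of z] by simp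
    then have "(1 + \<delta>) * (exp (kr z) * (cmod (Q z))\<^sup>2) \<le> ((\<alpha> + 2) + (1 - (cmod z)\<^sup>2)\<^sup>2 * kl z) * (exp (kr z) * (cmod (Q z))\<^sup>2)"
      by (intro mult_right_mono) auto
    then show "(1 + \<delta>) * (exp (kr z) * (cmod (Q z))\<^sup>2) \<le> exp (kr z) * ((\<alpha> + 2) + (1 - (cmod z)\<^sup>2)\<^sup>2 * kl z) * (cmod (Q z))\<^sup>2"
      by (simp add: mult_ac)
  qed
  also have "\<dots> \<le> (LINT z|?M. exp (kr z) * (cmod (of_real (1 - (cmod z)\<^sup>2) * a z - of_real (\<alpha> + 2) * cnj z * Q z))\<^sup>2)"
    by (rule dbar_energy_identity[OF \<alpha> S w k real])
  also have "\<dots> \<le> (LINT z|?M. (1 + 2 / \<delta>) * (exp (kr z) * (cmod (R z))\<^sup>2) + (1 + \<delta> / 2) * (exp (kr z) * (cmod (Q z))\<^sup>2))"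
  proof (rule integral_mono)
    show "integrable ?M (\<lambda>z. exp (kr z) * (cmod (of_real (1 - (cmod z)\<^sup>2) * a z - of_real (\<alpha> + 2) * cnj z * Q z))\<^sup>2)"
      by (intro int continuous_intros c ckr)
    show "integrable ?M (\<lambda>z. (1 + 2 / \<delta>) * (exp (kr z) * (cmod (R z))\<^sup>2) + (1 + \<delta> / 2) * (exp (kr z) * (cmod (Q z))\<^sup>2))"
      using iQ iR by simp
    fix z assume "z \<in> space ?M"
    then have z: "z \<in> ball 0 1" "z \<in> S" using S(2) by auto
    have "of_real (1 - (cmod z)\<^sup>2) * a z - of_real (\<alpha> + 2) * cnj z * Q z = R z - cnj z * Q z"
      unfolding R[OF z(2), symmetric] by (simp add: algebra_simps)
    moreover have "(cmod (R z - cnj z * Q z))\<^sup>2 \<le> (1 + 1 / (\<delta> / 2)) * (cmod (R z))\<^sup>2 + (1 + \<delta> / 2) * (cmod (cnj z * Q z))\<^sup>2"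
      using \<delta> by (intro norm_diff_square_le) simp
    moreover have "(cmod (cnj z * Q z))\<^sup>2 \<le> (cmod (Q z))\<^sup>2"
      using z by (intro power_mono) (auto simp: norm_mult mult_left_le_one_le)
    then have "(1 + \<delta> / 2) * (cmod (cnj z * Q z))\<^sup>2 \<le> (1 + \<delta> / 2) * (cmod (Q z))\<^sup>2"
      using \<delta> by (intro mult_left_mono) auto
    ultimately have "(cmod (of_real (1 - (cmod z)\<^sup>2) * a z - of_real (\<alpha> + 2) * cnj z * Q z))\<^sup>2 \<le>
      (1 + 2 / \<delta>) * (cmod (R z))\<^sup>2 + (1 + \<delta> / 2) * (cmod (Q z))\<^sup>2" by simp
    then have "exp (kr z) * (cmod (of_real (1 - (cmod z)\<^sup>2) * a z - of_real (\<alpha> + 2) * cnj z * Q z))\<^sup>2 \<le>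
      exp (kr z) * ((1 + 2 / \<delta>) * (cmod (R z))\<^sup>2 + (1 + \<delta> / 2) * (cmod (Q z))\<^sup>2)"
      by (intro mult_left_mono) auto
    then show "exp (kr z) * (cmod (of_real (1 - (cmod z)\<^sup>2) * a z - of_real (\<alpha> + 2) * cnj z * Q z))\<^sup>2 \<le>
      (1 + 2 / \<delta>) * (exp (kr z) * (cmod (R z))\<^sup>2) + (1 + \<delta> / 2) * (exp (kr z) * (cmod (Q z))\<^sup>2)"
      by (simp only: distrib_left mult.left_commute)
  qed
  also have "\<dots> = (1 + 2 / \<delta>) * (LINT z|?M. exp (kr z) * (cmod (R z))\<^sup>2) + (1 + \<delta> / 2) * (LINT z|?M. exp (kr z) * (cmod (Q z))\<^sup>2)"
    using iQ iR by simp
  finally show ?thesis by (simp add: algebra_simps)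
qed

section \<open>Jet weights and cutoffs\<close>

lemma DERIV_if_le:
  fixes f g f' g' :: "real \<Rightarrow> real"
  assumes f: "\<And>x. x \<le> p \<Longrightarrow> (f has_real_derivative f' x) (at x)"
    and g: "\<And>x. x \<ge> p \<Longrightarrow> (g has_real_derivative g' x) (at x)"
    and eq: "f p = g p" "f' p = g' p"
  shows "((\<lambda>x. if x \<le> p then f x else g x) has_real_derivative (if x \<le> p then f' x else g' x)) (at x)"
proof -
  consider "x < p" | "x > p" | "x = p" by linarith
  then show ?thesis
  proof cases
    case 1
    have "((\<lambda>x. if x \<le> p then f x else g x) has_real_derivative f' x) (at x)"
      by (rule has_field_derivative_transform_within_open[of f _ _ "{..<p}"]) (use 1 f in auto)
    then show ?thesis using 1 by simp
  next
    case 2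
    have "((\<lambda>x. if x \<le> p then f x else g x) has_real_derivative g' x) (at x)"
      by (rule has_field_derivative_transform_within_open[of g _ _ "{p<..}"]) (use 2 g in auto)
    then show ?thesis using 2 by simp
  next
    case 3
    have l: "((\<lambda>x. if x \<le> p then f x else g x) has_real_derivative f' p) (at p within {..p})"
      by (rule has_field_derivative_transform_within[of f _ _ _ 1])
         (use f[of p] in \<open>auto intro: has_field_derivative_at_within\<close>)
    have r: "((\<lambda>x. if x \<le> p then f x else g x) has_real_derivative f' p) (at p within {p..})"
      by (rule has_field_derivative_transform_within[of g _ _ _ 1])
         (use g[of p] eq in \<open>auto intro: has_field_derivative_at_within\<close>)
    have "((\<lambda>x. if x \<le> p then f x else g x) has_real_derivative f' p) (at p within {..p} \<union> {p..})"
      using l r unfolding has_field_derivative_iff by (rule Lim_Un)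
    moreover have "{..p} \<union> {p..} = UNIV" by auto
    ultimately show ?thesis using 3 by simp
  qed
qed

text \<open>The formula comes from solving \<open>m + s (jet_weight a m)' s = (max 0 (m - a s / (1 - s)))\<^sup>2 / m\<close>, the square making it twice
  continuously differentiable.\<close>

definition jet_weight_inner :: "real \<Rightarrow> real \<Rightarrow> real \<Rightarrow> real" where
  "jet_weight_inner a m s = 2 * a * ln (1 - s) + a\<^sup>2 / m * (1 / (1 - s) + ln (1 - s))"

definition jet_weight :: "real \<Rightarrow> real \<Rightarrow> real \<Rightarrow> real" where
  "jet_weight a m s = (if s \<le> m / (m + a)
     then jet_weight_inner a m s - m * ln (m / (m + a)) - jet_weight_inner a m (m / (m + a))
     else - m * ln s)"

definition jet_weight' :: "real \<Rightarrow> real \<Rightarrow> real \<Rightarrow> real" where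
  "jet_weight' a m s = (if s \<le> m / (m + a)
     then - 2 * a / (1 - s) + a\<^sup>2 / m * (s / (1 - s)\<^sup>2) else - m / s)"

definition jet_weight'' :: "real \<Rightarrow> real \<Rightarrow> real \<Rightarrow> real" where
  "jet_weight'' a m s = (if s \<le> m / (m + a)
     then - 2 * a / (1 - s)\<^sup>2 + a\<^sup>2 / m * ((1 + s) / (1 - s) ^ 3) else m / s\<^sup>2)"

context
  fixes a m p :: real
  assumes a: "a > 0" and m: "m > 0" and p: "p = m / (m + a)"
begin

lemma jet_p: "0 < p" "p < 1" "1 - p = a / (m + a)"
  using a m by (auto simp: p field_simps)

text \<open>The square of m - a s/(1-s) vanishes to second order at p. Hence m + s J', for the
  weight J, and its derivative are 0 at p from the inside, as they are on the outer branch.\<close>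

lemma jet_at_p:
  "- 2 * a / (1 - p) + a\<^sup>2 / m * (p / (1 - p)\<^sup>2) = - m / p"
  "- 2 * a / (1 - p)\<^sup>2 + a\<^sup>2 / m * ((1 + p) / (1 - p) ^ 3) = m / p\<^sup>2"
proof -
  define d where "d = m + a"
  have d: "d > 0" using a m by (simp add: d_def)
  have p': "p = m / d" "1 - p = a / d" using jet_p by (simp_all add: p d_def)
  have q: "1 + p = (d + m) / d" using d by (simp add: p' field_simps)
  have "- 2 * a / (1 - p) + a\<^sup>2 / m * (p / (1 - p)\<^sup>2) = - 2 * d + d"
    unfolding p'(2) unfolding p'(1) using a m d by (simp add: field_simps power2_eq_square)
  also have "\<dots> = - m / p" unfolding p'(1) using m d by simp
  finally show "- 2 * a / (1 - p) + a\<^sup>2 / m * (p / (1 - p)\<^sup>2) = - m / p" .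
  have "- 2 * a / (1 - p)\<^sup>2 + a\<^sup>2 / m * ((1 + p) / (1 - p) ^ 3) = - 2 * d\<^sup>2 / a + d\<^sup>2 * (d + m) / (m * a)"
    unfolding p'(2) q using a m d by (simp add: field_simps power2_eq_square power3_eq_cube)
  also have "\<dots> = d\<^sup>2 * (d - m) / (m * a)" using a m by (simp add: field_simps power2_eq_square)
  also have "\<dots> = m / p\<^sup>2" unfolding p'(1) using a m d by (simp add: d_def field_simps power2_eq_square)
  finally show "- 2 * a / (1 - p)\<^sup>2 + a\<^sup>2 / m * ((1 + p) / (1 - p) ^ 3) = m / p\<^sup>2" .
qed

lemma jet_weight_deriv: "(jet_weight a m has_real_derivative jet_weight' a m s) (at s)"
  unfolding jet_weight_def[abs_def] jet_weight'_def p[symmetric]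
proof (rule DERIV_if_le)
  fix x assume "x \<le> p"
  then have x: "1 - x > 0" using jet_p by linarith
  have "- 2 * a / (1 - x) + a\<^sup>2 / m * (x / (1 - x)\<^sup>2) = 2 * a * (- 1 / (1 - x)) + a\<^sup>2 / m * (1 / (1 - x)\<^sup>2 + (- 1) / (1 - x))"
    using x m by (simp add: divide_simps power2_eq_square)
  then show "((\<lambda>s. jet_weight_inner a m s - m * ln p - jet_weight_inner a m p) has_real_derivative
      - 2 * a / (1 - x) + a\<^sup>2 / m * (x / (1 - x)\<^sup>2)) (at x)"
    unfolding jet_weight_inner_def using x m
    by (auto intro!: derivative_eq_intros simp: power2_eq_square)
next
  fix x assume "x \<ge> p"
  then have "x > 0" using jet_p by linarith
  then show "((\<lambda>s. - m * ln s) has_real_derivative - m / x) (at x)"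
    by (auto intro!: derivative_eq_intros)
qed (use jet_at_p in auto)

lemma jet_weight'_deriv: "(jet_weight' a m has_real_derivative jet_weight'' a m s) (at s)"
  unfolding jet_weight'_def[abs_def] jet_weight''_def p[symmetric]
proof (rule DERIV_if_le)
  fix x assume "x \<le> p"
  then have x: "1 - x > 0" using jet_p by linarith
  have d1: "((\<lambda>s. - 2 * a / (1 - s)) has_real_derivative - 2 * a / (1 - x)\<^sup>2) (at x)"
    using x by (auto intro!: derivative_eq_intros simp: power2_eq_square)
  have "((1 - x)\<^sup>2 + 2 * x * (1 - x)) / ((1 - x)\<^sup>2 * (1 - x)\<^sup>2) = (1 + x) / (1 - x) ^ 3"
    using x by (simp add: divide_simps power2_eq_square power3_eq_cube) (simp add: algebra_simps)
  moreover have sq: "((\<lambda>s. (1 - s)\<^sup>2) has_real_derivative - 2 * (1 - x)) (at x)"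
    by (auto intro!: derivative_eq_intros)
  have "((\<lambda>s. s / (1 - s)\<^sup>2) has_real_derivative
      ((1 - x)\<^sup>2 + 2 * x * (1 - x)) / ((1 - x)\<^sup>2 * (1 - x)\<^sup>2)) (at x)"
    by (rule DERIV_cong[OF DERIV_divide[OF DERIV_ident sq]]) (use x in \<open>auto simp: algebra_simps\<close>)
  ultimately have d2: "((\<lambda>s. s / (1 - s)\<^sup>2) has_real_derivative (1 + x) / (1 - x) ^ 3) (at x)"
    by simp
  show "((\<lambda>s. - 2 * a / (1 - s) + a\<^sup>2 / m * (s / (1 - s)\<^sup>2)) has_real_derivative
      - 2 * a / (1 - x)\<^sup>2 + a\<^sup>2 / m * ((1 + x) / (1 - x) ^ 3)) (at x)"
    by (rule DERIV_add[OF d1 DERIV_cmult[OF d2]])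
next
  fix x assume "x \<ge> p"
  then have "x > 0" using jet_p by linarith
  then show "((\<lambda>s. - m / s) has_real_derivative m / x\<^sup>2) (at x)"
    by (auto intro!: derivative_eq_intros simp: power2_eq_square)
qed (use jet_at_p in auto)

lemma jet_weight''_continuous: "continuous_on UNIV (jet_weight'' a m)"
proof -
  have "continuous_on UNIV (\<lambda>s. if s \<le> p
     then - 2 * a / (1 - s)\<^sup>2 + a\<^sup>2 / m * ((1 + s) / (1 - s) ^ 3) else m / s\<^sup>2)"
    by (rule continuous_on_cases_le[where h="\<lambda>s. s"])
       (use jet_p jet_at_p m in \<open>auto intro!: continuous_intros\<close>)
  then show ?thesis unfolding jet_weight''_def[abs_def] p .
qed

lemma jet_weight_outer: "s \<ge> p \<Longrightarrow> jet_weight a m s = - m * ln s"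
  using jet_p by (auto simp: jet_weight_def p[symmetric])

text \<open>For s = |\<phi>|^2 with \<phi> holomorphic, -m ln s is harmonic away from the zeros of
  \<phi>.\<close>

lemma jet_weight_laplacian_outer:
  "s \<ge> p \<Longrightarrow> jet_weight' a m s + s * jet_weight'' a m s = 0"
proof -
  assume s: "s \<ge> p"
  have "jet_weight' a m s = - m / s" "jet_weight'' a m s = m / s\<^sup>2"
    using s jet_at_p by (auto simp: jet_weight'_def jet_weight''_def p[symmetric])
  then show ?thesis using s jet_p by (simp add: power2_eq_square)
qed

text \<open>J' + s J'' is the derivative of s J'. For s \<le> p, differentiating m + s J' = (m - a
  s/(1-s))^2 / m gives -2a (1 - a s/(m (1-s))) / (1-s)^2, where the middle bracket is at most 1. The
  loss 2a is independent of m.\<close>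

lemma jet_weight_laplacian:
  assumes "0 \<le> s" "s < 1"
  shows "(1 - s)\<^sup>2 * (jet_weight' a m s + s * jet_weight'' a m s) \<ge> - 2 * a"
proof (cases "s \<le> p")
  case True
  define v where "v = 1 - s"
  have v: "v > 0" "s = 1 - v" using assms by (auto simp: v_def)
  have "v\<^sup>2 * (- 2 * a / v + a\<^sup>2 / m * (s / v\<^sup>2) + s * (- 2 * a / v\<^sup>2 + a\<^sup>2 / m * ((1 + s) / v ^ 3)))
    = - 2 * a + a\<^sup>2 / m * (2 * s / v)"
    using v(1) m unfolding v(2) by (simp add: divide_simps power2_eq_square power3_eq_cube) (simp add: algebra_simps)
  moreover have "a\<^sup>2 / m * (2 * s / v) \<ge> 0" using v assms m by simp
  ultimately show ?thesis using True
    by (simp add: jet_weight'_def jet_weight''_def p[symmetric] v_def)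
next
  case False
  then show ?thesis using jet_weight_laplacian_outer[of s] a by simp
qed

text \<open>The derivative of the left side times s is m + s J', a nonnegative square over m up to
  p. So the left side increases to its value 0 at p and stays there.\<close>

lemma jet_weight_le:
  assumes "0 < s"
  shows "m * ln s + jet_weight a m s \<le> 0"
proof (cases "s \<le> p")
  case True
  have "m * ln s + jet_weight a m s \<le> m * ln p + jet_weight a m p"
  proof (rule DERIV_nonneg_imp_nondecreasing[OF True])
    fix x assume x: "s \<le> x" "x \<le> p"
    then have x0: "0 < x" "x < 1" using assms jet_p by auto
    have "((\<lambda>x. m * ln x + jet_weight a m x) has_real_derivative m / x + jet_weight' a m x) (at x)"
      using x0 by (auto intro!: derivative_eq_intros jet_weight_deriv)
    moreover have "m / x + jet_weight' a m x = (m * (1 - x) - a * x)\<^sup>2 / (m * x * (1 - x)\<^sup>2)"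
      using x x0 m by (simp add: jet_weight'_def p[symmetric] divide_simps power2_eq_square) (simp add: algebra_simps)
    ultimately show "\<exists>y. ((\<lambda>x. m * ln x + jet_weight a m x) has_real_derivative y) (at x) \<and> y \<ge> 0"
      using x0 m by (intro exI[of _ "m / x + jet_weight' a m x"]) auto
  qed
  also have "\<dots> = 0" using jet_weight_outer[of p] by simp
  finally show ?thesis .
next
  case False
  then show ?thesis using jet_weight_outer[of s] by simp
qed

end

text \<open>Squares of positive parts are continuously differentiable, which is the regularity that
  a single application of Stokes' theorem asks of a cutoff.\<close>

definition cutoff :: "real \<Rightarrow> real \<Rightarrow> real \<Rightarrow> real" where
  "cutoff p r s = (max 0 (1 - (max 0 ((s - p) / (r - p)))\<^sup>2))\<^sup>2"

definition cutoff' :: "real \<Rightarrow> real \<Rightarrow> real \<Rightarrow> real" where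
  "cutoff' p r s = - 4 * max 0 (1 - (max 0 ((s - p) / (r - p)))\<^sup>2) * max 0 ((s - p) / (r - p)) / (r - p)"

lemma DERIV_max_square: "((\<lambda>x::real. (max 0 x)\<^sup>2) has_real_derivative 2 * max 0 x) (at x)"
proof -
  have "((\<lambda>x::real. if x \<le> 0 then 0 else x\<^sup>2) has_real_derivative (if x \<le> 0 then 0 else 2 * x)) (at x)"
    by (rule DERIV_if_le) (auto intro!: derivative_eq_intros)
  moreover have "(\<lambda>x::real. if x \<le> 0 then 0 else x\<^sup>2) = (\<lambda>x. (max 0 x)\<^sup>2)" by (auto simp: max_def)
  moreover have "(if x \<le> 0 then 0 else 2 * x) = 2 * max 0 x" by (auto simp: max_def)
  ultimately show ?thesis by simp
qed

lemma cutoff_deriv: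
  assumes "p < r"
  shows "(cutoff p r has_real_derivative cutoff' p r s) (at s)"
proof -
  have 1: "((\<lambda>s. (s - p) / (r - p)) has_real_derivative 1 / (r - p)) (at s)"
    using assms by (auto intro!: derivative_eq_intros)
  have 2: "((\<lambda>s. 1 - (max 0 ((s - p) / (r - p)))\<^sup>2) has_real_derivative
      0 - 2 * max 0 ((s - p) / (r - p)) * (1 / (r - p))) (at s)"
    by (rule DERIV_diff[OF DERIV_const DERIV_chain2[OF DERIV_max_square 1]])
  have "(cutoff p r has_real_derivative 2 * max 0 (1 - (max 0 ((s - p) / (r - p)))\<^sup>2) *
      (0 - 2 * max 0 ((s - p) / (r - p)) * (1 / (r - p)))) (at s)"
    unfolding cutoff_def[abs_def] by (rule DERIV_chain2[OF DERIV_max_square 2])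
  then show ?thesis by (rule DERIV_cong) (simp add: cutoff'_def)
qed

lemma cutoff'_continuous: "continuous_on UNIV (cutoff' p r)"
proof -
  define c where "c = inverse (r - p)"
  have "cutoff' p r = (\<lambda>s. - 4 * max 0 (1 - (max 0 ((s - p) * c))\<^sup>2) * max 0 ((s - p) * c) * c)"
    by (simp add: cutoff'_def[abs_def] c_def divide_inverse)
  then show ?thesis by (simp only:) (intro continuous_intros)
qed

lemma cutoff_range: "0 \<le> cutoff p r s" "cutoff p r s \<le> 1"
proof -
  show "0 \<le> cutoff p r s" by (simp add: cutoff_def)
  have "max 0 (1 - (max 0 ((s - p) / (r - p)))\<^sup>2) \<le> 1" by simp
  then have "(max 0 (1 - (max 0 ((s - p) / (r - p)))\<^sup>2))\<^sup>2 \<le> 1\<^sup>2" by (intro power_mono) auto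
  then show "cutoff p r s \<le> 1" by (simp add: cutoff_def)
qed

lemma cutoff_inner:
  assumes "p < r" "s \<le> p"
  shows "cutoff p r s = 1" "cutoff' p r s = 0"
proof -
  have "(s - p) / (r - p) \<le> 0" using assms by (simp add: divide_le_0_iff)
  then have "max 0 ((s - p) / (r - p)) = 0" by simp
  then show "cutoff p r s = 1" "cutoff' p r s = 0" by (simp_all add: cutoff_def cutoff'_def)
qed

lemma cutoff_outer:
  assumes "p < r" "s \<ge> r"
  shows "cutoff p r s = 0" "cutoff' p r s = 0"
proof -
  have "(s - p) / (r - p) \<ge> 1" using assms by simp
  then have "(max 0 ((s - p) / (r - p)))\<^sup>2 \<ge> 1" by (simp add: max_def)
  then have "max 0 (1 - (max 0 ((s - p) / (r - p)))\<^sup>2) = 0" by simp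
  then show "cutoff p r s = 0" "cutoff' p r s = 0" by (simp_all add: cutoff_def cutoff'_def)
qed

lemma cutoff'_bound:
  assumes "p < r"
  shows "\<bar>cutoff' p r s\<bar> \<le> 4 / (r - p)"
proof (cases "s \<le> p \<or> s \<ge> r")
  case True
  then have "cutoff' p r s = 0" using cutoff_inner[OF assms] cutoff_outer[OF assms] by auto
  then show ?thesis using assms by simp
next
  case False
  define t where "t = max 0 ((s - p) / (r - p))"
  have t: "0 \<le> t" "t \<le> 1" using False by (auto simp: t_def)
  have q: "0 \<le> max 0 (1 - t\<^sup>2)" "max 0 (1 - t\<^sup>2) \<le> 1" by auto
  have "max 0 (1 - t\<^sup>2) * t \<le> 1 * 1" using q t by (intro mult_mono) auto
  moreover have "0 \<le> max 0 (1 - t\<^sup>2) * t" using q t by (intro mult_nonneg_nonneg) auto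
  moreover have "\<bar>cutoff' p r s\<bar> = 4 * (max 0 (1 - t\<^sup>2) * t) / (r - p)"
    unfolding cutoff'_def t_def[symmetric] using assms calculation(2) t(1) by (simp add: abs_mult abs_divide)
  ultimately show ?thesis using assms by (simp add: divide_right_mono)
qed

section \<open>Separated jets\<close>

lemma disk_aut_eq_0_iff:
  assumes "z \<in> kernel_dom w"
  shows "disk_aut w z = 0 \<longleftrightarrow> z = w"
  using kernel_dom_nz(1)[OF assms] by (auto simp: disk_aut_def)

text \<open>Invariance of the hyperbolic metric. It turns (1-|z|^2)^2 times the Laplacian of a
  function of s = |\<open>disk_aut w z\<close>|^2 into an expression in s alone, and likewise bounds
  derivatives of cutoffs.\<close>

lemma cmod_deriv_disk_aut:
  assumes "w \<in> ball 0 1" "z \<in> kernel_dom w"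
  shows "(1 - (cmod z)\<^sup>2) * cmod (deriv (disk_aut w) z) = 1 - (cmod (disk_aut w z))\<^sup>2"
proof -
  have "deriv (disk_aut w) z = (w * cnj w - 1) / (1 - cnj w * z)\<^sup>2"
    by (rule DERIV_imp_deriv[OF disk_aut_deriv[OF assms(2)]])
  moreover have "w * cnj w - 1 = of_real ((cmod w)\<^sup>2 - 1)"
    using complex_norm_square[of w] by simp
  moreover have "(cmod w)\<^sup>2 < 1" using assms(1) by (simp add: abs_square_less_1)
  ultimately have "cmod (deriv (disk_aut w) z) = (1 - (cmod w)\<^sup>2) / (cmod (1 - cnj w * z))\<^sup>2"
    by (simp add: norm_divide norm_power del: of_real_diff)
  then show ?thesis unfolding one_minus_cmod_disk_aut[OF assms(2)] by simp
qed

lemma wirtinger2_cmod_disk_aut: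
  assumes "open S" "S \<subseteq> kernel_dom w"
  defines "\<phi> \<equiv> disk_aut w"
  shows "wirtinger2 S (\<lambda>z. of_real ((cmod (\<phi> z))\<^sup>2)) (\<lambda>z. deriv \<phi> z * cnj (\<phi> z))
    (\<lambda>z. \<phi> z * cnj (deriv \<phi> z)) (\<lambda>z. deriv \<phi> z * cnj (deriv \<phi> z))"
proof -
  have h: "\<phi> holomorphic_on S"
    unfolding \<phi>_def using holomorphic_on_subset[OF disk_aut_holomorphic assms(2)] .
  note w = wirtinger2_holomorphic[OF assms(1) h]
  show ?thesis
    unfolding complex_norm_square by (rule wirtinger2_cong[OF wirtinger2_mult[OF w wirtinger2_cnj[OF w]]]) simp_all
qed

text \<open>The lower bound on \<open>a\<close> puts the modified part of each weight strictly
  inside its disk; the upper bound keeps the curvature loss 2a below \<alpha>+1. \<open>q w\<close>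
  is a potential of \<open>g w\<close> with its conjugate pole at \<open>w\<close> cleared, so that
  it is smooth on a neighbourhood \<open>S\<close> of the closed disk.\<close>

locale separated_jets =
  fixes \<alpha> C a :: real and F :: "complex set" and m :: "complex \<Rightarrow> nat" and S :: "complex set"
    and g q :: "complex \<Rightarrow> complex \<Rightarrow> complex"
  assumes \<alpha>: "\<alpha> > -1" and C: "C < \<alpha> + 1" and a: "\<alpha> + 1 - C < a" "a < (\<alpha> + 1) / 2"
    and F: "finite F" "F \<subseteq> ball 0 1" "\<And>w. w \<in> F \<Longrightarrow> m w \<ge> 1"
    and disj: "disjoint_family_on (\<lambda>w. pseudohyp_disk w (sqrt ((real (m w) + C) / (real (m w) + \<alpha> + 1)))) F"
    and S: "open S" "cball 0 1 \<subseteq> S" "\<And>w. w \<in> F \<Longrightarrow> S \<subseteq> kernel_dom w"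
    and g: "\<And>w. w \<in> F \<Longrightarrow> g w holomorphic_on S"
    and q: "\<And>w. w \<in> F \<Longrightarrow> bergman_potential \<alpha> S (q w) (\<lambda>z. g w z * cnj (disk_aut w z ^ m w))"

context separated_jets
begin

definition jt :: "complex \<Rightarrow> complex \<Rightarrow> real" where "jt w z = (cmod (disk_aut w z))\<^sup>2"
definition jp :: "complex \<Rightarrow> real" where "jp w = real (m w) / (real (m w) + a)"
definition jr :: "complex \<Rightarrow> real" where "jr w = (real (m w) + C) / (real (m w) + \<alpha> + 1)"
definition jk :: "complex \<Rightarrow> real" where "jk z = (\<Sum>w\<in>F. jet_weight a (m w) (jt w z))"
text \<open>Let B be the product of all \<open>disk_aut v z ^ m v\<close> and U the sum of the
  singular potentials \<open>q w z / cnj (disk_aut w z ^ m w)\<close>. Then \<open>jQ\<close> is the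
  smooth version of U cnj B.\<close>

definition jQ :: "complex \<Rightarrow> complex" where
  "jQ z = (\<Sum>w\<in>F. q w z * cnj (\<Prod>v\<in>F - {w}. disk_aut v z ^ m v))"

lemma a_pos: "a > 0"
  using a C by linarith

lemma m_pos: "w \<in> F \<Longrightarrow> real (m w) > 0"
  using F(3)[of w] by simp

text \<open>1 - \<open>jr w\<close> is (\<alpha>+1-C)/(m+\<alpha>+1) and 1 - \<open>jp w\<close> is
  a/(m+a). As a < \<alpha>+1, their quotient is at most (\<alpha>+1-C)/a < 1 for every m. Hence the
  annulus between the two radii has width comparable to 1 - \<open>jp w\<close>.\<close>

lemma jp_jr:
  assumes "w \<in> F"
  shows "0 < jp w" "jp w < jr w" "jr w < 1" "1 - jr w \<le> (\<alpha> + 1 - C) / a * (1 - jp w)"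
proof -
  note m = m_pos[OF assms]
  have d: "real (m w) + \<alpha> + 1 > 0" "real (m w) + a > 0" using m \<alpha> a_pos by linarith+
  show p: "0 < jp w" using m a_pos by (simp add: jp_def)
  have r: "1 - jr w = (\<alpha> + 1 - C) / (real (m w) + \<alpha> + 1)" using d by (simp add: jr_def field_simps)
  then have "1 - jr w > 0" using d C by simp
  then show "jr w < 1" by simp
  have p1: "1 - jp w = a / (real (m w) + a)" using d by (simp add: jp_def field_simps)
  have "1 - jr w \<le> (\<alpha> + 1 - C) / (real (m w) + a)"
    unfolding r using d C a \<alpha> by (intro divide_left_mono) auto
  also have "\<dots> = (\<alpha> + 1 - C) / a * (1 - jp w)" unfolding p1 using a_pos by simp
  finally show q: "1 - jr w \<le> (\<alpha> + 1 - C) / a * (1 - jp w)" .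
  have "(\<alpha> + 1 - C) / a * (1 - jp w) < 1 * (1 - jp w)"
    using a a_pos p1 d by (intro mult_strict_right_mono) auto
  with q show "jp w < jr w" by simp
qed

lemma jt_nonneg: "jt w z \<ge> 0"
  by (simp add: jt_def)

lemma jt_less_1: "w \<in> F \<Longrightarrow> z \<in> ball 0 1 \<Longrightarrow> jt w z < 1"
  using disk_aut_in_ball[of w z] F(2) by (auto simp: jt_def abs_square_less_1)

lemma separated:
  assumes "w \<in> F" "v \<in> F" "w \<noteq> v" "z \<in> ball 0 1" "jt w z < jr w"
  shows "jr v \<le> jt v z"
proof (rule ccontr)
  assume "\<not> ?thesis"
  then have "jt v z < jr v" by simp
  have "z \<in> pseudohyp_disk u (sqrt (jr u))" if "jt u z < jr u" for u
  proof -
    have "sqrt (jt u z) < sqrt (jr u)" using that by simp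
    then show ?thesis using assms(4) by (simp add: pseudohyp_disk_def pseudohyp_dist_def jt_def)
  qed
  then have "z \<in> pseudohyp_disk w (sqrt (jr w)) \<inter> pseudohyp_disk v (sqrt (jr v))"
    using assms(5) \<open>jt v z < jr v\<close> by blast
  then show False using disj assms(1-3) unfolding disjoint_family_on_def jr_def by blast
qed

lemma separated_centers:
  assumes "w \<in> F" "v \<in> F" "w \<noteq> v"
  shows "jr w \<le> jt w v"
proof (rule separated)
  show "jt v v < jr v" using jp_jr[OF assms(2)] by (simp add: jt_def disk_aut_def)
qed (use assms F(2) in auto)

lemma jQ_potential:
  "bergman_potential \<alpha> S jQ (\<lambda>z. (\<Sum>w\<in>F. g w z) * cnj (\<Prod>w\<in>F. disk_aut w z ^ m w))"
proof -
  have "bergman_potential \<alpha> S (\<lambda>z. q w z * cnj (\<Prod>v\<in>F - {w}. disk_aut v z ^ m v))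
     (\<lambda>z. g w z * cnj (disk_aut w z ^ m w) * cnj (\<Prod>v\<in>F - {w}. disk_aut v z ^ m v))" if "w \<in> F" for w
    by (rule bergman_potential_mult_cnj[OF q[OF that] S(1)])
       (use S(3) holomorphic_on_subset[OF disk_aut_holomorphic] in \<open>auto intro!: holomorphic_intros\<close>)
  then have "bergman_potential \<alpha> S jQ
     (\<lambda>z. \<Sum>w\<in>F. g w z * cnj (disk_aut w z ^ m w) * cnj (\<Prod>v\<in>F - {w}. disk_aut v z ^ m v))"
    unfolding jQ_def by (rule bergman_potential_sum)
  then show ?thesis
  proof (rule bergman_potential_cong)
    fix z
    have "(\<Prod>v\<in>F. disk_aut v z ^ m v) = disk_aut w z ^ m w * (\<Prod>v\<in>F - {w}. disk_aut v z ^ m v)" if "w \<in> F" for w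
      using F(1) that by (rule prod.remove)
    then show "(\<Sum>w\<in>F. g w z * cnj (disk_aut w z ^ m w) * cnj (\<Prod>v\<in>F - {w}. disk_aut v z ^ m v)) =
       (\<Sum>w\<in>F. g w z) * cnj (\<Prod>w\<in>F. disk_aut w z ^ m w)"
      unfolding sum_distrib_right by (intro sum.cong refl) (simp add: mult.assoc)
  qed
qed

lemma jQ_continuous: "continuous_on S jQ"
  using jQ_potential unfolding bergman_potential_def by (auto elim!: wirtinger2E dest: wirtinger_continuous)

lemma jt_continuous: "w \<in> F \<Longrightarrow> continuous_on S (jt w)"
  unfolding jt_def[abs_def] using holomorphic_on_imp_continuous_on[OF holomorphic_on_subset[OF disk_aut_holomorphic S(3)]]
  by (auto intro!: continuous_intros)

lemma jk_continuous: "continuous_on S jk"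
  unfolding jk_def[abs_def]
proof (rule continuous_on_sum)
  fix w assume w: "w \<in> F"
  have "continuous_on UNIV (jet_weight a (m w))"
    using jet_weight_deriv[OF a_pos m_pos[OF w] refl] DERIV_isCont continuous_at_imp_continuous_on by blast
  then show "continuous_on S (\<lambda>z. jet_weight a (m w) (jt w z))"
    using continuous_on_compose2[OF _ jt_continuous[OF w]] by blast
qed

lemma jk_prod: "exp (jk z) * (cmod (\<Prod>w\<in>F. disk_aut w z ^ m w))\<^sup>2 =
    (\<Prod>w\<in>F. jt w z ^ m w * exp (jet_weight a (m w) (jt w z)))"
proof -
  have "(cmod (\<Prod>w\<in>F. disk_aut w z ^ m w))\<^sup>2 = (\<Prod>w\<in>F. jt w z ^ m w)"
    by (simp add: prod_norm[symmetric] prod_power_distrib norm_power jt_def flip: power_mult) (simp add: mult.commute)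
  then show ?thesis
    by (simp add: jk_def exp_sum[OF F(1)] prod.distrib mult.commute)
qed

lemma jet_weight_exp:
  assumes "w \<in> F" "t > 0"
  shows "t ^ m w * exp (jet_weight a (m w) t) = exp (real (m w) * ln t + jet_weight a (m w) t)"
  using assms by (simp add: exp_add exp_of_nat_mult)

lemma jk_prod_le: "exp (jk z) * (cmod (\<Prod>w\<in>F. disk_aut w z ^ m w))\<^sup>2 \<le> 1"
  unfolding jk_prod
proof (rule prod_le_1)
  fix w assume w: "w \<in> F"
  have "jt w z ^ m w * exp (jet_weight a (m w) (jt w z)) \<le> 1"
  proof (cases "jt w z = 0")
    case True
    then show ?thesis using m_pos[OF w] by (simp add: power_0_left)
  next
    case False
    then have "jt w z > 0" using jt_nonneg[of w z] by linarith
    then show ?thesis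
      using jet_weight_le[OF a_pos m_pos[OF w] refl] by (simp add: jet_weight_exp[OF w])
  qed
  then show "0 \<le> jt w z ^ m w * exp (jet_weight a (m w) (jt w z)) \<and> jt w z ^ m w * exp (jet_weight a (m w) (jt w z)) \<le> 1"
    using jt_nonneg[of w z] by simp
qed

text \<open>Where all weights are unmodified they cancel the poles exactly: there exp
  (\<open>jk z\<close>) |\<open>jQ z\<close>|^2 is |U|^2.\<close>

lemma jk_prod_eq:
  assumes "\<And>w. w \<in> F \<Longrightarrow> jp w \<le> jt w z"
  shows "exp (jk z) * (cmod (\<Prod>w\<in>F. disk_aut w z ^ m w))\<^sup>2 = 1"
  unfolding jk_prod
proof (intro prod.neutral ballI)
  fix w assume w: "w \<in> F"
  have "jt w z > 0" using assms[OF w] jp_jr(1)[OF w] by linarith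
  from jet_weight_exp[OF w this] jet_weight_outer[OF a_pos m_pos[OF w] jp_def assms[OF w]]
  show "jt w z ^ m w * exp (jet_weight a (m w) (jt w z)) = 1" by simp
qed

text \<open>Curvature is lost only inside the given disks, and since these are disjoint only one
  summand loses at a given z. The total loss is therefore 2a however many points there are. On the
  right, the density G cnj B is replaced by G because the weight times |B|^2 is at most 1.\<close>

lemma global_estimate:
  defines "\<delta> \<equiv> \<alpha> + 1 - 2 * a"
  shows "\<delta> / 2 * (LINT z|bergman_measure \<alpha>. exp (jk z) * (cmod (jQ z))\<^sup>2) \<le>
    (1 + 2 / \<delta>) * (LINT z|bergman_measure \<alpha>. (cmod (\<Sum>w\<in>F. g w z))\<^sup>2)"
proof -
  let ?M = "bergman_measure \<alpha>"
  have \<delta>: "\<delta> > 0" using a by (simp add: \<delta>_def)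
  define \<phi>' where "\<phi>' w = deriv (disk_aut w)" for w
  define j1 where "j1 w z = jet_weight' a (m w) (jt w z)" for w z
  define j2 where "j2 w z = jet_weight'' a (m w) (jt w z)" for w z
  define k1 where "k1 z = (\<Sum>w\<in>F. of_real (j1 w z) * (\<phi>' w z * cnj (disk_aut w z)))" for z
  define k2 where "k2 z = (\<Sum>w\<in>F. of_real (j1 w z) * (disk_aut w z * cnj (\<phi>' w z)))" for z
  define kl where "kl z = (\<Sum>w\<in>F. (cmod (\<phi>' w z))\<^sup>2 * (j1 w z + jt w z * j2 w z))" for z
  have k: "wirtinger2 S (\<lambda>z. \<Sum>w\<in>F. of_real (jet_weight a (m w) (jt w z))) k1 k2 (\<lambda>z. of_real (kl z))"
  proof -
    have "wirtinger2 S (\<lambda>z. of_real (jet_weight a (m w) (jt w z)))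
      (\<lambda>z. of_real (j1 w z) * (\<phi>' w z * cnj (disk_aut w z)))
      (\<lambda>z. of_real (j1 w z) * (disk_aut w z * cnj (\<phi>' w z)))
      (\<lambda>z. of_real ((cmod (\<phi>' w z))\<^sup>2 * (j1 w z + jt w z * j2 w z)))" if w: "w \<in> F" for w
      unfolding j1_def
      apply (rule wirtinger2_cong)
         apply (rule wirtinger2_real_comp[OF wirtinger2_cmod_disk_aut[OF S(1) S(3)[OF w]] _
             jet_weight_deriv[OF a_pos m_pos[OF w] refl] jet_weight'_deriv[OF a_pos m_pos[OF w] refl] jet_weight''_continuous[OF a_pos m_pos[OF w] refl]])
         apply (simp_all add: jt_def \<phi>'_def j2_def complex_norm_square algebra_simps del: of_real_power)
      done
    note sum = wirtinger2_sum[OF this, of F]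
    show ?thesis
      unfolding k1_def[abs_def] k2_def[abs_def] kl_def of_real_sum by (rule sum)
  qed
  have "\<delta> / 2 * (LINT z|?M. exp (jk z) * (cmod (jQ z))\<^sup>2) \<le>
    (1 + 2 / \<delta>) * (LINT z|?M. exp (jk z) * (cmod ((\<Sum>w\<in>F. g w z) * cnj (\<Prod>w\<in>F. disk_aut w z ^ m w)))\<^sup>2)"
  proof (rule dbar_estimate[OF \<alpha> S(1,2) jQ_potential k _ _ refl \<delta>])
    show "cnj (k2 z) = k1 z" for z unfolding k1_def k2_def by (simp add: mult_ac)
    show "(\<Sum>w\<in>F. of_real (jet_weight a (m w) (jt w z))) = complex_of_real (jk z)" for z
      by (simp add: jk_def)
    fix z :: complex assume z: "z \<in> ball 0 1"
    have trm: "(1 - (cmod z)\<^sup>2)\<^sup>2 * ((cmod (\<phi>' w z))\<^sup>2 * (j1 w z + jt w z * j2 w z)) =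
       (1 - jt w z)\<^sup>2 * (j1 w z + jt w z * j2 w z)" if w: "w \<in> F" for w
    proof -
      have "z \<in> kernel_dom w" using S z w by (meson ball_subset_cball subsetD)
      then have "(1 - (cmod z)\<^sup>2) * cmod (\<phi>' w z) = 1 - jt w z"
        using cmod_deriv_disk_aut[of w z] F(2) w by (auto simp: \<phi>'_def jt_def)
      moreover have "A\<^sup>2 * (B\<^sup>2 * K) = (A * B)\<^sup>2 * K" for A B K :: real
        by (simp only: power_mult_distrib mult.assoc)
      ultimately show ?thesis by (simp only:)
    qed
    have "(1 - (cmod z)\<^sup>2)\<^sup>2 * kl z = (\<Sum>w\<in>F. (1 - jt w z)\<^sup>2 * (j1 w z + jt w z * j2 w z))"
      unfolding kl_def sum_distrib_left using trm by (intro sum.cong) auto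
    also have "\<dots> \<ge> - 2 * a"
    proof (cases "\<exists>w\<in>F. jt w z < jr w")
      case True
      then obtain w where w: "w \<in> F" "jt w z < jr w" by blast
      have "(1 - jt v z)\<^sup>2 * (j1 v z + jt v z * j2 v z) = 0" if v: "v \<in> F - {w}" for v
      proof -
        have "jp v \<le> jt v z" using separated[OF w(1) _ _ z w(2), of v] jp_jr(2)[of v] v by force
        then show ?thesis
          using jet_weight_laplacian_outer[OF a_pos m_pos jp_def, of v] v by (simp add: j1_def j2_def)
      qed
      then have "(\<Sum>w\<in>F. (1 - jt w z)\<^sup>2 * (j1 w z + jt w z * j2 w z)) = (1 - jt w z)\<^sup>2 * (j1 w z + jt w z * j2 w z)"
        using F(1) w(1) sum.neutral[of "F - {w}" "\<lambda>v. (1 - jt v z)\<^sup>2 * (j1 v z + jt v z * j2 v z)"]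
        by (subst sum.remove[of F w]) simp_all
      also have "\<dots> \<ge> - 2 * a"
        unfolding j1_def j2_def
        using jet_weight_laplacian[OF a_pos m_pos[OF w(1)] refl jt_nonneg jt_less_1[OF w(1) z]] by simp
      finally show ?thesis .
    next
      case False
      have "(1 - jt v z)\<^sup>2 * (j1 v z + jt v z * j2 v z) = 0" if v: "v \<in> F" for v
      proof -
        have "jp v \<le> jt v z" using False v jp_jr(2)[OF v] by force
        then show ?thesis
          using jet_weight_laplacian_outer[OF a_pos m_pos jp_def, of v] v by (simp add: j1_def j2_def)
      qed
      then have "(\<Sum>w\<in>F. (1 - jt w z)\<^sup>2 * (j1 w z + jt w z * j2 w z)) = 0"
        by (intro sum.neutral) blast
      then show ?thesis using a_pos by simp
    qed
    finally show "\<delta> - (\<alpha> + 1) \<le> (1 - (cmod z)\<^sup>2)\<^sup>2 * kl z" by (simp add: \<delta>_def)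
  qed
  also have "\<dots> \<le> (1 + 2 / \<delta>) * (LINT z|?M. (cmod (\<Sum>w\<in>F. g w z))\<^sup>2)"
  proof (rule mult_left_mono)
    have c: "continuous_on S (\<lambda>z. \<Sum>w\<in>F. g w z)" "continuous_on S (\<lambda>z. \<Prod>w\<in>F. disk_aut w z ^ m w)"
      using g holomorphic_on_subset[OF disk_aut_holomorphic S(3)]
      by (auto intro!: holomorphic_on_imp_continuous_on holomorphic_intros)
    have int: "integrable ?M f" if "continuous_on S f" for f :: "complex \<Rightarrow> real"
      using integrable_bergman_continuous[OF \<alpha>] continuous_on_subset[OF that S(2)] by blast
    show "(LINT z|?M. exp (jk z) * (cmod ((\<Sum>w\<in>F. g w z) * cnj (\<Prod>w\<in>F. disk_aut w z ^ m w)))\<^sup>2) \<le>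
       (LINT z|?M. (cmod (\<Sum>w\<in>F. g w z))\<^sup>2)"
    proof (rule integral_mono)
      show "integrable ?M (\<lambda>z. exp (jk z) * (cmod ((\<Sum>w\<in>F. g w z) * cnj (\<Prod>w\<in>F. disk_aut w z ^ m w)))\<^sup>2)"
        "integrable ?M (\<lambda>z. (cmod (\<Sum>w\<in>F. g w z))\<^sup>2)"
        by (intro int continuous_intros c jk_continuous)+
      fix z
      have "exp (jk z) * (cmod ((\<Sum>w\<in>F. g w z) * cnj (\<Prod>w\<in>F. disk_aut w z ^ m w)))\<^sup>2 =
        (exp (jk z) * (cmod (\<Prod>w\<in>F. disk_aut w z ^ m w))\<^sup>2) * (cmod (\<Sum>w\<in>F. g w z))\<^sup>2"
        by (simp only: norm_mult complex_mod_cnj power_mult_distrib mult_ac)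
      also have "\<dots> \<le> 1 * (cmod (\<Sum>w\<in>F. g w z))\<^sup>2"
        by (intro mult_right_mono jk_prod_le) auto
      finally show "exp (jk z) * (cmod ((\<Sum>w\<in>F. g w z) * cnj (\<Prod>w\<in>F. disk_aut w z ^ m w)))\<^sup>2 \<le> (cmod (\<Sum>w\<in>F. g w z))\<^sup>2"
        by simp
    qed
  qed (use \<delta> in auto)
  finally show ?thesis .
qed

lemma potential_quotient:
  assumes "w \<in> F" "open T" "T \<subseteq> S" "\<And>z. z \<in> T \<Longrightarrow> disk_aut w z \<noteq> 0"
  shows "bergman_potential \<alpha> T (\<lambda>z. q w z / cnj (disk_aut w z ^ m w)) (g w)"
proof -
  have h: "(\<lambda>z. 1 / disk_aut w z ^ m w) holomorphic_on T"
    using assms S(3)[OF assms(1)] by (intro holomorphic_intros holomorphic_on_subset[OF disk_aut_holomorphic]) auto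
  have "bergman_potential \<alpha> T (\<lambda>z. q w z * cnj (1 / disk_aut w z ^ m w))
      (\<lambda>z. g w z * cnj (disk_aut w z ^ m w) * cnj (1 / disk_aut w z ^ m w))"
    by (rule bergman_potential_mult_cnj[OF bergman_potential_subset[OF q[OF assms(1)] assms(3)] assms(2) h])
  moreover have "(\<lambda>z. q w z * cnj (1 / disk_aut w z ^ m w)) = (\<lambda>z. q w z / cnj (disk_aut w z ^ m w))"
    by (simp add: divide_inverse)
  ultimately have "bergman_potential \<alpha> T (\<lambda>z. q w z / cnj (disk_aut w z ^ m w))
      (\<lambda>z. g w z * cnj (disk_aut w z ^ m w) * cnj (1 / disk_aut w z ^ m w))" by simp
  then show ?thesis by (rule bergman_potential_cong) (use assms(4) in simp)
qed

text \<open>Stokes' theorem for X u cnj h. Since cnj h is constant for the z-derivative, only u and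
  the cutoff are differentiated. \<open>T\<close> may omit poles of u; they are covered by
  \<open>Z\<close>, where the cutoff vanishes.\<close>

lemma cutoff_stokes:
  fixes u R h :: "complex \<Rightarrow> complex"
  assumes u: "bergman_potential \<alpha> T u R" and T: "open T" "open Z" "cball 0 1 \<subseteq> T \<union> Z"
    and h: "h holomorphic_on T" and \<chi>: "wirtinger (T \<union> Z) X X1 X2"
    and zero: "\<And>z. z \<in> Z \<Longrightarrow> X z = 0" "\<And>z. z \<in> Z \<Longrightarrow> X1 z = 0" "\<And>z. z \<in> Z \<Longrightarrow> X2 z = 0"
  shows "(LINT z|bergman_measure \<alpha>. X z * (R z * cnj (h z)) + of_real (1 - (cmod z)\<^sup>2) * X1 z * (u z * cnj (h z))) = 0"
    and "integrable (bergman_measure \<alpha>) (\<lambda>z. X z * (R z * cnj (h z)) + of_real (1 - (cmod z)\<^sup>2) * X1 z * (u z * cnj (h z)))"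
proof -
  let ?M = "bergman_measure \<alpha>"
  obtain a b c where w: "wirtinger2 T (\<lambda>z. u z * cnj (h z)) a b c"
     and R: "\<And>z. z \<in> T \<Longrightarrow> of_real (1 - (cmod z)\<^sup>2) * a z - of_real (\<alpha> + 1) * cnj z * (u z * cnj (h z)) = R z * cnj (h z)"
    using bergman_potential_mult_cnj[OF u T(1) h] unfolding bergman_potential_def by blast
  have "wirtinger T (\<lambda>z. u z * cnj (h z)) a b" using w by (simp add: wirtinger2_def)
  define N where "N z = X z * (u z * cnj (h z))" for z
  define N1 where "N1 z = X1 z * (u z * cnj (h z)) + X z * a z" for z
  have W: "wirtinger (T \<union> Z) N N1 (\<lambda>z. X2 z * (u z * cnj (h z)) + X z * b z)"
    unfolding N_def N1_def by (rule wirtinger_cutoff[OF \<open>wirtinger T _ a b\<close> \<chi> T(1,2)]) (simp_all add: zero)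
  define D where "D z = of_real (1 - (cmod z)\<^sup>2) * N1 z - of_real (\<alpha> + 1) * cnj z * N z" for z
  have "(LINT z|?M. D z) = 0" unfolding D_def by (rule bergman_stokes(1)[OF \<alpha> W T(3)])
  moreover have iD: "integrable ?M D"
  proof -
    have "continuous_on (T \<union> Z) D"
      unfolding D_def by (intro continuous_intros wirtinger_continuous[OF W])
    then show ?thesis using integrable_bergman_continuous[OF \<alpha>] continuous_on_subset T(3) by blast
  qed
  moreover have eq: "D z = X z * (R z * cnj (h z)) + of_real (1 - (cmod z)\<^sup>2) * X1 z * (u z * cnj (h z))"
    if "z \<in> T \<union> Z" for z
  proof (cases "z \<in> Z")
    case True
    then show ?thesis by (simp add: D_def N_def N1_def zero)
  next
    case False
    with that have "z \<in> T" by simp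
    show ?thesis unfolding R[OF \<open>z \<in> T\<close>, symmetric] by (simp add: D_def N_def N1_def algebra_simps)
  qed
  have ball: "z \<in> T \<union> Z" if "z \<in> space ?M" for z
    using that T(3) ball_subset_cball by (metis space_bergman_measure subsetD)
  have e2: "(LINT z|?M. D z) = (LINT z|?M. X z * (R z * cnj (h z)) + of_real (1 - (cmod z)\<^sup>2) * X1 z * (u z * cnj (h z)))"
    by (rule Bochner_Integration.integral_cong[OF refl], rule eq, rule ball)
  have e3: "integrable ?M D \<longleftrightarrow> integrable ?M (\<lambda>z. X z * (R z * cnj (h z)) + of_real (1 - (cmod z)\<^sup>2) * X1 z * (u z * cnj (h z)))"
    by (rule Bochner_Integration.integrable_cong[OF refl], rule eq, rule ball)
  show "(LINT z|?M. X z * (R z * cnj (h z)) + of_real (1 - (cmod z)\<^sup>2) * X1 z * (u z * cnj (h z))) = 0"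
    using e2 \<open>(LINT z|?M. D z) = 0\<close> by simp
  show "integrable ?M (\<lambda>z. X z * (R z * cnj (h z)) + of_real (1 - (cmod z)\<^sup>2) * X1 z * (u z * cnj (h z)))"
    using e3 iD by simp
qed

end

section \<open>Recovering a single jet from the sum\<close>

context separated_jets
begin

text \<open>Bound, uniform in m, for 1-|z|^2 times the z-derivative of the cutoff:
  \<open>cutoff'_bound\<close> gives 4/(r - \<open>jp w\<close>) with r halfway from
  \<open>jp w\<close> to \<open>jr w\<close>, the metric gives at most 1 - \<open>jp w\<close>, and
  \<open>jp_jr\<close> compares the two.\<close>

definition cut_bound :: real where "cut_bound = 8 / (1 - (\<alpha> + 1 - C) / a)"

definition jH :: "complex \<Rightarrow> real" where
  "jH z = 2 * (cmod (\<Sum>w\<in>F. g w z))\<^sup>2 + 2 * cut_bound\<^sup>2 * (exp (jk z) * (cmod (jQ z))\<^sup>2)"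

lemma jH_nonneg: "jH z \<ge> 0"
  by (simp add: jH_def)

lemma g_continuous: "w \<in> F \<Longrightarrow> continuous_on S (g w)"
  using g holomorphic_on_imp_continuous_on by blast

lemma integrable_S:
  fixes f :: "complex \<Rightarrow> 'b :: {banach, second_countable_topology}"
  shows "continuous_on S f \<Longrightarrow> integrable (bergman_measure \<alpha>) f"
  using integrable_bergman_continuous[OF \<alpha>] continuous_on_subset[OF _ S(2)] by blast

lemma jH_continuous: "continuous_on S jH"
  unfolding jH_def[abs_def] by (intro continuous_intros g_continuous jk_continuous jQ_continuous)

lemma ball_S: "z \<in> ball 0 1 \<Longrightarrow> z \<in> S"
  using S(2) by auto

lemma jQ_quotient:
  assumes "\<And>v. v \<in> F \<Longrightarrow> disk_aut v z \<noteq> 0"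
  shows "jQ z = (\<Sum>v\<in>F. q v z / cnj (disk_aut v z ^ m v)) * cnj (\<Prod>w\<in>F. disk_aut w z ^ m w)"
  unfolding jQ_def sum_distrib_right
proof (rule sum.cong[OF refl])
  fix v assume v: "v \<in> F"
  have "(\<Prod>w\<in>F. disk_aut w z ^ m w) = disk_aut v z ^ m v * (\<Prod>w\<in>F - {v}. disk_aut w z ^ m w)"
    using F(1) v by (rule prod.remove)
  then show "q v z * cnj (\<Prod>v\<in>F - {v}. disk_aut v z ^ m v) =
      q v z / cnj (disk_aut v z ^ m v) * cnj (\<Prod>w\<in>F. disk_aut w z ^ m w)"
    using assms[OF v] by simp
qed

text \<open>Y = X G + (1-|z|^2) \<open>X1\<close> U is built from the sums G and U alone and lives
  in the disk of \<open>w\<close>, yet its inner product with \<open>g w\<close> is the squared norm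
  of \<open>g w\<close>. This is Stokes' theorem with cutoff X for the potentials of the other jets
  and with 1 - X for the potential of \<open>g w\<close>, whose only pole is \<open>w\<close>.
  Young's inequality then absorbs half of that squared norm.\<close>

lemma local_estimate:
  assumes w: "w \<in> F"
  shows "(LINT z|bergman_measure \<alpha>. (cmod (g w z))\<^sup>2) \<le>
     (LINT z|bergman_measure \<alpha>. indicator {z. jt w z < jr w} z * jH z)"
    and "integrable (bergman_measure \<alpha>) (\<lambda>z. indicator {z. jt w z < jr w} z * jH z)"
proof -
  let ?M = "bergman_measure \<alpha>"
  note pr = jp_jr[OF w]
  \<comment> \<open>Strictly below \<open>jr w\<close>, so that all other centres lie in the open
    set \<open>Z1\<close> where the cutoff is zero.\<close>
  define r where "r = (jp w + jr w) / 2"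
  have r: "jp w < r" "r < jr w" using pr by (auto simp: r_def)
  have w1: "w \<in> ball 0 1" using F(2) w by auto
  let ?\<phi> = "disk_aut w"
  define X where "X z = complex_of_real (cutoff (jp w) r (jt w z))" for z
  define X1 where "X1 z = of_real (cutoff' (jp w) r (jt w z)) * (deriv ?\<phi> z * cnj (?\<phi> z))" for z
  define X2 where "X2 z = of_real (cutoff' (jp w) r (jt w z)) * (?\<phi> z * cnj (deriv ?\<phi> z))" for z
  have wt: "wirtinger S (\<lambda>z. of_real (jt w z)) (\<lambda>z. deriv ?\<phi> z * cnj (?\<phi> z)) (\<lambda>z. ?\<phi> z * cnj (deriv ?\<phi> z))"
    using wirtinger2_cmod_disk_aut[OF S(1) S(3)[OF w]] by (simp add: wirtinger2_def jt_def)
  have wX: "wirtinger S X X1 X2"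
    unfolding X_def[abs_def] X1_def[abs_def] X2_def[abs_def]
    by (rule wirtinger_real_comp[OF wt refl cutoff_deriv[OF r(1)] cutoff'_continuous])
  have wX': "wirtinger S (\<lambda>z. 1 - X z) (\<lambda>z. - X1 z) (\<lambda>z. - X2 z)"
    using wirtinger_diff[OF wirtinger_const wX, of 1] by simp
  have cph: "continuous_on S (disk_aut v)" if "v \<in> F" for v
    using holomorphic_on_imp_continuous_on[OF holomorphic_on_subset[OF disk_aut_holomorphic S(3)[OF that]]] .
  note ct = jt_continuous[OF w]

  define P where "P z = (\<Prod>v\<in>F - {w}. disk_aut v z)" for z
  define T1 where "T1 = S \<inter> P -` (- {0})"
  define Z1 where "Z1 = S \<inter> jt w -` {r<..}"
  define T2 where "T2 = S \<inter> ?\<phi> -` (- {0})"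
  define Z2 where "Z2 = S \<inter> jt w -` {..<jp w}"
  have cP: "continuous_on S P" unfolding P_def[abs_def] by (intro continuous_intros cph) auto
  have op: "open T1" "open Z1" "open T2" "open Z2"
    unfolding T1_def T2_def Z1_def Z2_def
    by (rule continuous_open_preimage[OF cP S(1)] continuous_open_preimage[OF ct S(1)]
          continuous_open_preimage[OF cph[OF w] S(1)]; simp add: open_Compl)+
  have sub: "T1 \<subseteq> S" "Z1 \<subseteq> S" "T2 \<subseteq> S" "Z2 \<subseteq> S"
    by (auto simp: T1_def T2_def Z1_def Z2_def)
  have cov1: "cball 0 1 \<subseteq> T1 \<union> Z1"
  proof
    fix z :: complex assume z: "z \<in> cball 0 1"
    then have zS: "z \<in> S" using S(2) by auto
    show "z \<in> T1 \<union> Z1"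
    proof (cases "P z = 0")
      case True
      then obtain v where v: "v \<in> F" "v \<noteq> w" "disk_aut v z = 0"
        using F(1) by (auto simp: P_def)
      then have "z = v" using disk_aut_eq_0_iff zS S(3)[OF v(1)] by blast
      then have "jt w z \<ge> jr w" using separated_centers[OF w v(1)] v(2) by simp
      then show ?thesis using r zS by (simp add: Z1_def)
    qed (simp add: T1_def zS)
  qed
  have cov2: "cball 0 1 \<subseteq> T2 \<union> Z2"
  proof
    fix z :: complex assume z: "z \<in> cball 0 1"
    then have zS: "z \<in> S" using S(2) by auto
    then show "z \<in> T2 \<union> Z2" using pr by (cases "?\<phi> z = 0") (auto simp: T2_def Z2_def jt_def)
  qed
  define u where "u v z = q v z / cnj (disk_aut v z ^ m v)" for v z
  have pot1: "bergman_potential \<alpha> T1 (\<lambda>z. \<Sum>v\<in>F - {w}. u v z) (\<lambda>z. \<Sum>v\<in>F - {w}. g v z)"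
    unfolding u_def
  proof (rule bergman_potential_sum)
    fix v assume v: "v \<in> F - {w}"
    have "disk_aut v z \<noteq> 0" if "z \<in> T1" for z
      using that v F(1) by (auto simp: T1_def P_def)
    then show "bergman_potential \<alpha> T1 (\<lambda>z. q v z / cnj (disk_aut v z ^ m v)) (g v)"
      using potential_quotient[OF _ op(1) sub(1)] v by blast
  qed
  have pot2: "bergman_potential \<alpha> T2 (u w) (g w)"
    unfolding u_def[abs_def] by (rule potential_quotient[OF w op(3) sub(3)]) (auto simp: T2_def)
  have Z1: "X z = 0" "X1 z = 0" "X2 z = 0" if "z \<in> Z1" for z
    using that cutoff_outer[OF r(1), of "jt w z"] by (auto simp: Z1_def X_def X1_def X2_def)
  have Z2: "1 - X z = 0" "- X1 z = 0" "- X2 z = 0" if "z \<in> Z2" for z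
    using that cutoff_inner[OF r(1), of "jt w z"] by (auto simp: Z2_def X_def X1_def X2_def)
  note I1 = cutoff_stokes[OF pot1 op(1,2) cov1 holomorphic_on_subset[OF g[OF w] sub(1)]
      wirtinger_subset[OF wX Un_least[OF sub(1,2)]] Z1]
  note I2 = cutoff_stokes[OF pot2 op(3,4) cov2 holomorphic_on_subset[OF g[OF w] sub(3)]
      wirtinger_subset[OF wX' Un_least[OF sub(3,4)]] Z2]
  define f1 where "f1 z = X z * ((\<Sum>v\<in>F - {w}. g v z) * cnj (g w z)) + of_real (1 - (cmod z)\<^sup>2) * X1 z * ((\<Sum>v\<in>F - {w}. u v z) * cnj (g w z))" for z
  define f2 where "f2 z = (1 - X z) * (g w z * cnj (g w z)) + of_real (1 - (cmod z)\<^sup>2) * (- X1 z) * (u w z * cnj (g w z))" for z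
  have f1: "(LINT z|?M. f1 z) = 0" "integrable ?M f1" unfolding f1_def[abs_def] by (rule I1; assumption)+
  have f2: "(LINT z|?M. f2 z) = 0" "integrable ?M f2" unfolding f2_def[abs_def] by (rule I2; assumption)+
  define Y where "Y z = X z * (\<Sum>v\<in>F. g v z) + of_real (1 - (cmod z)\<^sup>2) * X1 z * (\<Sum>v\<in>F. u v z)" for z
  \<comment> \<open>The cutoff derivative enters \<open>f1\<close> and \<open>f2\<close> with
    opposite signs, so in \<open>f1 - f2\<close> the single potentials combine into the full sum,
    which \<open>jQ\<close> controls.\<close>
  have Yf: "Y z * cnj (g w z) = f1 z - f2 z + of_real ((cmod (g w z))\<^sup>2)" for z
  proof -
    have "(\<Sum>v\<in>F. g v z) = g w z + (\<Sum>v\<in>F - {w}. g v z)" "(\<Sum>v\<in>F. u v z) = u w z + (\<Sum>v\<in>F - {w}. u v z)"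
      using F(1) w by (simp_all add: sum.remove)
    then show ?thesis unfolding Y_def f1_def f2_def complex_norm_square by (simp add: algebra_simps)
  qed
  have ig: "integrable ?M (\<lambda>z. (cmod (g w z))\<^sup>2)"
    by (intro integrable_S continuous_intros g_continuous w)
  have igc: "integrable ?M (\<lambda>z. complex_of_real ((cmod (g w z))\<^sup>2))"
    by (intro integrable_S continuous_intros g_continuous w)
  have iY: "integrable ?M (\<lambda>z. Y z * cnj (g w z))" unfolding Yf using f1 f2 igc by simp
  have "(LINT z|?M. Y z * cnj (g w z)) = (LINT z|?M. complex_of_real ((cmod (g w z))\<^sup>2))"
    unfolding Yf using f1 f2 igc by simp
  also have "\<dots> = of_real (LINT z|?M. (cmod (g w z))\<^sup>2)" by (rule integral_complex_of_real)
  finally have eq: "(LINT z|?M. Y z * cnj (g w z)) = of_real (LINT z|?M. (cmod (g w z))\<^sup>2)" .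

  let ?ind = "\<lambda>z. indicator {z. jt w z < jr w} z :: real"
  have iH: "integrable ?M (\<lambda>z. ?ind z * jH z)"
  proof (rule Bochner_Integration.integrable_bound)
    show "integrable ?M jH" by (rule integrable_S[OF jH_continuous])
    have "jt w \<in> borel_measurable ?M"
      by (rule continuous_on_borel_measurable_bergman, rule continuous_on_subset[OF ct]) (use ball_S in auto)
    then have "{z \<in> space ?M. jt w z < jr w} \<in> sets ?M" by measurable
    then have "(\<lambda>z. indicator {z \<in> space ?M. jt w z < jr w} z * jH z) \<in> borel_measurable ?M"
      using integrable_S[OF jH_continuous] by (intro borel_measurable_times borel_measurable_indicator) auto
    then show "(\<lambda>z. ?ind z * jH z) \<in> borel_measurable ?M"
      by (rule measurable_cong[THEN iffD1, rotated]) (auto split: split_indicator)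
    show "AE z in ?M. norm (?ind z * jH z) \<le> norm (jH z)"
      by (intro AE_I2) (auto split: split_indicator)
  qed
  then show "integrable ?M (\<lambda>z. ?ind z * jH z)" .

  have bound: "(cmod (Y z))\<^sup>2 \<le> ?ind z * jH z" if z: "z \<in> ball 0 1" for z
  proof (cases "jt w z < jr w")
    case False
    then have "jt w z \<ge> r" using r by simp
    then have "Y z = 0" using cutoff_outer[OF r(1), of "jt w z"] by (simp add: Y_def X_def X1_def)
    then show ?thesis using jH_nonneg[of z] by simp
  next
    case True
    have "(cmod (X z * (\<Sum>v\<in>F. g v z)))\<^sup>2 \<le> (cmod (\<Sum>v\<in>F. g v z))\<^sup>2"
    proof (intro power_mono)
      have "cmod (X z) \<le> 1" using cutoff_range[of "jp w" r "jt w z"] by (simp add: X_def)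
      then show "cmod (X z * (\<Sum>v\<in>F. g v z)) \<le> cmod (\<Sum>v\<in>F. g v z)"
        by (simp add: norm_mult mult_left_le_one_le)
    qed simp
    moreover have "(cmod (of_real (1 - (cmod z)\<^sup>2) * X1 z * (\<Sum>v\<in>F. u v z)))\<^sup>2 \<le> cut_bound\<^sup>2 * (exp (jk z) * (cmod (jQ z))\<^sup>2)"
    proof (cases "jt w z \<le> jp w")
      case True
      then show ?thesis using cutoff_inner[OF r(1), of "jt w z"] by (simp add: X1_def)
    next
      case t: False
      have s: "1 - (cmod z)\<^sup>2 \<ge> 0" using z by (simp add: abs_square_le_1 less_imp_le)
      have t1: "jt w z < 1" using jt_less_1[OF w z] .
      have "(1 - (cmod z)\<^sup>2) * cmod (deriv ?\<phi> z) = 1 - jt w z"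
        using cmod_deriv_disk_aut[OF w1] S(3)[OF w] ball_S[OF z] by (auto simp: jt_def)
      moreover have "cmod (of_real (1 - (cmod z)\<^sup>2) * X1 z) =
          \<bar>cutoff' (jp w) r (jt w z)\<bar> * (((1 - (cmod z)\<^sup>2) * cmod (deriv ?\<phi> z)) * cmod (?\<phi> z))"
        using s by (simp add: X1_def norm_mult del: of_real_diff)
      ultimately have "cmod (of_real (1 - (cmod z)\<^sup>2) * X1 z) =
          \<bar>cutoff' (jp w) r (jt w z)\<bar> * ((1 - jt w z) * cmod (?\<phi> z))" by simp
      also have "\<dots> \<le> 4 / (r - jp w) * ((1 - jp w) * 1)"
        using t t1 disk_aut_in_ball[OF w1 z] pr r
        by (intro mult_mono cutoff'_bound[OF r(1)]) auto
      also have "\<dots> \<le> cut_bound"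
      proof -
        define k where "k = (\<alpha> + 1 - C) / a"
        have k: "k < 1" using a a_pos by (simp add: k_def)
        have "1 - jr w \<le> k * (1 - jp w)" using pr(4) unfolding k_def .
        then have "(1 - jp w) * (1 - k) \<le> jr w - jp w" by (simp add: algebra_simps)
        moreover have "r - jp w = (jr w - jp w) / 2" by (simp add: r_def field_simps)
        ultimately show ?thesis using k r pr unfolding cut_bound_def k_def[symmetric]
          by (simp add: field_simps)
      qed
      finally have cb: "cmod (of_real (1 - (cmod z)\<^sup>2) * X1 z) \<le> cut_bound" .
      \<comment> \<open>On the annulus where the cutoff varies, z is outside the modified zone of
        every point: of \<open>w\<close> because \<open>jt w z\<close> exceeds \<open>jp w\<close>,
        of the others by disjointness. Hence the weighted \<open>jQ\<close> has the size of U
        there.\<close>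
      have jpv: "jp v \<le> jt v z" if "v \<in> F" for v
        using separated[OF w that _ z \<open>jt w z < jr w\<close>] jp_jr(2)[OF that] t by (cases "v = w") force+
      have nz: "disk_aut v z \<noteq> 0" if "v \<in> F" for v
        using jpv[OF that] jp_jr(1)[OF that] by (auto simp: jt_def)
      have jq: "jQ z = (\<Sum>v\<in>F. u v z) * cnj (\<Prod>w\<in>F. disk_aut w z ^ m w)"
        unfolding u_def by (rule jQ_quotient) (rule nz)
      have "(cmod (\<Sum>v\<in>F. u v z))\<^sup>2 = (exp (jk z) * (cmod (\<Prod>w\<in>F. disk_aut w z ^ m w))\<^sup>2) * (cmod (\<Sum>v\<in>F. u v z))\<^sup>2"
        using jk_prod_eq[OF jpv] by simp
      also have "\<dots> = exp (jk z) * (cmod (jQ z))\<^sup>2"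
        unfolding jq by (simp only: norm_mult complex_mod_cnj power_mult_distrib mult_ac)
      finally have "(cmod (\<Sum>v\<in>F. u v z))\<^sup>2 = exp (jk z) * (cmod (jQ z))\<^sup>2" .
      moreover have "(cmod (of_real (1 - (cmod z)\<^sup>2) * X1 z))\<^sup>2 \<le> cut_bound\<^sup>2"
        using cb by (intro power_mono) auto
      ultimately show ?thesis
        unfolding norm_mult[of "of_real (1 - (cmod z)\<^sup>2) * X1 z"] power_mult_distrib
        by (metis mult_right_mono zero_le_power2)
    qed
    moreover have "(cmod (Y z))\<^sup>2 \<le> 2 * (cmod (X z * (\<Sum>v\<in>F. g v z)))\<^sup>2 + 2 * (cmod (of_real (1 - (cmod z)\<^sup>2) * X1 z * (\<Sum>v\<in>F. u v z)))\<^sup>2"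
      unfolding Y_def by (rule norm_add_square_le)
    ultimately have "(cmod (Y z))\<^sup>2 \<le> jH z" unfolding jH_def mult.assoc by linarith
    then show ?thesis using True by simp
  qed
  have "(LINT z|?M. (cmod (g w z))\<^sup>2) = cmod (LINT z|?M. Y z * cnj (g w z))"
    unfolding eq by (simp add: integral_nonneg_AE)
  also have "\<dots> \<le> (LINT z|?M. cmod (Y z * cnj (g w z)))" by (rule integral_norm_bound)
  also have "\<dots> \<le> (LINT z|?M. (?ind z * jH z + (cmod (g w z))\<^sup>2) / 2)"
  proof (rule integral_mono)
    show "integrable ?M (\<lambda>z. cmod (Y z * cnj (g w z)))" using iY by (rule integrable_norm)
    show "integrable ?M (\<lambda>z. (?ind z * jH z + (cmod (g w z))\<^sup>2) / 2)" using iH ig by simp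
    fix z assume "z \<in> space ?M"
    then have "(cmod (Y z))\<^sup>2 \<le> ?ind z * jH z" using bound by simp
    moreover have "0 \<le> (cmod (Y z) - cmod (g w z))\<^sup>2" by simp
    then have "2 * (cmod (Y z) * cmod (g w z)) \<le> (cmod (Y z))\<^sup>2 + (cmod (g w z))\<^sup>2" by (simp add: power2_diff)
    ultimately show "cmod (Y z * cnj (g w z)) \<le> (?ind z * jH z + (cmod (g w z))\<^sup>2) / 2"
      by (simp add: norm_mult)
  qed
  also have "\<dots> = ((LINT z|?M. ?ind z * jH z) + (LINT z|?M. (cmod (g w z))\<^sup>2)) / 2" using iH ig by simp
  finally show "(LINT z|?M. (cmod (g w z))\<^sup>2) \<le> (LINT z|?M. ?ind z * jH z)" by simp
qed

text \<open>The disks are disjoint, so the local bounds add up to at most one integral of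
  \<open>jH\<close>, which \<open>global_estimate\<close> bounds by the norm of G.\<close>

lemma finite_lower_bound:
  defines "\<delta> \<equiv> \<alpha> + 1 - 2 * a"
  shows "(\<Sum>w\<in>F. LINT z|bergman_measure \<alpha>. (cmod (g w z))\<^sup>2) \<le>
     (2 + 2 * cut_bound\<^sup>2 * (2 / \<delta> * (1 + 2 / \<delta>))) * (LINT z|bergman_measure \<alpha>. (cmod (\<Sum>w\<in>F. g w z))\<^sup>2)"
proof -
  let ?M = "bergman_measure \<alpha>"
  let ?ind = "\<lambda>w z. indicator {z. jt w z < jr w} z :: real"
  have \<delta>: "\<delta> > 0" using a by (simp add: \<delta>_def)
  have "(\<Sum>w\<in>F. LINT z|?M. (cmod (g w z))\<^sup>2) \<le> (\<Sum>w\<in>F. LINT z|?M. ?ind w z * jH z)"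
    by (intro sum_mono local_estimate)
  also have "\<dots> = (LINT z|?M. (\<Sum>w\<in>F. ?ind w z * jH z))"
    using local_estimate(2) by (simp add: Bochner_Integration.integral_sum)
  also have "\<dots> \<le> (LINT z|?M. jH z)"
  proof (rule integral_mono)
    show "integrable ?M (\<lambda>z. \<Sum>w\<in>F. ?ind w z * jH z)" using local_estimate(2) by simp
    show "integrable ?M jH" by (rule integrable_S[OF jH_continuous])
    fix z assume "z \<in> space ?M"
    then have z: "z \<in> ball 0 1" by simp
    show "(\<Sum>w\<in>F. ?ind w z * jH z) \<le> jH z"
    proof (cases "\<exists>w\<in>F. jt w z < jr w")
      case True
      then obtain w where w: "w \<in> F" "jt w z < jr w" by blast
      have "?ind v z * jH z = 0" if v: "v \<in> F - {w}" for v
        using separated[OF w(1) _ _ z w(2), of v] v by auto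
      then have "(\<Sum>w\<in>F. ?ind w z * jH z) = ?ind w z * jH z"
        using F(1) w(1) sum.neutral[of "F - {w}" "\<lambda>v. ?ind v z * jH z"] by (subst sum.remove[of F w]) simp_all
      then show ?thesis using w(2) by simp
    next
      case False
      then have "(\<Sum>w\<in>F. ?ind w z * jH z) = 0" by (intro sum.neutral) auto
      then show ?thesis using jH_nonneg by simp
    qed
  qed
  also have "\<dots> = 2 * (LINT z|?M. (cmod (\<Sum>w\<in>F. g w z))\<^sup>2) + 2 * cut_bound\<^sup>2 * (LINT z|?M. exp (jk z) * (cmod (jQ z))\<^sup>2)"
  proof -
    have "integrable ?M (\<lambda>z. (cmod (\<Sum>w\<in>F. g w z))\<^sup>2)" "integrable ?M (\<lambda>z. exp (jk z) * (cmod (jQ z))\<^sup>2)"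
      by (intro integrable_S continuous_intros g_continuous jk_continuous jQ_continuous; assumption)+
    then show ?thesis unfolding jH_def by simp
  qed
  also have "\<dots> \<le> 2 * (LINT z|?M. (cmod (\<Sum>w\<in>F. g w z))\<^sup>2) +
      2 * cut_bound\<^sup>2 * ((2 / \<delta> * (1 + 2 / \<delta>)) * (LINT z|?M. (cmod (\<Sum>w\<in>F. g w z))\<^sup>2))"
  proof (intro add_left_mono mult_left_mono)
    have "2 / \<delta> * (\<delta> / 2 * (LINT z|?M. exp (jk z) * (cmod (jQ z))\<^sup>2)) \<le>
       2 / \<delta> * ((1 + 2 / \<delta>) * (LINT z|?M. (cmod (\<Sum>w\<in>F. g w z))\<^sup>2))"
      using \<delta> global_estimate unfolding \<delta>_def by (intro mult_left_mono) auto
    moreover have "2 / \<delta> * (\<delta> / 2 * I) = I" for I using \<delta> by simp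
    ultimately show "(LINT z|?M. exp (jk z) * (cmod (jQ z))\<^sup>2) \<le> (2 / \<delta> * (1 + 2 / \<delta>)) * (LINT z|?M. (cmod (\<Sum>w\<in>F. g w z))\<^sup>2)"
      by (simp only: mult.assoc)
  qed auto
  finally show ?thesis by (simp add: algebra_simps)
qed

end

section \<open>From lower bounds to interpolation\<close>

lemma ker_basis_lower_bound:
  assumes \<alpha>: "\<alpha> > -1" and C: "(\<alpha> + 1) / 2 < C" "C < \<alpha> + 1" and div: "divisor \<Lambda> m"
    and disj: "disjoint_family_on (\<lambda>w. pseudohyp_disk w (sqrt ((real (m w) + C) / (real (m w) + \<alpha> + 1)))) \<Lambda>"
  shows "\<exists>M>0. \<forall>F c. finite F \<longrightarrow> F \<subseteq> \<Lambda> \<longrightarrow>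
    (\<Sum>w\<in>F. ker_norm \<alpha> w * (\<Sum>j<m w. (cmod (c w j))\<^sup>2)) \<le>
    M * (LINT z|bergman_measure \<alpha>. (cmod (\<Sum>w\<in>F. \<Sum>j<m w. c w j * ker_basis \<alpha> w j z))\<^sup>2)"
proof -
  \<comment> \<open>The midpoint of the interval from \<alpha>+1-C to (\<alpha>+1)/2, which is
    nonempty because C > (\<alpha>+1)/2.\<close>
  define a where "a = ((\<alpha> + 1 - C) + (\<alpha> + 1) / 2) / 2"
  have a: "\<alpha> + 1 - C < a" "a < (\<alpha> + 1) / 2" using C by (simp_all add: a_def field_simps)
  define K where "K = 2 + 2 * (8 / (1 - (\<alpha> + 1 - C) / a))\<^sup>2 * (2 / (\<alpha> + 1 - 2 * a) * (1 + 2 / (\<alpha> + 1 - 2 * a)))"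
  have "K > 0"
    unfolding K_def using a by (intro add_pos_nonneg mult_nonneg_nonneg) auto
  moreover have "(\<Sum>w\<in>F. ker_norm \<alpha> w * (\<Sum>j<m w. (cmod (c w j))\<^sup>2)) \<le>
    K * (LINT z|bergman_measure \<alpha>. (cmod (\<Sum>w\<in>F. \<Sum>j<m w. c w j * ker_basis \<alpha> w j z))\<^sup>2)"
    if F: "finite F" "F \<subseteq> \<Lambda>" for F c
  proof -
    define S where "S = (\<Inter>w\<in>F. kernel_dom w)"
    have Fb: "F \<subseteq> ball 0 1" "\<And>w. w \<in> F \<Longrightarrow> m w \<ge> 1"
      using F div by (auto simp: divisor_def)
    have S: "open S" "cball 0 1 \<subseteq> S" "\<And>w. w \<in> F \<Longrightarrow> S \<subseteq> kernel_dom w"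
      unfolding S_def
    proof -
      show "open (\<Inter>w\<in>F. kernel_dom w)" using F(1) open_kernel_dom by (intro open_INT) auto
      show "cball 0 1 \<subseteq> (\<Inter>w\<in>F. kernel_dom w)"
        by (intro INT_greatest cball_subset_kernel_dom) (use Fb(1) in auto)
    qed auto
    define g where "g w z = (\<Sum>j<m w. c w j * ker_basis \<alpha> w j z)" for w z
    have "\<exists>q. bergman_potential \<alpha> S q (\<lambda>z. g w z * cnj (disk_aut w z ^ m w))" if w: "w \<in> F" for w
    proof -
      have "\<forall>j\<in>{..<m w}. \<exists>q. bergman_potential \<alpha> S q (\<lambda>z. bergman_ker \<alpha> w z * disk_aut w z ^ j * cnj (disk_aut w z) ^ m w)"
        using bergman_potential_exists[OF S(3)[OF w] S(1) \<alpha>] by blast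
      then obtain q where q: "\<And>j. j < m w \<Longrightarrow> bergman_potential \<alpha> S (q j) (\<lambda>z. bergman_ker \<alpha> w z * disk_aut w z ^ j * cnj (disk_aut w z) ^ m w)"
        by (metis lessThan_iff)
      have "bergman_potential \<alpha> S (\<lambda>z. \<Sum>j<m w. (c w j * of_real (sqrt (bcoef \<alpha> j))) * q j z)
         (\<lambda>z. \<Sum>j<m w. (c w j * of_real (sqrt (bcoef \<alpha> j))) * (bergman_ker \<alpha> w z * disk_aut w z ^ j * cnj (disk_aut w z) ^ m w))"
        by (intro bergman_potential_sum bergman_potential_cmult q S(1)) auto
      then have "bergman_potential \<alpha> S (\<lambda>z. \<Sum>j<m w. (c w j * of_real (sqrt (bcoef \<alpha> j))) * q j z)
         (\<lambda>z. g w z * cnj (disk_aut w z ^ m w))"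
        by (rule bergman_potential_cong) (simp add: g_def ker_basis_def sum_distrib_left sum_distrib_right mult_ac)
      then show ?thesis by blast
    qed
    then obtain q where q: "\<And>w. w \<in> F \<Longrightarrow> bergman_potential \<alpha> S (q w) (\<lambda>z. g w z * cnj (disk_aut w z ^ m w))"
      by metis
    have gh: "g w holomorphic_on S" if "w \<in> F" for w
      unfolding g_def using holomorphic_on_subset[OF ker_basis_holomorphic S(3)[OF that]]
      by (intro holomorphic_intros) auto
    have dF: "disjoint_family_on (\<lambda>w. pseudohyp_disk w (sqrt ((real (m w) + C) / (real (m w) + \<alpha> + 1)))) F"
      using disjoint_family_on_mono[OF F(2) disj] .
    interpret J: separated_jets \<alpha> C a F m S g q
      by unfold_locales (use \<alpha> C a F Fb dF S gh q in auto)
    have "(\<Sum>w\<in>F. LINT z|bergman_measure \<alpha>. (cmod (g w z))\<^sup>2) \<le>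
      K * (LINT z|bergman_measure \<alpha>. (cmod (\<Sum>w\<in>F. g w z))\<^sup>2)"
      using J.finite_lower_bound unfolding J.cut_bound_def K_def .
    moreover have "(LINT z|bergman_measure \<alpha>. (cmod (g w z))\<^sup>2) = ker_norm \<alpha> w * (\<Sum>j<m w. (cmod (c w j))\<^sup>2)"
      if "w \<in> F" for w
      unfolding g_def by (rule ker_basis_sum_norm[OF \<alpha>]) (use Fb that in auto)
    ultimately show ?thesis by (simp add: g_def)
  qed
  ultimately show ?thesis by blast
qed

text \<open>Elimination on the index set: \<open>D\<close> is the Schur complement left at
  \<open>a\<close>, and if it were 0, the vector that is 1 at \<open>a\<close> and -q on
  \<open>I\<close> would contradict nondegeneracy. The assumption quantifies over all subsets so
  that the induction inherits it.\<close>

lemma nondegenerate_imp_solvable: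
  fixes A :: "'i \<Rightarrow> 'i \<Rightarrow> 'k :: field"
  assumes "finite I" and "\<forall>J c. J \<subseteq> I \<longrightarrow> (\<forall>i\<in>J. (\<Sum>k\<in>J. c k * A k i) = 0) \<longrightarrow> (\<forall>i\<in>J. c i = 0)"
  shows "\<exists>c. \<forall>i\<in>I. (\<Sum>k\<in>I. c k * A k i) = v i"
  using assms
proof (induction I arbitrary: v rule: finite_induct)
  case (insert a I)
  have sub: "\<forall>J c. J \<subseteq> I \<longrightarrow> (\<forall>i\<in>J. (\<Sum>k\<in>J. c k * A k i) = 0) \<longrightarrow> (\<forall>i\<in>J. c i = 0)"
    using insert.prems by (meson subset_insertI2)
  obtain q where q: "\<And>i. i \<in> I \<Longrightarrow> (\<Sum>k\<in>I. q k * A k i) = A a i"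
    using insert.IH[OF sub, of "A a"] by blast
  obtain f where f: "\<And>i. i \<in> I \<Longrightarrow> (\<Sum>k\<in>I. f k * A k i) = v i"
    using insert.IH[OF sub, of v] by blast
  define D where "D = A a a - (\<Sum>k\<in>I. q k * A k a)"
  have sums: "(\<Sum>k\<in>insert a I. (if k = a then t else h k) * A k i) = t * A a i + (\<Sum>k\<in>I. h k * A k i)" for t h i
  proof -
    have "(\<Sum>k\<in>I. (if k = a then t else h k) * A k i) = (\<Sum>k\<in>I. h k * A k i)"
      using insert.hyps by (intro sum.cong) auto
    then show ?thesis using insert.hyps by simp
  qed
  have "D \<noteq> 0"
  proof
    assume D: "D = 0"
    have "\<forall>i\<in>insert a I. (\<Sum>k\<in>insert a I. (if k = a then 1 else - q k) * A k i) = 0"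
      unfolding sums using D q by (auto simp: D_def sum_negf)
    then have "\<forall>i\<in>insert a I. (if i = a then 1 else - q i) = 0"
      using insert.prems[rule_format, of "insert a I" "\<lambda>k. if k = a then 1 else - q k"] by blast
    then show False by simp
  qed
  define t where "t = (v a - (\<Sum>k\<in>I. f k * A k a)) / D"
  have t: "t * D = v a - (\<Sum>k\<in>I. f k * A k a)" using \<open>D \<noteq> 0\<close> by (simp add: t_def)
  show ?case
  proof (intro exI ballI)
    fix i assume i: "i \<in> insert a I"
    have "(\<Sum>k\<in>insert a I. (if k = a then t else f k - t * q k) * A k i) =
       t * A a i + (\<Sum>k\<in>I. f k * A k i) - t * (\<Sum>k\<in>I. q k * A k i)"
      unfolding sums by (simp add: left_diff_distrib sum_subtractf sum_distrib_left mult.assoc)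
    also have "\<dots> = v i"
    proof (cases "i = a")
      case True
      then show ?thesis using t by (simp add: D_def algebra_simps)
    next
      case False
      then show ?thesis using i q f by simp
    qed
    finally show "(\<Sum>k\<in>insert a I. (if k = a then t else f k - t * q k) * A k i) = v i" .
  qed
qed simp

text \<open>The lower bound, applied to coefficients padded by zeros, makes every principal block of
  the Gram matrix nondegenerate. For the solution, the squared norm N is the sum of cnj (c i) v i;
  Young's inequality and the lower bound give N \<le> (N + |v|^2/K)/2.\<close>

lemma Riesz_lower_bound_imp_solvable:
  fixes e :: "'i \<Rightarrow> 'a \<Rightarrow> complex"
  assumes I: "finite I" and e: "\<And>i. i \<in> I \<Longrightarrow> e i \<in> borel_measurable M" "\<And>i. i \<in> I \<Longrightarrow> integrable M (\<lambda>z. (cmod (e i z))\<^sup>2)"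
    and K: "K > 0" and lower: "\<And>c. K * (\<Sum>i\<in>I. (cmod (c i))\<^sup>2) \<le> (LINT z|M. (cmod (\<Sum>i\<in>I. c i * e i z))\<^sup>2)"
  shows "\<exists>c. (\<forall>i\<in>I. (LINT z|M. (\<Sum>k\<in>I. c k * e k z) * cnj (e i z)) = v i) \<and>
     K * (LINT z|M. (cmod (\<Sum>k\<in>I. c k * e k z))\<^sup>2) \<le> (\<Sum>i\<in>I. (cmod (v i))\<^sup>2)"
proof -
  define A where "A k i = (LINT z|M. e k z * cnj (e i z))" for k i
  have int: "integrable M (\<lambda>z. e k z * cnj (e i z))" if "k \<in> I" "i \<in> I" for k i
    using e that by (intro integrable_mult_cnj_L2) auto
  have lin: "(LINT z|M. (\<Sum>k\<in>J. c k * e k z) * cnj (e i z)) = (\<Sum>k\<in>J. c k * A k i)" if "J \<subseteq> I" "i \<in> I" for J c i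
  proof -
    have "(LINT z|M. (\<Sum>k\<in>J. c k * e k z) * cnj (e i z)) = (LINT z|M. (\<Sum>k\<in>J. c k * (e k z * cnj (e i z))))"
      by (simp add: sum_distrib_right mult.assoc)
    also have "\<dots> = (\<Sum>k\<in>J. c k * A k i)"
      unfolding A_def using int that by (subst Bochner_Integration.integral_sum) auto
    finally show ?thesis .
  qed
  have quad: "complex_of_real (LINT z|M. (cmod (\<Sum>k\<in>J. c k * e k z))\<^sup>2) = (\<Sum>i\<in>J. cnj (c i) * (\<Sum>k\<in>J. c k * A k i))" if J: "J \<subseteq> I" for J c
  proof -
    have "complex_of_real (LINT z|M. (cmod (\<Sum>k\<in>J. c k * e k z))\<^sup>2) = (LINT z|M. complex_of_real ((cmod (\<Sum>k\<in>J. c k * e k z))\<^sup>2))"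
      by (rule integral_complex_of_real[symmetric])
    also have "\<dots> = (LINT z|M. (\<Sum>i\<in>J. cnj (c i) * ((\<Sum>k\<in>J. c k * e k z) * cnj (e i z))))"
      unfolding complex_norm_square by (simp add: sum_distrib_left mult_ac)
    also have "\<dots> = (\<Sum>i\<in>J. cnj (c i) * (LINT z|M. (\<Sum>k\<in>J. c k * e k z) * cnj (e i z)))"
    proof (subst Bochner_Integration.integral_sum)
      fix i assume "i \<in> J"
      then have "integrable M (\<lambda>z. \<Sum>k\<in>J. c k * (e k z * cnj (e i z)))"
        using int J by (intro Bochner_Integration.integrable_sum integrable_mult_right) auto
      then show "integrable M (\<lambda>z. cnj (c i) * ((\<Sum>k\<in>J. c k * e k z) * cnj (e i z)))"
        by (intro integrable_mult_right) (simp add: sum_distrib_right mult.assoc)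
    qed simp
    also have "\<dots> = (\<Sum>i\<in>J. cnj (c i) * (\<Sum>k\<in>J. c k * A k i))"
      using lin J by (intro sum.cong refl) auto
    finally show ?thesis .
  qed
  have "\<exists>c. \<forall>i\<in>I. (\<Sum>k\<in>I. c k * A k i) = v i"
  proof (rule nondegenerate_imp_solvable[OF I], intro allI impI ballI)
    fix J c i assume J: "J \<subseteq> I" and z: "\<forall>i\<in>J. (\<Sum>k\<in>J. c k * A k i) = 0" and i: "i \<in> J"
    define c' where "c' k = (if k \<in> J then c k else 0)" for k
    have "(\<Sum>k\<in>I. c' k * e k x) = (\<Sum>k\<in>J. c k * e k x)" for x
      using J I by (intro sum.mono_neutral_cong_right) (auto simp: c'_def)
    then have "K * (\<Sum>i\<in>I. (cmod (c' i))\<^sup>2) \<le> (LINT x|M. (cmod (\<Sum>k\<in>J. c k * e k x))\<^sup>2)"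
      using lower[of c'] by simp
    moreover have "complex_of_real (LINT x|M. (cmod (\<Sum>k\<in>J. c k * e k x))\<^sup>2) = 0"
      unfolding quad[OF J] using z by simp
    ultimately have "K * (\<Sum>i\<in>I. (cmod (c' i))\<^sup>2) \<le> 0" by (simp only: of_real_eq_0_iff)
    then have "(\<Sum>i\<in>I. (cmod (c' i))\<^sup>2) \<le> 0" using K by (simp add: mult_le_0_iff)
    moreover have "(cmod (c' i))\<^sup>2 \<le> (\<Sum>i\<in>I. (cmod (c' i))\<^sup>2)"
      using I J i by (intro member_le_sum) auto
    ultimately have "(cmod (c' i))\<^sup>2 \<le> 0" by linarith
    then show "c i = 0" using i by (simp add: c'_def)
  qed
  then obtain c where c: "\<And>i. i \<in> I \<Longrightarrow> (\<Sum>k\<in>I. c k * A k i) = v i" by blast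
  define N where "N = (LINT z|M. (cmod (\<Sum>k\<in>I. c k * e k z))\<^sup>2)"
  have "complex_of_real N = (\<Sum>i\<in>I. cnj (c i) * v i)"
    unfolding N_def quad[OF subset_refl] using c by simp
  then have "N = Re (\<Sum>i\<in>I. cnj (c i) * v i)" by (metis Re_complex_of_real)
  also have "\<dots> \<le> (\<Sum>i\<in>I. cmod (c i) * cmod (v i))"
    by (rule order_trans[OF complex_Re_le_cmod], rule order_trans[OF norm_sum]) (simp add: norm_mult)
  also have "\<dots> \<le> (\<Sum>i\<in>I. (K * (cmod (c i))\<^sup>2 + (cmod (v i))\<^sup>2 / K) / 2)"
  proof (rule sum_mono)
    fix i
    have "0 \<le> (sqrt K * cmod (c i) - cmod (v i) / sqrt K)\<^sup>2" by simp
    also have "\<dots> = K * (cmod (c i))\<^sup>2 + (cmod (v i))\<^sup>2 / K - 2 * (cmod (c i) * cmod (v i))"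
      using K by (simp add: power2_diff power_mult_distrib power_divide)
    finally show "cmod (c i) * cmod (v i) \<le> (K * (cmod (c i))\<^sup>2 + (cmod (v i))\<^sup>2 / K) / 2" by simp
  qed
  also have "\<dots> = (K * (\<Sum>i\<in>I. (cmod (c i))\<^sup>2) + (\<Sum>i\<in>I. (cmod (v i))\<^sup>2) / K) / 2"
    by (simp add: sum.distrib sum_distrib_left sum_divide_distrib add_divide_distrib)
  also have "\<dots> \<le> (N + (\<Sum>i\<in>I. (cmod (v i))\<^sup>2) / K) / 2"
    using lower[of c] by (simp add: N_def)
  finally have "N \<le> (\<Sum>i\<in>I. (cmod (v i))\<^sup>2) / K" by simp
  then have "K * N \<le> (\<Sum>i\<in>I. (cmod (v i))\<^sup>2)" using K by (simp add: field_simps)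
  then show ?thesis
    using c lin[OF subset_refl] unfolding N_def by (intro exI[of _ c]) auto
qed

text \<open>The reproducing property by division: f is a multiple of the kernel at \<open>z0\<close>
  plus \<open>disk_aut z0\<close> times a holomorphic h. The second part is orthogonal to the
  kernel, because the kernel times the conjugate of \<open>disk_aut z0\<close> has a potential. The
  factor \<open>ker_norm \<alpha> 0\<close> is the total mass.\<close>

lemma bergman_point_evaluation:
  assumes \<alpha>: "\<alpha> > -1" and S: "open S" "cball 0 1 \<subseteq> S" and f: "f holomorphic_on S" and z0: "z0 \<in> ball 0 1"
  shows "2 * ker_norm \<alpha> 0 * cmod (f z0) \<le> (LINT z|bergman_measure \<alpha>. (cmod (f z))\<^sup>2) + ker_norm \<alpha> z0"
proof -
  let ?M = "bergman_measure \<alpha>"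
  let ?D = "bergman_ker \<alpha> z0"
  define T where "T = S \<inter> kernel_dom z0"
  have T: "open T" "cball 0 1 \<subseteq> T" "T \<subseteq> kernel_dom z0"
    using S open_kernel_dom cball_subset_kernel_dom[of z0] z0 by (auto simp: T_def)
  have z0T: "z0 \<in> T" using T(2) z0 by auto
  have D0: "?D z \<noteq> 0" for z by (simp add: bergman_ker_def)
  have hD: "?D holomorphic_on T" using holomorphic_on_subset[OF bergman_ker_holomorphic T(3)] .
  have hf: "f holomorphic_on T" using holomorphic_on_subset[OF f] by (auto simp: T_def)
  define p where "p z = f z / ?D z" for z
  have hp: "p holomorphic_on T" unfolding p_def using hf hD D0 by (intro holomorphic_intros) auto
  define p2 where "p2 z = (if z = z0 then deriv p z0 else (p z - p z0) / (z - z0))" for z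
  have hp2: "p2 holomorphic_on T"
    unfolding p2_def using hp z0T T(1) by (intro pole_lemma) (auto simp: interior_open)
  have pp: "p z = p z0 + (z - z0) * p2 z" for z by (simp add: p2_def)
  define h where "h z = ?D z * (- (1 - cnj z0 * z) * p2 z)" for z
  have hh: "h holomorphic_on T" unfolding h_def using hD hp2 by (intro holomorphic_intros) auto
  have fz: "f z = p z0 * ?D z + disk_aut z0 z * h z" if "z \<in> T" for z
  proof -
    have nz: "1 - cnj z0 * z \<noteq> 0" using kernel_dom_nz(1) T(3) that by blast
    have "f z = ?D z * p z" using D0 by (simp add: p_def)
    also have "\<dots> = p z0 * ?D z + ?D z * (z - z0) * p2 z" by (subst pp) (simp add: algebra_simps)
    also have "?D z * (z - z0) * p2 z = disk_aut z0 z * h z"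
    proof -
      have "(a / Y) * (D * (- Y * p)) = - a * D * p" if "Y \<noteq> 0" for a Y D p :: complex
        using that by simp
      from this[OF nz, of "z0 - z" "?D z" "p2 z"] show ?thesis
        by (simp only: disk_aut_def h_def mult_ac minus_diff_eq)
    qed
    finally show ?thesis .
  qed
  have cD: "continuous_on T ?D" "continuous_on T h" "continuous_on T f" "continuous_on T (disk_aut z0)"
    using hD hh hf holomorphic_on_subset[OF disk_aut_holomorphic T(3)] holomorphic_on_imp_continuous_on by blast+
  have int: "integrable ?M F" if "continuous_on T F" for F :: "complex \<Rightarrow> complex"
    using integrable_bergman_continuous[OF \<alpha>] continuous_on_subset[OF that T(2)] by blast
  obtain q where "bergman_potential \<alpha> T q (\<lambda>z. ?D z * disk_aut z0 z ^ 0 * cnj (disk_aut z0 z) ^ 1)"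
    using bergman_potential_exists[OF T(3,1) \<alpha>, of 0 1] by auto
  from bergman_potential_integral_0[OF \<alpha> bergman_potential_mult_cnj[OF this T(1) hh] T(2)]
  have "(LINT z|?M. cnj (disk_aut z0 z * h z * cnj (?D z))) = 0" by (simp add: mult_ac)
  then have 0: "(LINT z|?M. disk_aut z0 z * h z * cnj (?D z)) = 0"
    unfolding Bochner_Integration.integral_cnj by (metis complex_cnj_zero_iff)
  have "(LINT z|?M. f z * cnj (?D z)) = (LINT z|?M. p z0 * (?D z * cnj (?D z)) + disk_aut z0 z * h z * cnj (?D z))"
    by (rule Bochner_Integration.integral_cong[OF refl], subst fz) (use T(2) in \<open>auto simp: algebra_simps\<close>)
  also have "\<dots> = p z0 * (LINT z|?M. ?D z * cnj (?D z))"
    using 0 by (subst Bochner_Integration.integral_add) (auto intro!: int continuous_intros cD)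
  also have "(LINT z|?M. ?D z * cnj (?D z)) = of_real (ker_norm \<alpha> z0)"
    using moment_0_0[of \<alpha> z0] by (simp add: moment_def)
  finally have eq: "(LINT z|?M. f z * cnj (?D z)) = p z0 * of_real (ker_norm \<alpha> z0)" .
  have "cmod (p z0) * ker_norm \<alpha> z0 = ker_norm \<alpha> 0 * cmod (f z0)"
  proof -
    have s: "1 - (cmod z0)\<^sup>2 > 0" using z0 by (simp add: abs_square_less_1)
    have "?D z0 = of_real ((1 - (cmod z0)\<^sup>2) powr (- (2 + \<alpha>)))"
    proof -
      have "1 - cnj z0 * z0 = of_real (1 - (cmod z0)\<^sup>2)"
        using complex_norm_square[of z0] by (simp add: mult.commute)
      then have "Ln (1 - cnj z0 * z0) = of_real (ln (1 - (cmod z0)\<^sup>2))"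
        using s by (simp only: Ln_of_real)
      then show ?thesis using s
        by (simp add: bergman_ker_def powr_def exp_of_real[symmetric])
    qed
    then have "cmod (?D z0) = (1 - (cmod z0)\<^sup>2) powr (- (2 + \<alpha>))" by (simp only: norm_of_real) simp
    then have "ker_norm \<alpha> z0 = ker_norm \<alpha> 0 * cmod (?D z0)" using ker_norm_eq[OF \<alpha> z0] by simp
    then show ?thesis using D0[of z0] by (simp add: p_def norm_divide)
  qed
  then have "2 * (ker_norm \<alpha> 0 * cmod (f z0)) = 2 * cmod (LINT z|?M. f z * cnj (?D z))"
    unfolding eq using ker_norm_pos[OF \<alpha> z0] by (simp add: norm_mult)
  also have "\<dots> \<le> 1 * (LINT z|?M. (cmod (f z))\<^sup>2) + (LINT z|?M. (cmod (?D z))\<^sup>2) / 1"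
  proof (rule norm_integral_mult_cnj_le)
    have intr: "integrable ?M F" if "continuous_on T F" for F :: "complex \<Rightarrow> real"
      using integrable_bergman_continuous[OF \<alpha>] continuous_on_subset[OF that T(2)] by blast
    show "integrable ?M (\<lambda>z. (cmod (f z))\<^sup>2)" "integrable ?M (\<lambda>z. (cmod (?D z))\<^sup>2)"
      by (intro intr continuous_intros cD)+
    show "f \<in> borel_measurable ?M" "?D \<in> borel_measurable ?M"
      using int cD by (auto intro: borel_measurable_integrable)
  qed simp
  finally show ?thesis by (simp add: ker_norm_def)
qed

text \<open>Fatou's lemma puts the limit into L2. For weak convergence, |d| |h| is at most
  \<open>r n\<close> + \<eta> |d|^2: the first part is dominated by |h|^2/\<eta> and tends to 0, the
  second has an integral of order \<eta> by the norm bound.\<close>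

lemma
  fixes f :: "nat \<Rightarrow> 'a \<Rightarrow> complex"
  assumes f: "\<And>n. f n \<in> borel_measurable M" "\<And>n. integrable M (\<lambda>z. (cmod (f n z))\<^sup>2)"
      "\<And>n. (LINT z|M. (cmod (f n z))\<^sup>2) \<le> B"
    and lim: "\<And>z. z \<in> space M \<Longrightarrow> (\<lambda>n. f n z) \<longlonglongrightarrow> g z"
  shows bounded_L2_limit_integrable: "integrable M (\<lambda>z. (cmod (g z))\<^sup>2)"
    and bounded_L2_limit_inner: "h \<in> borel_measurable M \<Longrightarrow> integrable M (\<lambda>z. (cmod (h z))\<^sup>2) \<Longrightarrow>
       (\<lambda>n. LINT z|M. f n z * cnj (h z)) \<longlonglongrightarrow> (LINT z|M. g z * cnj (h z))"
proof -
  have gm [measurable]: "g \<in> borel_measurable M"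
    by (rule borel_measurable_LIMSEQ_metric[OF f(1) lim])
  note [measurable] = f(1)
  show gi: "integrable M (\<lambda>z. (cmod (g z))\<^sup>2)"
  proof (rule integrableI_bounded)
    have "(\<integral>\<^sup>+z. ennreal (norm ((cmod (g z))\<^sup>2)) \<partial>M) = (\<integral>\<^sup>+z. liminf (\<lambda>n. ennreal ((cmod (f n z))\<^sup>2)) \<partial>M)"
    proof (rule nn_integral_cong)
      fix z assume "z \<in> space M"
      then have "(\<lambda>n. ennreal ((cmod (f n z))\<^sup>2)) \<longlonglongrightarrow> ennreal ((cmod (g z))\<^sup>2)"
        by (intro tendsto_ennrealI tendsto_intros lim)
      from lim_imp_Liminf[OF trivial_limit_sequentially this]
      show "ennreal (norm ((cmod (g z))\<^sup>2)) = liminf (\<lambda>n. ennreal ((cmod (f n z))\<^sup>2))" by simp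
    qed
    also have "\<dots> \<le> liminf (\<lambda>n. \<integral>\<^sup>+z. ennreal ((cmod (f n z))\<^sup>2) \<partial>M)"
      by (rule nn_integral_liminf) measurable
    also have "\<dots> \<le> ennreal B"
    proof (rule Liminf_le)
      have "(\<integral>\<^sup>+z. ennreal ((cmod (f n z))\<^sup>2) \<partial>M) \<le> ennreal B" for n
        using f(2,3)[of n] by (subst nn_integral_eq_integral) (auto intro: ennreal_leI)
      then show "\<forall>\<^sub>F n in sequentially. (\<integral>\<^sup>+z. ennreal ((cmod (f n z))\<^sup>2) \<partial>M) \<le> ennreal B" by simp
    qed simp
    finally show "(\<integral>\<^sup>+z. ennreal (norm ((cmod (g z))\<^sup>2)) \<partial>M) < \<infinity>"
      by (metis ennreal_less_top infinity_ennreal_def le_less_trans)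
  qed measurable
  assume hm [measurable]: "h \<in> borel_measurable M" and hi: "integrable M (\<lambda>z. (cmod (h z))\<^sup>2)"
  define d where "d n z = f n z - g z" for n z
  \<comment> \<open>The added 1 makes \<open>B'\<close> positive, so that the choice of \<eta> can
    divide by it.\<close>
  define B' where "B' = 2 * B + 2 * (LINT z|M. (cmod (g z))\<^sup>2) + 1"
  have di: "integrable M (\<lambda>z. (cmod (d n z))\<^sup>2)" for n
    unfolding d_def using integrable_L2_add[OF f(1) borel_measurable_uminus[OF gm] f(2)] gi by simp
  have dB: "(LINT z|M. (cmod (d n z))\<^sup>2) \<le> B' - 1" for n
  proof -
    have "(LINT z|M. (cmod (d n z))\<^sup>2) \<le> (LINT z|M. 2 * (cmod (f n z))\<^sup>2 + 2 * (cmod (g z))\<^sup>2)"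
      using di f(2) gi norm_add_square_le[of "f n _" "- g _"] by (intro integral_mono) (auto simp: d_def)
    also have "\<dots> = 2 * (LINT z|M. (cmod (f n z))\<^sup>2) + 2 * (LINT z|M. (cmod (g z))\<^sup>2)"
      using f(2) gi by simp
    also have "\<dots> \<le> B' - 1" using f(3)[of n] by (simp add: B'_def)
    finally show ?thesis .
  qed
  have B': "B' > 0"
  proof -
    have "0 \<le> (LINT z|M. (cmod (d 0 z))\<^sup>2)" by (rule integral_nonneg_AE) simp
    then show ?thesis using dB[of 0] by linarith
  qed
  have dm [measurable]: "d n \<in> borel_measurable M" for n unfolding d_def by measurable
  have ih: "integrable M (\<lambda>z. d n z * cnj (h z))" for n
    by (rule integrable_mult_cnj_L2[OF dm hm di hi])
  show "(\<lambda>n. LINT z|M. f n z * cnj (h z)) \<longlonglongrightarrow> (LINT z|M. g z * cnj (h z))"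
  proof (rule LIMSEQ_I)
    fix \<epsilon> :: real assume \<epsilon>: "\<epsilon> > 0"
    define \<eta> where "\<eta> = \<epsilon> / (2 * B')"
    have \<eta>: "\<eta> > 0" using \<epsilon> B' by (simp add: \<eta>_def)
    define r where "r n z = max 0 (cmod (d n z) * cmod (h z) - \<eta> * (cmod (d n z))\<^sup>2)" for n z
    have rle: "r n z \<le> (cmod (h z))\<^sup>2 / \<eta>" for n z
    proof -
      have "0 \<le> (sqrt \<eta> * cmod (d n z) - cmod (h z) / sqrt \<eta>)\<^sup>2" by simp
      also have "\<dots> = \<eta> * (cmod (d n z))\<^sup>2 + (cmod (h z))\<^sup>2 / \<eta> - 2 * (cmod (d n z) * cmod (h z))"
        using \<eta> by (simp add: power2_diff power_mult_distrib power_divide)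
      finally have "2 * (cmod (d n z) * cmod (h z)) \<le> \<eta> * (cmod (d n z))\<^sup>2 + (cmod (h z))\<^sup>2 / \<eta>" by simp
      moreover have "0 \<le> cmod (d n z) * cmod (h z)" "0 \<le> (cmod (h z))\<^sup>2 / \<eta>" "0 \<le> \<eta> * (cmod (d n z))\<^sup>2" using \<eta> by auto
      ultimately show ?thesis unfolding r_def by linarith
    qed
    have "(\<lambda>n. LINT z|M. r n z) \<longlonglongrightarrow> (LINT z|M. 0)"
    proof (rule integral_dominated_convergence[where w="\<lambda>z. (cmod (h z))\<^sup>2 / \<eta>"])
      show "AE z in M. (\<lambda>n. r n z) \<longlonglongrightarrow> 0"
      proof (rule AE_I2)
        fix z assume z: "z \<in> space M"
        have "(\<lambda>n. d n z) \<longlonglongrightarrow> g z - g z" unfolding d_def by (intro tendsto_intros lim z)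
        then have "(\<lambda>n. r n z) \<longlonglongrightarrow> max 0 (cmod (g z - g z) * cmod (h z) - \<eta> * (cmod (g z - g z))\<^sup>2)"
          unfolding r_def by (intro tendsto_intros)
        then show "(\<lambda>n. r n z) \<longlonglongrightarrow> 0" by simp
      qed
      show "AE z in M. norm (r n z) \<le> (cmod (h z))\<^sup>2 / \<eta>" for n
        using rle[of n] by (intro AE_I2) (simp add: r_def)
      show "integrable M (\<lambda>z. (cmod (h z))\<^sup>2 / \<eta>)" using hi by simp
    qed (unfold r_def, measurable)
    then have "(\<lambda>n. LINT z|M. r n z) \<longlonglongrightarrow> 0" by simp
    from LIMSEQ_D[OF this, of "\<epsilon> / 2"] \<epsilon> obtain N where N: "\<And>n. n \<ge> N \<Longrightarrow> norm ((LINT z|M. r n z) - 0) < \<epsilon> / 2"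
      by auto
    show "\<exists>N. \<forall>n\<ge>N. norm ((LINT z|M. f n z * cnj (h z)) - (LINT z|M. g z * cnj (h z))) < \<epsilon>"
    proof (intro exI allI impI)
      fix n assume n: "n \<ge> N"
      have ri: "integrable M (r n)"
      proof (rule Bochner_Integration.integrable_bound)
        show "integrable M (\<lambda>z. (cmod (h z))\<^sup>2 / \<eta>)" using hi by simp
        show "r n \<in> borel_measurable M" unfolding r_def by measurable
        have "norm (r n z) \<le> norm ((cmod (h z))\<^sup>2 / \<eta>)" for z
        proof -
          have "0 \<le> r n z" by (simp add: r_def)
          with rle[of n z] show ?thesis by (simp only: real_norm_def abs_of_nonneg order_trans[OF \<open>0 \<le> r n z\<close>])
        qed
        then show "AE z in M. norm (r n z) \<le> norm ((cmod (h z))\<^sup>2 / \<eta>)" by simp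
      qed
      have "(LINT z|M. f n z * cnj (h z)) - (LINT z|M. g z * cnj (h z)) = (LINT z|M. d n z * cnj (h z))"
        using integrable_mult_cnj_L2[OF f(1) hm f(2) hi, of n] integrable_mult_cnj_L2[OF gm hm gi hi]
        by (simp add: d_def left_diff_distrib)
      also have "norm \<dots> \<le> (LINT z|M. cmod (d n z * cnj (h z)))" by (rule integral_norm_bound)
      also have "\<dots> \<le> (LINT z|M. r n z + \<eta> * (cmod (d n z))\<^sup>2)"
      proof (rule integral_mono)
        show "integrable M (\<lambda>z. cmod (d n z * cnj (h z)))" using ih by (rule integrable_norm)
        show "integrable M (\<lambda>z. r n z + \<eta> * (cmod (d n z))\<^sup>2)" using ri di by simp
        show "cmod (d n z * cnj (h z)) \<le> r n z + \<eta> * (cmod (d n z))\<^sup>2" for z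
          by (simp add: r_def norm_mult)
      qed
      also have "\<dots> = (LINT z|M. r n z) + \<eta> * (LINT z|M. (cmod (d n z))\<^sup>2)" using ri di by simp
      also have "\<dots> < \<epsilon> / 2 + \<eta> * B'"
        using N[OF n] dB[of n] \<eta> by (intro add_less_le_mono mult_left_mono) auto
      also have "\<dots> = \<epsilon>" using B' by (simp add: \<eta>_def)
      finally show "norm ((LINT z|M. f n z * cnj (h z)) - (LINT z|M. g z * cnj (h z))) < \<epsilon>" .
    qed
  qed
qed

text \<open>The interpolant is a combination of the functions \<open>ker_basis\<close>, hence
  holomorphic past the circle, as \<open>bergman_point_evaluation\<close> requires. \<open>K\<close>
  is fixed before \<open>F\<close> and \<open>v\<close>, which is what makes the limit over finite
  sets possible.\<close>

lemma finite_interpolation: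
  assumes \<alpha>: "\<alpha> > -1" and C: "(\<alpha> + 1) / 2 < C" "C < \<alpha> + 1" and div: "divisor \<Lambda> m"
    and L: "\<forall>w\<in>\<Lambda>. deriv_log_branch w (L w)"
    and disj: "disjoint_family_on (\<lambda>w. pseudohyp_disk w (sqrt ((real (m w) + C) / (real (m w) + \<alpha> + 1)))) \<Lambda>"
  shows "\<exists>K>0. \<forall>F v. finite F \<longrightarrow> F \<subseteq> \<Lambda> \<longrightarrow> (\<exists>f S. open S \<and> cball 0 1 \<subseteq> S \<and> f holomorphic_on S \<and>
     K * (LINT z|bergman_measure \<alpha>. (cmod (f z))\<^sup>2) \<le> (\<Sum>w\<in>F. \<Sum>j<m w. (cmod (v w j))\<^sup>2) \<and>
     (\<forall>w\<in>F. \<forall>j<m w. bergman_inner \<alpha> f (bergman_shift \<alpha> (L w) w (bergman_basis \<alpha> j)) = v w j))"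
proof -
  let ?M = "bergman_measure \<alpha>"
  obtain M where M: "M > 0" "\<And>F c. finite F \<Longrightarrow> F \<subseteq> \<Lambda> \<Longrightarrow>
    (\<Sum>w\<in>F. ker_norm \<alpha> w * (\<Sum>j<m w. (cmod (c w j))\<^sup>2)) \<le>
    M * (LINT z|?M. (cmod (\<Sum>w\<in>F. \<Sum>j<m w. c w j * ker_basis \<alpha> w j z))\<^sup>2)"
    using ker_basis_lower_bound[OF \<alpha> C div disj] by blast
  have b: "w \<in> ball 0 1" if "w \<in> \<Lambda>" for w using div that by (auto simp: divisor_def)
  have "\<exists>\<theta>. (cmod \<theta>)\<^sup>2 * ker_norm \<alpha> w = ker_norm \<alpha> 0 \<and>
    (\<forall>j. \<forall>z\<in>ball 0 1. bergman_shift \<alpha> (L w) w (bergman_basis \<alpha> j) z = \<theta> * ker_basis \<alpha> w j z)" if w: "w \<in> \<Lambda>" for w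
  proof -
    obtain \<theta> where "(cmod \<theta>)\<^sup>2 * ker_norm \<alpha> w = ker_norm \<alpha> 0" "\<theta> \<noteq> 0"
      "\<And>j z. z \<in> ball 0 1 \<Longrightarrow> bergman_shift \<alpha> (L w) w (bergman_basis \<alpha> j) z = \<theta> * ker_basis \<alpha> w j z"
      using bergman_shift_basis[OF \<alpha> b[OF w] L[rule_format, OF w]] by blast
    then show ?thesis by blast
  qed
  then obtain \<theta> where \<theta>: "\<And>w. w \<in> \<Lambda> \<Longrightarrow> (cmod (\<theta> w))\<^sup>2 * ker_norm \<alpha> w = ker_norm \<alpha> 0"
    "\<And>w j z. w \<in> \<Lambda> \<Longrightarrow> z \<in> ball 0 1 \<Longrightarrow> bergman_shift \<alpha> (L w) w (bergman_basis \<alpha> j) z = \<theta> w * ker_basis \<alpha> w j z"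
    by metis
  define K where "K = ker_norm \<alpha> 0 / M"
  have K: "K > 0" using M(1) ker_norm_0_pos[OF \<alpha>] by (simp add: K_def)
  moreover have "\<exists>f S. open S \<and> cball 0 1 \<subseteq> S \<and> f holomorphic_on S \<and>
     K * (LINT z|?M. (cmod (f z))\<^sup>2) \<le> (\<Sum>w\<in>F. \<Sum>j<m w. (cmod (v w j))\<^sup>2) \<and>
     (\<forall>w\<in>F. \<forall>j<m w. bergman_inner \<alpha> f (bergman_shift \<alpha> (L w) w (bergman_basis \<alpha> j)) = v w j)"
    if F: "finite F" "F \<subseteq> \<Lambda>" for F v
  proof -
    define I where "I = (SIGMA w:F. {..<m w})"
    define e where "e i z = \<theta> (fst i) * ker_basis \<alpha> (fst i) (snd i) z" for i z
    have I: "finite I" unfolding I_def using F(1) by auto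
    have Ib: "fst i \<in> ball 0 1" if "i \<in> I" for i using that F b by (auto simp: I_def)
    have ce: "continuous_on (cball 0 1) (e i)" if "i \<in> I" for i
      unfolding e_def by (intro continuous_intros ker_basis_continuous Ib that)
    have sig: "(\<Sum>i\<in>I. h i) = (\<Sum>w\<in>F. \<Sum>j<m w. h (w, j))" for h :: "complex \<times> nat \<Rightarrow> 'b::comm_monoid_add"
      unfolding I_def using F(1) by (subst sum.Sigma) auto
    have "\<exists>c. (\<forall>i\<in>I. (LINT z|?M. (\<Sum>k\<in>I. c k * e k z) * cnj (e i z)) = v (fst i) (snd i)) \<and>
      K * (LINT z|?M. (cmod (\<Sum>k\<in>I. c k * e k z))\<^sup>2) \<le> (\<Sum>i\<in>I. (cmod (v (fst i) (snd i)))\<^sup>2)"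
    proof (rule Riesz_lower_bound_imp_solvable[OF I _ _ K])
      fix i assume i: "i \<in> I"
      show "e i \<in> borel_measurable ?M"
        by (rule borel_measurable_integrable[OF integrable_bergman_continuous[OF \<alpha> ce[OF i]]])
      show "integrable ?M (\<lambda>z. (cmod (e i z))\<^sup>2)"
        by (intro integrable_bergman_continuous[OF \<alpha>] continuous_intros ce i)
    next
      fix c :: "complex \<times> nat \<Rightarrow> complex"
      have "ker_norm \<alpha> 0 * (\<Sum>i\<in>I. (cmod (c i))\<^sup>2) =
        (\<Sum>w\<in>F. ker_norm \<alpha> w * (\<Sum>j<m w. (cmod (c (w, j) * \<theta> w))\<^sup>2))"
        unfolding sig sum_distrib_left
      proof (intro sum.cong refl)
        fix w j assume "w \<in> F"
        then have "ker_norm \<alpha> 0 = (cmod (\<theta> w))\<^sup>2 * ker_norm \<alpha> w" using \<theta>(1) F(2) by auto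
        then show "ker_norm \<alpha> 0 * (cmod (c (w, j)))\<^sup>2 = ker_norm \<alpha> w * (cmod (c (w, j) * \<theta> w))\<^sup>2"
          by (simp add: norm_mult power_mult_distrib)
      qed
      also have "\<dots> \<le> M * (LINT z|?M. (cmod (\<Sum>w\<in>F. \<Sum>j<m w. c (w, j) * \<theta> w * ker_basis \<alpha> w j z))\<^sup>2)"
        by (rule M(2)[OF F])
      also have "\<dots> = M * (LINT z|?M. (cmod (\<Sum>i\<in>I. c i * e i z))\<^sup>2)"
        unfolding sig by (simp add: e_def mult.assoc)
      finally show "K * (\<Sum>i\<in>I. (cmod (c i))\<^sup>2) \<le> (LINT z|?M. (cmod (\<Sum>i\<in>I. c i * e i z))\<^sup>2)"
        using M(1) by (simp add: K_def field_simps)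
    qed
    then obtain c where c: "\<And>i. i \<in> I \<Longrightarrow> (LINT z|?M. (\<Sum>k\<in>I. c k * e k z) * cnj (e i z)) = v (fst i) (snd i)"
      "K * (LINT z|?M. (cmod (\<Sum>k\<in>I. c k * e k z))\<^sup>2) \<le> (\<Sum>i\<in>I. (cmod (v (fst i) (snd i)))\<^sup>2)"
      by blast
    define S where "S = (\<Inter>w\<in>F. kernel_dom w)"
    show ?thesis
    proof (intro exI conjI ballI allI impI)
      show "open S" unfolding S_def using F(1) open_kernel_dom by (intro open_INT) auto
      show "cball 0 1 \<subseteq> S"
        unfolding S_def by (intro INT_greatest cball_subset_kernel_dom) (use b F(2) in force)
      have "e k holomorphic_on S" if "k \<in> I" for k
        unfolding e_def using that
        by (intro holomorphic_intros holomorphic_on_subset[OF ker_basis_holomorphic]) (auto simp: S_def I_def)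
      then show "(\<lambda>z. \<Sum>k\<in>I. c k * e k z) holomorphic_on S" by (intro holomorphic_intros)
      show "K * (LINT z|?M. (cmod (\<Sum>k\<in>I. c k * e k z))\<^sup>2) \<le> (\<Sum>w\<in>F. \<Sum>j<m w. (cmod (v w j))\<^sup>2)"
        using c(2) unfolding sig by simp
      fix w j assume wj: "w \<in> F" "j < m w"
      have "bergman_inner \<alpha> (\<lambda>z. \<Sum>k\<in>I. c k * e k z) (bergman_shift \<alpha> (L w) w (bergman_basis \<alpha> j)) =
        (LINT z|?M. (\<Sum>k\<in>I. c k * e k z) * cnj (e (w, j) z))"
        unfolding bergman_inner_def
        by (rule Bochner_Integration.integral_cong[OF refl]) (use \<theta>(2) wj F(2) in \<open>auto simp: e_def\<close>)
      then show "bergman_inner \<alpha> (\<lambda>z. \<Sum>k\<in>I. c k * e k z) (bergman_shift \<alpha> (L w) w (bergman_basis \<alpha> j)) = v w j"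
        using c(1)[of "(w, j)"] wj by (simp add: I_def)
    qed
  qed
  ultimately show ?thesis by blast
qed

text \<open>The disks are disjoint nonempty open sets in the plane. Countability provides the
  exhaustion by a sequence of finite sets.\<close>

lemma divisor_countable:
  assumes "divisor \<Lambda> m" and r: "\<And>w. w \<in> \<Lambda> \<Longrightarrow> r w > 0"
    and disj: "disjoint_family_on (\<lambda>w. pseudohyp_disk w (r w)) \<Lambda>"
  shows "countable \<Lambda>"
proof -
  let ?D = "\<lambda>w. pseudohyp_disk w (r w)"
  have b: "w \<in> ball 0 1" if "w \<in> \<Lambda>" for w using assms(1) that by (auto simp: divisor_def)
  have c: "w \<in> ?D w" if "w \<in> \<Lambda>" for w
    using b[OF that] r[OF that] by (simp add: pseudohyp_disk_def pseudohyp_dist_def disk_aut_def)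
  have o: "open (?D w)" if "w \<in> \<Lambda>" for w
  proof -
    have "continuous_on (ball 0 1) (\<lambda>z. cmod (disk_aut w z))"
      using continuous_on_subset[OF continuous_on_ker_cball(2)[OF b[OF that]]]
      by (intro continuous_intros) auto
    then have "open (ball 0 1 \<inter> (\<lambda>z. cmod (disk_aut w z)) -` {..<r w})"
      by (intro continuous_open_preimage) auto
    also have "ball 0 1 \<inter> (\<lambda>z. cmod (disk_aut w z)) -` {..<r w} = ?D w"
      by (auto simp: pseudohyp_disk_def pseudohyp_dist_def)
    finally show ?thesis .
  qed
  have "countable (?D ` \<Lambda>)"
  proof (rule countable_disjoint_open_subsets)
    show "pairwise disjnt (?D ` \<Lambda>)"
    proof (rule pairwiseI)
      fix A B assume "A \<in> ?D ` \<Lambda>" "B \<in> ?D ` \<Lambda>" "A \<noteq> B"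
      then obtain x y where "x \<in> \<Lambda>" "y \<in> \<Lambda>" "A = ?D x" "B = ?D y" "x \<noteq> y" by blast
      then show "disjnt A B" using disjoint_family_onD[OF disj] by (simp add: disjnt_def)
    qed
  qed (use o in auto)
  moreover have "inj_on ?D \<Lambda>"
  proof (rule inj_onI)
    fix x y assume xy: "x \<in> \<Lambda>" "y \<in> \<Lambda>" "?D x = ?D y"
    then have "x \<in> ?D x \<inter> ?D y" using c[OF xy(1)] by simp
    then show "x = y" using disjoint_family_onD[OF disj xy(1,2)] by blast
  qed
  ultimately show ?thesis by (rule countable_image_inj_on)
qed

text \<open>Interpolants on an increasing sequence of finite sets have bounded norms, so point
  evaluation makes them locally bounded, and Montel's theorem gives a limit. Each inner product is
  eventually equal to its prescribed value along the sequence and survives in the limit by weak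
  convergence.\<close>

lemma disjoint_imp_interpolating:
  assumes \<alpha>: "\<alpha> > -1" and C: "(\<alpha> + 1) / 2 < C" "C < \<alpha> + 1" and div: "divisor \<Lambda> m"
    and L: "\<forall>w\<in>\<Lambda>. deriv_log_branch w (L w)"
    and disj: "disjoint_family_on (\<lambda>w. pseudohyp_disk w (sqrt ((real (m w) + C) / (real (m w) + \<alpha> + 1)))) \<Lambda>"
  shows "interpolating \<alpha> L \<Lambda> m"
  unfolding interpolating_def
proof
  fix v assume v: "v \<in> ell2 \<Lambda> m"
  let ?M = "bergman_measure \<alpha>"
  define T where "T w j = bergman_shift \<alpha> (L w) w (bergman_basis \<alpha> j)" for w j
  define V where "V = (\<Sum>\<^sub>\<infinity>w\<in>\<Lambda>. \<Sum>j<m w. (cmod (v w j))\<^sup>2)"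
  have V: "(\<Sum>w\<in>F. \<Sum>j<m w. (cmod (v w j))\<^sup>2) \<le> V" if "finite F" "F \<subseteq> \<Lambda>" for F
    unfolding V_def using v that by (intro finite_sum_le_infsum) (auto simp: ell2_def intro!: sum_nonneg)
  define Q where "Q K \<longleftrightarrow> (\<forall>F v. finite F \<longrightarrow> F \<subseteq> \<Lambda> \<longrightarrow> (\<exists>f S. open S \<and> cball 0 1 \<subseteq> S \<and> f holomorphic_on S \<and>
     K * (LINT z|?M. (cmod (f z))\<^sup>2) \<le> (\<Sum>w\<in>F. \<Sum>j<m w. (cmod (v w j))\<^sup>2) \<and>
     (\<forall>w\<in>F. \<forall>j<m w. bergman_inner \<alpha> f (T w j) = v w j)))" for K
  have "\<exists>K>0. Q K"
    unfolding Q_def T_def by (rule finite_interpolation[OF \<alpha> C div L disj])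
  then obtain K where K: "K > 0" "Q K" by blast
  have b: "w \<in> ball 0 1" "m w \<ge> 1" if "w \<in> \<Lambda>" for w using div that by (auto simp: divisor_def)
  have "0 < (\<alpha> + 1) / 2" using \<alpha> by simp
  then have C0: "C > 0" using C(1) by (rule less_trans)
  have "countable \<Lambda>"
    by (rule divisor_countable[OF div _ disj]) (use C0 \<alpha> in \<open>auto intro!: divide_pos_pos add_nonneg_pos\<close>)
  define Fn where "Fn n = {w \<in> \<Lambda>. to_nat_on \<Lambda> w \<le> n}" for n
  have Fn: "finite (Fn n)" "Fn n \<subseteq> \<Lambda>" for n
  proof -
    show "Fn n \<subseteq> \<Lambda>" by (auto simp: Fn_def)
    show "finite (Fn n)"
      by (rule inj_on_finite[of "to_nat_on \<Lambda>" _ "{..n}"])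
         (use inj_on_to_nat_on[OF \<open>countable \<Lambda>\<close>] in \<open>auto simp: Fn_def inj_on_def\<close>)
  qed
  define P where "P n f \<longleftrightarrow> (\<exists>S. open S \<and> cball 0 1 \<subseteq> S \<and> f holomorphic_on S) \<and>
     (LINT z|?M. (cmod (f z))\<^sup>2) \<le> V / K \<and> (\<forall>w\<in>Fn n. \<forall>j<m w. bergman_inner \<alpha> f (T w j) = v w j)" for n f
  have "\<exists>f. P n f" for n
  proof -
    from K(2)[unfolded Q_def, rule_format, OF Fn[of n], of v] show ?thesis
    proof (elim exE conjE)
      fix f S
      assume f: "open S" "cball 0 1 \<subseteq> S" "f holomorphic_on S"
        "K * (LINT z|?M. (cmod (f z))\<^sup>2) \<le> (\<Sum>w\<in>Fn n. \<Sum>j<m w. (cmod (v w j))\<^sup>2)"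
        "\<forall>w\<in>Fn n. \<forall>j<m w. bergman_inner \<alpha> f (T w j) = v w j"
      have "K * (LINT z|?M. (cmod (f z))\<^sup>2) \<le> V" using f(4) V[OF Fn, of n] by linarith
      then have "(LINT z|?M. (cmod (f z))\<^sup>2) \<le> V / K" using K(1) by (simp add: field_simps)
      with f show "\<exists>f. P n f"
        unfolding P_def by (intro exI[of _ f] conjI exI[of _ S])
    qed
  qed
  then obtain f where f: "\<And>n. P n (f n)" by metis
  have fc: "continuous_on (cball 0 1) (f n)" for n
    using f[of n] holomorphic_on_imp_continuous_on continuous_on_subset unfolding P_def by blast
  have fm: "f n \<in> borel_measurable ?M" "integrable ?M (\<lambda>z. (cmod (f n z))\<^sup>2)" for n
    by (rule borel_measurable_integrable[OF integrable_bergman_continuous[OF \<alpha> fc]])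
       (intro integrable_bergman_continuous[OF \<alpha>] continuous_intros fc)
  have \<kappa>: "ker_norm \<alpha> 0 > 0" by (rule ker_norm_0_pos[OF \<alpha>])
  have fb: "2 * ker_norm \<alpha> 0 * cmod (f n z) \<le> V / K + ker_norm \<alpha> z" if "z \<in> ball 0 1" for n z
  proof -
    obtain S where "open S" "cball 0 1 \<subseteq> S" "f n holomorphic_on S" using f[of n] unfolding P_def by blast
    from bergman_point_evaluation[OF \<alpha> this that] f[of n] show ?thesis unfolding P_def by linarith
  qed
  obtain g r where gr: "g holomorphic_on ball 0 1" "strict_mono (r :: nat \<Rightarrow> nat)"
    "\<And>x. x \<in> ball 0 1 \<Longrightarrow> ((\<lambda>n. f (r n) x) \<longlongrightarrow> g x) sequentially"
  proof (rule Montel[of "ball 0 1" "range f" f])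
    show "h holomorphic_on ball 0 1" if hr: "h \<in> range f" for h
    proof -
      obtain n where h: "h = f n" using hr by auto
      obtain S where "cball 0 1 \<subseteq> S" "f n holomorphic_on S" using f[of n] unfolding P_def by blast
      then show ?thesis unfolding h using ball_subset_cball by (meson holomorphic_on_subset order_trans)
    qed
    fix A :: "complex set" assume A: "compact A" "A \<subseteq> ball 0 1"
    have c: "continuous_on A (\<lambda>z. ker_norm \<alpha> 0 * (1 - (cmod z)\<^sup>2) powr (- (2 + \<alpha>)))"
    proof (intro continuous_intros)
      show "\<forall>z\<in>A. 1 - (cmod z)\<^sup>2 \<noteq> 0"
      proof
        fix z assume "z \<in> A"
        then have "(cmod z)\<^sup>2 < 1" using A(2) abs_square_less_1[of "cmod z"] by auto
        then show "1 - (cmod z)\<^sup>2 \<noteq> 0" by simp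
      qed
    qed
    have "bounded ((\<lambda>z. ker_norm \<alpha> 0 * (1 - (cmod z)\<^sup>2) powr (- (2 + \<alpha>))) ` A)"
      by (rule compact_imp_bounded[OF compact_continuous_image[OF c A(1)]])
    then obtain N where N: "\<And>z. z \<in> A \<Longrightarrow> norm (ker_norm \<alpha> 0 * (1 - (cmod z)\<^sup>2) powr (- (2 + \<alpha>))) \<le> N"
      unfolding bounded_iff by blast
    show "\<exists>B. \<forall>h\<in>range f. \<forall>z\<in>A. norm (h z) \<le> B"
    proof (intro exI ballI)
      fix h z assume h: "h \<in> range f" and z: "z \<in> A"
      then obtain n where h: "h = f n" by auto
      have zb: "z \<in> ball 0 1" using z A(2) by auto
      have "ker_norm \<alpha> z \<le> N" using N[OF z] ker_norm_eq[OF \<alpha> zb] by simp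
      then have "2 * ker_norm \<alpha> 0 * cmod (f n z) \<le> V / K + N" using fb[OF zb, of n] by linarith
      then show "norm (h z) \<le> (V / K + N) / (2 * ker_norm \<alpha> 0)"
        unfolding h using \<kappa> by (simp add: pos_le_divide_eq mult.commute)
    qed
  qed auto
  have fB: "(LINT z|?M. (cmod (f (r n) z))\<^sup>2) \<le> V / K" for n
    using f[of "r n"] unfolding P_def by blast
  have lim: "(\<lambda>n. f (r n) z) \<longlonglongrightarrow> g z" if "z \<in> space ?M" for z
    using gr(3) that by simp
  have "g \<in> bergman_space \<alpha>"
    using gr(1) bounded_L2_limit_integrable[OF fm(1) fm(2) fB lim] by (simp add: bergman_space_def)
  moreover have "bergman_inner \<alpha> g (T w j) = v w j" if w: "w \<in> \<Lambda>" "j < m w" for w j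
  proof -
    have "(\<lambda>n. LINT z|?M. f (r n) z * cnj (T w j z)) \<longlonglongrightarrow> (LINT z|?M. g z * cnj (T w j z))"
      by (rule bounded_L2_limit_inner[OF fm(1) fm(2) fB lim])
         (use bergman_shift_basis_L2[OF \<alpha> b(1)[OF w(1)], of "L w" j] L w in \<open>auto simp: T_def\<close>)
    moreover have "\<forall>\<^sub>F n in sequentially. (LINT z|?M. f (r n) z * cnj (T w j z)) = v w j"
      unfolding eventually_sequentially
    proof (intro exI allI impI)
      fix n assume "to_nat_on \<Lambda> w \<le> n"
      then have "to_nat_on \<Lambda> w \<le> r n" using seq_suble[OF gr(2), of n] by linarith
      then have "w \<in> Fn (r n)" using w by (simp add: Fn_def)
      then show "(LINT z|?M. f (r n) z * cnj (T w j z)) = v w j"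
        using f[of "r n"] w(2) by (auto simp: P_def bergman_inner_def)
    qed
    then have "(\<lambda>n. LINT z|?M. f (r n) z * cnj (T w j z)) \<longlonglongrightarrow> v w j"
      by (rule tendsto_eventually)
    ultimately show ?thesis unfolding bergman_inner_def using LIMSEQ_unique by blast
  qed
  ultimately show "\<exists>f\<in>bergman_space \<alpha>. \<forall>w\<in>\<Lambda>. \<forall>j<m w.
      bergman_inner \<alpha> f (bergman_shift \<alpha> (L w) w (bergman_basis \<alpha> j)) = v w j"
    unfolding T_def by blast
qed

theorem theorem1p5:
  fixes \<alpha> :: real and \<Lambda> :: "complex set" and m :: "complex \<Rightarrow> nat"
    and L :: "complex \<Rightarrow> complex \<Rightarrow> complex"
  assumes "\<alpha> > -1"
    and "divisor \<Lambda> m"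
    and "\<forall>w\<in>\<Lambda>. deriv_log_branch w (L w)"
  shows "(interpolating \<alpha> L \<Lambda> m \<longrightarrow>
            (\<exists>C::real. C > 0 \<and>
               disjoint_family_on
                 (\<lambda>w. pseudohyp_disk w (sqrt ((real (m w) - C) / (real (m w) + \<alpha> + 1))))
                 {w\<in>\<Lambda>. real (m w) > C})) \<and>
         ((\<exists>C::real. (\<alpha> + 1) * (1 - exp (-1)) < C \<and> C < \<alpha> + 1 \<and>
               disjoint_family_on
                 (\<lambda>w. pseudohyp_disk w (sqrt ((real (m w) + C) / (real (m w) + \<alpha> + 1))))
                 \<Lambda>) \<longrightarrow>
            interpolating \<alpha> L \<Lambda> m)"
proof (intro conjI impI)
  assume "interpolating \<alpha> L \<Lambda> m"
  then show "\<exists>C::real. C > 0 \<and> disjoint_family_on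
      (\<lambda>w. pseudohyp_disk w (sqrt ((real (m w) - C) / (real (m w) + \<alpha> + 1)))) {w\<in>\<Lambda>. real (m w) > C}"
    by (rule interpolating_imp_disjoint[OF assms])
next
  assume "\<exists>C::real. (\<alpha> + 1) * (1 - exp (-1)) < C \<and> C < \<alpha> + 1 \<and> disjoint_family_on
      (\<lambda>w. pseudohyp_disk w (sqrt ((real (m w) + C) / (real (m w) + \<alpha> + 1)))) \<Lambda>"
  then obtain C where C: "(\<alpha> + 1) * (1 - exp (-1)) < C" "C < \<alpha> + 1" "disjoint_family_on
      (\<lambda>w. pseudohyp_disk w (sqrt ((real (m w) + C) / (real (m w) + \<alpha> + 1)))) \<Lambda>" by blast
  \<comment> \<open>Since e \<ge> 2, the hypothesis on C yields C > (\<alpha>+1)/2, the condition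
    under which a suitable \<open>a\<close> exists.\<close>
  have "exp (-1) \<le> (1/2 :: real)"
    using exp_ge_add_one_self[of 1] by (simp add: exp_minus field_simps)
  then have "(\<alpha> + 1) * (1 / 2) \<le> (\<alpha> + 1) * (1 - exp (-1))"
    using assms(1) by (intro mult_left_mono) auto
  then have "(\<alpha> + 1) / 2 < C" using C(1) by simp
  then show "interpolating \<alpha> L \<Lambda> m"
    by (rule disjoint_imp_interpolating[OF assms(1) _ C(2) assms(2,3) C(3)])
qed

end
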